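(* Let $q\in\mathbb{C}^\times$ be transcendental. The Grothendieck ring $\operatorname{Rep}(U_q(\tilde{\mathfrak{sl}}_2))$ of the category of finite-dimensional type $\boldsymbol{1}$ representations of the quantum affine algebra $U_q(\tilde{\mathfrak{sl}}_2)$ is commutative.
   Context: $U_q(\tilde{\mathfrak{sl}}_2)$ is the Hopf algebra over $\mathbb{C}$ with generators $K_i^{\pm1},X_i^\pm$ ($i=0,1$) and relations, with $a_{00}=a_{11}=2$, $a_{01}=a_{10}=-2$ and $[n]_q=\frac{q^n-q^{-n}}{q-q^{-1}}$: $K_iK_i^{-1}=K_i^{-1}K_i=1$, $K_0K_1=K_1K_0$, $K_iX_j^\pm K_i^{-1}=q^{\pm a_{ij}}X_j^\pm$, $[X_i^+,X_j^-]=\delta_{ij}\frac{K_i-K_i^{-1}}{q-q^{-1}}$, and for $i\ne j$ $$(X_i^\pm)^3X_j^\pm-[3]_q(X_i^\pm)^2X_j^\pm X_i^\pm+[3]_qX_i^\pm X_j^\pm(X_i^\pm)^2-X_j^\pm(X_i^\pm)^3=0,$$ together with an adjoined invertible central group-like square root $\mathcal{C}^{1/2}$ of the central element $\mathcal{C}=K_0K_1$. The comultiplication is $\Delta(K_i)=K_i\otimes K_i$, $\Delta(X_i^+)=X_i^+\otimes K_i+1\otimes X_i^+$, $\Delta(X_i^-)=X_i^-\otimes1+K_i^{-1}\otimes X_i^-$, the counit is $\epsilon(K_i)=1$, $\epsilon(X_i^\pm)=0$, and the antipode is $S(K_i)=K_i^{-1}$, $S(X_i^+)=-X_i^+K_i^{-1}$,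 $S(X_i^-)=-K_iX_i^-$. A representation $V$ is of type $\boldsymbol 1$ if $K_0,K_1$ act semisimply on $V$ with eigenvalues that are integer powers of $q$, and $\mathcal{C}^{1/2}$ acts as the identity on $V$. The finite-dimensional type $\boldsymbol 1$ representations form an abelian monoidal category, with tensor product of representations defined via $\Delta$. The Grothendieck ring of an abelian monoidal category is the free abelian group on isomorphism classes $[U]$ of objects modulo the relations $[W]=[U]+[V]$ for all short exact sequences $U\to W\to V$, with product $[U][V]=[U\otimes V]$. *)

theory Defs
  imports
    "HOL-Library.Poly_Mapping"
    "HOL-Library.Product_Plus"
    "HOL-Algebra.Free_Abelian_Groups"
    "HOL-Algebra.QuotRing"
    "Jordan_Normal_Form.Char_Poly"
    "Jordan_Normal_Form.Matrix_Kernel"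
begin

section \<open>Free associative algebras over the complex numbers\<close>

text \<open>
  Words form the free monoid under concatenation. It is written additively because
  the convolution product on finitely supported functions expects an additive monoid
  of keys. Hence \<open>'g free_alg\<close> is the free unital associative algebra on
  \<open>'g\<close>, and \<open>'g free_alg2\<close>, whose keys are pairs of words, is its tensor
  square: the product there is \<open>(a \<otimes> b) (c \<otimes> d) = ac \<otimes> bd\<close>.
\<close>

datatype 'g word = Word (letters: "'g list")

instantiation word :: (type) monoid_add
begin

definition zero_word :: "'a word" where
  "0 = Word []"

definition plus_word :: "'a word \<Rightarrow> 'a word \<Rightarrow> 'a word" where
  "u + v = Word (letters u @ letters v)"

instance
  by intro_classes (simp_all add: zero_word_def plus_word_def)

end

type_synonym 'g free_alg = "'g word \<Rightarrow>\<^sub>0 complex"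
type_synonym 'g free_alg2 = "('g word \<times> 'g word) \<Rightarrow>\<^sub>0 complex"

abbreviation scal :: "complex \<Rightarrow> 'm::zero \<Rightarrow>\<^sub>0 complex" where
  "scal c \<equiv> Poly_Mapping.single 0 c"

abbreviation gen :: "'g \<Rightarrow> 'g free_alg" where
  "gen x \<equiv> Poly_Mapping.single (Word [x]) 1"

definition tens :: "'g free_alg \<Rightarrow> 'g free_alg \<Rightarrow> 'g free_alg2" (infixl "\<otimes>\<^sub>F" 75) where
  "f \<otimes>\<^sub>F g = (\<Sum>u\<in>Poly_Mapping.keys f. \<Sum>v\<in>Poly_Mapping.keys g.
     Poly_Mapping.single (u, v) (Poly_Mapping.lookup f u * Poly_Mapping.lookup g v))"

text \<open>
  The unital algebra homomorphism out of the free algebra with prescribed values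
  \<open>h\<close> on the generators; \<open>s\<close> embeds the scalars into the target algebra.
\<close>

definition free_lift :: "(complex \<Rightarrow> 'r::ring_1) \<Rightarrow> ('g \<Rightarrow> 'r) \<Rightarrow> 'g free_alg \<Rightarrow> 'r" where
  "free_lift s h f =
     (\<Sum>w\<in>Poly_Mapping.keys f. s (Poly_Mapping.lookup f w) * prod_list (map h (letters w)))"


section \<open>The quantum affine algebra\<close>

datatype node = N0 | N1

definition cartan :: "node \<Rightarrow> node \<Rightarrow> int" where
  "cartan i j = (if i = j then 2 else - 2)"

definition qint :: "complex \<Rightarrow> nat \<Rightarrow> complex" where
  "qint q n = (q ^ n - inverse q ^ n) / (q - inverse q)"

text \<open>\<open>CSqrt\<close> is the adjoined square root of the central element \<open>K\<^sub>0 K\<^sub>1\<close>.\<close>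

datatype uq_gen = K node | KInv node | XPlus node | XMinus node | CSqrt | CSqrtInv

definition serre :: "complex \<Rightarrow> uq_gen free_alg \<Rightarrow> uq_gen free_alg \<Rightarrow> uq_gen free_alg" where
  "serre q x y = x ^ 3 * y - scal (qint q 3) * x ^ 2 * y * x
     + scal (qint q 3) * x * y * x ^ 2 - y * x ^ 3"

text \<open>Each defining relation \<open>l = r\<close> is recorded as the element \<open>l - r\<close>.\<close>

inductive_set uq_relators :: "complex \<Rightarrow> uq_gen free_alg set" for q :: complex where
  K_KInv: "gen (K i) * gen (KInv i) - 1 \<in> uq_relators q"
| KInv_K: "gen (KInv i) * gen (K i) - 1 \<in> uq_relators q"
| K_comm: "gen (K N0) * gen (K N1) - gen (K N1) * gen (K N0) \<in> uq_relators q"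
| K_XPlus: "gen (K i) * gen (XPlus j) * gen (KInv i)
      - scal (q powi cartan i j) * gen (XPlus j) \<in> uq_relators q"
| K_XMinus: "gen (K i) * gen (XMinus j) * gen (KInv i)
      - scal (q powi (- cartan i j)) * gen (XMinus j) \<in> uq_relators q"
| XPlus_XMinus: "gen (XPlus i) * gen (XMinus j) - gen (XMinus j) * gen (XPlus i)
      - (if i = j then scal (1 / (q - inverse q)) * (gen (K i) - gen (KInv i)) else 0)
      \<in> uq_relators q"
| serre_plus: "i \<noteq> j \<Longrightarrow> serre q (gen (XPlus i)) (gen (XPlus j)) \<in> uq_relators q"
| serre_minus: "i \<noteq> j \<Longrightarrow> serre q (gen (XMinus i)) (gen (XMinus j)) \<in> uq_relators q"
| CSqrt_CSqrtInv: "gen CSqrt * gen CSqrtInv - 1 \<in> uq_relators q"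
| CSqrtInv_CSqrt: "gen CSqrtInv * gen CSqrt - 1 \<in> uq_relators q"
| CSqrt_central: "gen CSqrt * gen x - gen x * gen CSqrt \<in> uq_relators q"
| CSqrt_square: "gen CSqrt ^ 2 - gen (K N0) * gen (K N1) \<in> uq_relators q"

definition uq_ideal :: "complex \<Rightarrow> uq_gen free_alg set" where
  "uq_ideal q = genideal class_ring (uq_relators q)"

definition Uq :: "complex \<Rightarrow> uq_gen free_alg set ring" where
  "Uq q = class_ring Quot uq_ideal q"

definition uq_class :: "complex \<Rightarrow> uq_gen free_alg \<Rightarrow> uq_gen free_alg set" where
  "uq_class q f = uq_ideal q +>\<^bsub>class_ring\<^esub> f"

text \<open>
  The comultiplication and the counit are given on the free algebra. They descend to
  \<open>Uq q\<close> since the defining relations are respected, and are only used through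
  the representations they induce there.
\<close>

primrec comult_gen :: "uq_gen \<Rightarrow> uq_gen free_alg2" where
  "comult_gen (K i) = gen (K i) \<otimes>\<^sub>F gen (K i)"
| "comult_gen (KInv i) = gen (KInv i) \<otimes>\<^sub>F gen (KInv i)"
| "comult_gen (XPlus i) = gen (XPlus i) \<otimes>\<^sub>F gen (K i) + 1 \<otimes>\<^sub>F gen (XPlus i)"
| "comult_gen (XMinus i) = gen (XMinus i) \<otimes>\<^sub>F 1 + gen (KInv i) \<otimes>\<^sub>F gen (XMinus i)"
| "comult_gen CSqrt = gen CSqrt \<otimes>\<^sub>F gen CSqrt"
| "comult_gen CSqrtInv = gen CSqrtInv \<otimes>\<^sub>F gen CSqrtInv"

definition comult :: "uq_gen free_alg \<Rightarrow> uq_gen free_alg2" where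
  "comult = free_lift scal comult_gen"

primrec counit_gen :: "uq_gen \<Rightarrow> complex" where
  "counit_gen (K i) = 1"
| "counit_gen (KInv i) = 1"
| "counit_gen (XPlus i) = 0"
| "counit_gen (XMinus i) = 0"
| "counit_gen CSqrt = 1"
| "counit_gen CSqrtInv = 1"

definition counit :: "uq_gen free_alg \<Rightarrow> complex" where
  "counit = free_lift (\<lambda>c. c) counit_gen"


section \<open>Finite-dimensional representations of type 1\<close>

text \<open>
  A pair \<open>(n, \<rho>)\<close> stands for the space of column vectors of length \<open>n\<close>
  (with \<open>n = 0\<close> allowed) on which \<open>a\<close> acts by the matrix \<open>\<rho> a\<close>.
  Every finite-dimensional representation is isomorphic to one of these.
\<close>

type_synonym uq_rep = "nat \<times> (uq_gen free_alg set \<Rightarrow> complex mat)"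

definition is_rep :: "complex \<Rightarrow> uq_rep \<Rightarrow> bool" where
  "is_rep q V = (case V of (n, \<rho>) \<Rightarrow>
     \<rho> \<in> Ring.ring_hom (Uq q) (ring_mat TYPE(complex) n ()) \<and>
     (\<forall>c. \<rho> (uq_class q (scal c)) = c \<cdot>\<^sub>m 1\<^sub>m n))"

definition diagonalizable :: "complex mat \<Rightarrow> bool" where
  "diagonalizable A = (\<exists>D. similar_mat A D \<and> diagonal_mat D)"

text \<open>Over the complex numbers, acting semisimply means acting diagonalizably.\<close>

definition type_one :: "complex \<Rightarrow> uq_rep \<Rightarrow> bool" where
  "type_one q V = (case V of (n, \<rho>) \<Rightarrow>
     (\<forall>i. diagonalizable (\<rho> (uq_class q (gen (K i)))) \<and>
          (\<forall>c. eigenvalue (\<rho> (uq_class q (gen (K i)))) c \<longrightarrow> (\<exists>k::int. c = q powi k))) \<and>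
     \<rho> (uq_class q (gen CSqrt)) = 1\<^sub>m n)"

definition uq_reps :: "complex \<Rightarrow> uq_rep set" where
  "uq_reps q = {V. is_rep q V \<and> type_one q V}"

definition rep_hom :: "complex \<Rightarrow> uq_rep \<Rightarrow> uq_rep \<Rightarrow> complex mat set" where
  "rep_hom q V W = (case (V, W) of ((m, \<rho>), (n, \<sigma>)) \<Rightarrow>
     {T \<in> carrier_mat n m. \<forall>a\<in>carrier (Uq q). T * \<rho> a = \<sigma> a * T})"

definition rep_iso :: "complex \<Rightarrow> uq_rep \<Rightarrow> uq_rep \<Rightarrow> bool" where
  "rep_iso q V W = (\<exists>T\<in>rep_hom q V W. \<exists>S\<in>rep_hom q W V.
     S * T = 1\<^sub>m (fst V) \<and> T * S = 1\<^sub>m (fst W))"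

text \<open>A short exact sequence from \<open>U\<close> through \<open>W\<close> to \<open>V\<close>, in this order.\<close>

definition rep_ses :: "complex \<Rightarrow> uq_rep \<Rightarrow> uq_rep \<Rightarrow> uq_rep \<Rightarrow> bool" where
  "rep_ses q U W V = (\<exists>f\<in>rep_hom q U W. \<exists>g\<in>rep_hom q W V.
     inj_on ((*\<^sub>v) f) (carrier_vec (fst U)) \<and>
     (*\<^sub>v) f ` carrier_vec (fst U) = mat_kernel g \<and>
     (*\<^sub>v) g ` carrier_vec (fst W) = carrier_vec (fst V))"

text \<open>
  The Kronecker product: the matrix of \<open>A \<otimes> B\<close> in the basis
  \<open>e\<^sub>i \<otimes> e\<^sub>j\<close>, which is placed at position \<open>i * n + j\<close> with
  \<open>n\<close> the dimension of the second factor.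
\<close>

definition kron :: "complex mat \<Rightarrow> complex mat \<Rightarrow> complex mat" where
  "kron A B = mat (dim_row A * dim_row B) (dim_col A * dim_col B)
     (\<lambda>(i, j). A $$ (i div dim_row B, j div dim_col B) * B $$ (i mod dim_row B, j mod dim_col B))"

text \<open>
  \<open>tens_action q V W t\<close> is the image of \<open>t\<close> under the algebra homomorphism
  \<open>\<rho> \<otimes> \<sigma>\<close>. In \<open>rep_tensor\<close> the set whose element is taken is a
  singleton for every element of \<open>Uq q\<close>: the matrix does not depend on the
  representative, as \<open>comult\<close> respects the defining relations.
\<close>

definition tens_action :: "complex \<Rightarrow> uq_rep \<Rightarrow> uq_rep \<Rightarrow> uq_gen free_alg2 \<Rightarrow> complex mat" where
  "tens_action q V W t = (case (V, W) of ((m, \<rho>), (n, \<sigma>)) \<Rightarrow>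
     finsum (ring_mat TYPE(complex) (m * n) ())
       (\<lambda>(u, v). Poly_Mapping.lookup t (u, v) \<cdot>\<^sub>m
          kron (\<rho> (uq_class q (Poly_Mapping.single u 1)))
               (\<sigma> (uq_class q (Poly_Mapping.single v 1))))
       (Poly_Mapping.keys t))"

definition rep_tensor :: "complex \<Rightarrow> uq_rep \<Rightarrow> uq_rep \<Rightarrow> uq_rep" where
  "rep_tensor q V W =
     (fst V * fst W, \<lambda>a. the_elem ((\<lambda>f. tens_action q V W (comult f)) ` a))"

definition rep_unit :: uq_rep where
  "rep_unit = (1, \<lambda>a. the_elem ((\<lambda>f. counit f \<cdot>\<^sub>m 1\<^sub>m 1) ` a))"


section \<open>Grothendieck rings\<close>

text \<open>
  The data are a set \<open>Ob\<close> of objects, the isomorphism relation \<open>isom\<close>, the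
  relation \<open>ses U W V\<close> of fitting into a short exact sequence, the tensor product and
  the unit object. The Grothendieck ring is the quotient of the free abelian group on the
  isomorphism classes, with the bilinear extension of the product of classes, by the
  subgroup (not a priori an ideal) generated by the elements \<open>[W] - [U] - [V]\<close>.
\<close>

definition iso_class :: "'o set \<Rightarrow> ('o \<Rightarrow> 'o \<Rightarrow> bool) \<Rightarrow> 'o \<Rightarrow> 'o set" where
  "iso_class Ob isom U = {V \<in> Ob. isom U V}"

definition class_tensor ::
    "'o set \<Rightarrow> ('o \<Rightarrow> 'o \<Rightarrow> bool) \<Rightarrow> ('o \<Rightarrow> 'o \<Rightarrow> 'o) \<Rightarrow> 'o set \<Rightarrow> 'o set \<Rightarrow> 'o set" where
  "class_tensor Ob isom ten A B = {W \<in> Ob. \<exists>U\<in>A. \<exists>V\<in>B. isom (ten U V) W}"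

definition class_group_ring ::
    "'o set \<Rightarrow> ('o \<Rightarrow> 'o \<Rightarrow> bool) \<Rightarrow> ('o \<Rightarrow> 'o \<Rightarrow> 'o) \<Rightarrow> 'o \<Rightarrow> ('o set \<Rightarrow>\<^sub>0 int) ring" where
  "class_group_ring Ob isom ten unit = \<lparr>
     carrier = carrier (free_Abelian_group (iso_class Ob isom ` Ob)),
     monoid.mult = (\<lambda>f g. \<Sum>A\<in>Poly_Mapping.keys f. \<Sum>B\<in>Poly_Mapping.keys g.
       Poly_Mapping.single (class_tensor Ob isom ten A B)
         (Poly_Mapping.lookup f A * Poly_Mapping.lookup g B)),
     monoid.one = Poly_Mapping.single (iso_class Ob isom unit) 1,
     zero = 0,
     add = (+)\<rparr>"

definition ses_relators ::
    "'o set \<Rightarrow> ('o \<Rightarrow> 'o \<Rightarrow> bool) \<Rightarrow> ('o \<Rightarrow> 'o \<Rightarrow> 'o \<Rightarrow> bool) \<Rightarrow> ('o set \<Rightarrow>\<^sub>0 int) set" where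
  "ses_relators Ob isom ses =
     {Poly_Mapping.single (iso_class Ob isom W) 1 - Poly_Mapping.single (iso_class Ob isom U) 1
        - Poly_Mapping.single (iso_class Ob isom V) 1 | U W V.
      U \<in> Ob \<and> W \<in> Ob \<and> V \<in> Ob \<and> ses U W V}"

definition grothendieck_ring ::
    "'o set \<Rightarrow> ('o \<Rightarrow> 'o \<Rightarrow> bool) \<Rightarrow> ('o \<Rightarrow> 'o \<Rightarrow> 'o \<Rightarrow> bool) \<Rightarrow> ('o \<Rightarrow> 'o \<Rightarrow> 'o) \<Rightarrow> 'o
      \<Rightarrow> ('o set \<Rightarrow>\<^sub>0 int) set ring" where
  "grothendieck_ring Ob isom ses ten unit =
     class_group_ring Ob isom ten unit Quot
       generate (free_Abelian_group (iso_class Ob isom ` Ob)) (ses_relators Ob isom ses)"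

definition Rep_ring :: "complex \<Rightarrow> (uq_rep set \<Rightarrow>\<^sub>0 int) set ring" where
  "Rep_ring q = grothendieck_ring (uq_reps q) (rep_iso q) (rep_ses q) (rep_tensor q) rep_unit"

end

theory Submission
  imports Defs
begin

text \<open>
  A type 1 representation has level zero: \<open>K\<^sub>0 = K\<^sub>1\<^sup>-\<^sup>1\<close> there. Composing the antipode with the
  exchange of the two nodes gives a map that reverses both products and coproducts and fixes
  \<open>K\<^sub>1\<close>; transposing matrices along it yields a contravariant exact duality with
  \<open>(V \<otimes> W)* \<cong> W* \<otimes> V*\<close>. If \<open>[V*] = [V]\<close> for every \<open>V\<close>, then
  \<open>[V][W] = [(V \<otimes> W)*] = [W*][V*] = [W][V]\<close>.

  By exactness only irreducible \<open>V\<close> matter, and these are even isomorphic to their duals.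
  In Drinfeld's loop generators the duality exchanges \<open>x\<^sub>i\<close> and \<open>y\<^sub>i\<^sub>+\<^sub>1\<close> and fixes the commuting
  operators \<open>\<psi>\<^sub>s\<close>. Let \<open>v\<close> and \<open>v'\<close> be vectors of highest weight in \<open>V\<close> and \<open>V*\<close> that pair to a
  nonzero number. A weight argument shows that the submodule of \<open>V \<oplus> V*\<close> generated by
  \<open>(v, v')\<close> is the graph of an isomorphism.
\<close>

section \<open>Algebras over the complex numbers\<close>

text \<open>The classical route reads off a class from its q-character and rests on the full
  Drinfeld presentation. Here only those loop relations are established that the self-duality of
  irreducibles consumes, and only inside a finite-dimensional representation, where weights are
  bounded. Boundedness enters through one rank one principle: an operator of weight q^4 that
  commutes with the lowering operator of a quantum sl2 is zero. It gives x_{l+1} x_l = q^2 x_l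
  x_{l+1} for all l. Bracketed with y this becomes the exchange relation between x and psi; written
  out at l = 0 it is the cubic Serre relation. So the Serre relations of duals and tensor products
  come for free from the other relations. The exchange of the nodes is part of the duality because
  the antipode alone inverts K_1 and would turn a highest weight vector into a lowest one. With
  weights preserved and every psi_s transposed into itself, the top weight spaces of V and of its
  dual carry transposed actions of the same commuting family, and this is what makes a pairing
  argument possible.\<close>

class complex_algebra = ring_1 +
  fixes scaleC :: "complex \<Rightarrow> 'a \<Rightarrow> 'a" (infixr "*\<^sub>C" 75)
  assumes scaleC_add_right: "a *\<^sub>C (x + y) = a *\<^sub>C x + a *\<^sub>C y"
    and scaleC_add_left: "(a + b) *\<^sub>C x = a *\<^sub>C x + b *\<^sub>C x"
    and scaleC_scaleC [simp]: "a *\<^sub>C b *\<^sub>C x = (a * b) *\<^sub>C x"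
    and scaleC_one [simp]: "1 *\<^sub>C x = x"
    and mult_scaleC_left [simp]: "(a *\<^sub>C x) * y = a *\<^sub>C (x * y)"
    and mult_scaleC_right [simp]: "x * (a *\<^sub>C y) = a *\<^sub>C (x * y)"
begin

lemma scaleC_zero_left [simp]: "0 *\<^sub>C x = 0"
  using scaleC_add_left[of 0 0 x] by simp

lemma scaleC_zero_right [simp]: "a *\<^sub>C 0 = 0"
  using scaleC_add_right[of a 0 0] by simp

lemma scaleC_minus_left [simp]: "(- a) *\<^sub>C x = - (a *\<^sub>C x)"
  using scaleC_add_left[of "- a" a x] by (simp add: eq_neg_iff_add_eq_0)

lemma scaleC_minus_right [simp]: "a *\<^sub>C (- x) = - (a *\<^sub>C x)"
  using scaleC_add_right[of a "- x" x] by (simp add: eq_neg_iff_add_eq_0)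

lemma scaleC_diff_right: "a *\<^sub>C (x - y) = a *\<^sub>C x - a *\<^sub>C y"
  using scaleC_add_right[of a x "- y"] by simp

lemma scaleC_diff_left: "(a - b) *\<^sub>C x = a *\<^sub>C x - b *\<^sub>C x"
  using scaleC_add_left[of a "- b" x] by simp

lemmas scaleC_distribs =
  scaleC_add_right scaleC_add_left scaleC_diff_right scaleC_diff_left

lemma scaleC_eq_0_iff [simp]: "a *\<^sub>C x = 0 \<longleftrightarrow> a = 0 \<or> x = 0"
proof
  assume "a *\<^sub>C x = 0"
  moreover have "inverse a *\<^sub>C a *\<^sub>C x = x" if "a \<noteq> 0"
    using that by simp
  ultimately show "a = 0 \<or> x = 0" by (metis scaleC_zero_right)
qed auto

lemma scaleC_left_cancel: "a \<noteq> 0 \<Longrightarrow> a *\<^sub>C x = a *\<^sub>C y \<longleftrightarrow> x = y"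
  using scaleC_eq_0_iff[of a "x - y"] by (simp add: scaleC_diff_right)

end

section \<open>Rank one: quantum sl2 at a parameter that is no root of unity\<close>

locale generic_parameter =
  fixes q :: complex
  assumes q_nonzero [simp]: "q \<noteq> 0"
    and q_power: "\<And>m. m > 0 \<Longrightarrow> q ^ m \<noteq> 1"
begin

lemma q_minus_inverse [simp]: "q - 1 / q \<noteq> 0"
proof
  assume "q - 1 / q = 0"
  then have "q ^ 2 = 1" by (simp add: field_simps power2_eq_square)
  then show False using q_power[of 2] by simp
qed

lemma q_plus_inverse [simp]: "q + 1 / q \<noteq> 0"
proof
  assume "q + 1 / q = 0"
  then have "q * q = -1" by (simp add: field_simps eq_neg_iff_add_eq_0)
  then have "(q * q) * (q * q) = 1" by simp
  then have "q ^ 4 = 1" by (simp add: power4_eq_xxxx mult.assoc)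
  then show False using q_power[of 4] by simp
qed

lemma q_powi_diff_inverse:
  assumes "m > 0"
  shows "q ^ m - 1 / q ^ m \<noteq> 0"
proof
  assume "q ^ m - 1 / q ^ m = 0"
  then have "q ^ (2 * m) = 1" by (simp add: field_simps power_mult power2_eq_square power_mult_distrib)
  then show False using q_power[of "2 * m"] assms by simp
qed

end

text \<open>\<open>weights_bounded\<close> stands in for finite dimension: conjugation by
  \<open>k\<close> has no eigenvalue q^m for large m. It speaks of elements of the algebra and not
  of vectors, since the argument uses the adjoint action.\<close>

locale uq_sl2_triple = generic_parameter q for q +
  fixes k ki e f :: "'a::complex_algebra"
  assumes k_ki [simp]: "k * ki = 1" and ki_k [simp]: "ki * k = 1"
    and k_e: "k * e = q\<^sup>2 *\<^sub>C (e * k)"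
    and e_f: "e * f - f * e = (1 / (q - 1 / q)) *\<^sub>C (k - ki)"
    and weights_bounded: "\<exists>M. \<forall>m\<ge>M. \<forall>u. k * u = q ^ m *\<^sub>C (u * k) \<longrightarrow> u = 0"
begin

text \<open>The iterated quantum adjoint action of \<open>e\<close>, sending u to e u - (k u ki) e.
  The factors q^(4 + 2j) are the weights of the iterates when \<open>w\<close> has weight
  q^4.\<close>

primrec adj_pow :: "'a \<Rightarrow> nat \<Rightarrow> 'a" where
  "adj_pow w 0 = w"
| "adj_pow w (Suc j) = e * adj_pow w j - q ^ (4 + 2 * j) *\<^sub>C (adj_pow w j * e)"

lemma k_conj_ki:
  assumes "k * w = c *\<^sub>C (w * k)" "c \<noteq> 0"
  shows "ki * w = (1 / c) *\<^sub>C (w * ki)"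
proof -
  have "w * ki = ki * (k * w) * ki" by (simp flip: mult.assoc)
  also have "\<dots> = c *\<^sub>C (ki * w * (k * ki))" using assms(1) by (simp add: mult.assoc)
  finally have "w * ki = c *\<^sub>C (ki * w)" by simp
  then show ?thesis using assms(2) by simp
qed

lemma adj_pow_weight:
  assumes "k * w = q ^ 4 *\<^sub>C (w * k)"
  shows "k * adj_pow w j = q ^ (4 + 2 * j) *\<^sub>C (adj_pow w j * k)"
proof (induction j)
  case 0
  then show ?case using assms by simp
next
  case (Suc j)
  let ?w = "adj_pow w j"
  have "k * (e * ?w) = q ^ (4 + 2 * Suc j) *\<^sub>C (e * ?w * k)"
  proof -
    have "k * (e * ?w) = q\<^sup>2 *\<^sub>C (e * (k * ?w))" using k_e by (simp flip: mult.assoc)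
    also have "\<dots> = q ^ (4 + 2 * Suc j) *\<^sub>C (e * ?w * k)"
      by (simp add: Suc mult.assoc flip: power_add)
    finally show ?thesis .
  qed
  moreover have "k * (?w * e) = q ^ (4 + 2 * Suc j) *\<^sub>C (?w * e * k)"
  proof -
    have "k * (?w * e) = q ^ (4 + 2 * j) *\<^sub>C (?w * (k * e))" using Suc by (simp flip: mult.assoc)
    also have "\<dots> = q ^ (4 + 2 * Suc j) *\<^sub>C (?w * e * k)"
      by (simp add: k_e mult.assoc add.commute flip: power_add)
    finally show ?thesis .
  qed
  ultimately show ?case
    by (simp add: right_diff_distrib left_diff_distrib scaleC_distribs mult.commute)
qed

text \<open>\<open>w\<close> is a lowest weight vector of weight 4 for the adjoint action, and
  \<open>a j\<close> is the familiar coefficient [j]_q [j+3]_q by which f undoes the j-th power of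
  e. It is the sum of [4+2i]_q over i < j.\<close>

lemma adj_pow_bracket:
  assumes w: "k * w = q ^ 4 *\<^sub>C (w * k)" "w * f = f * w"
  defines "a \<equiv> \<lambda>j. (q ^ j - 1 / q ^ j) * (q ^ (j + 3) - 1 / q ^ (j + 3)) / (q - 1 / q)\<^sup>2"
  shows "adj_pow w (Suc j) * f - f * adj_pow w (Suc j) = a (Suc j) *\<^sub>C (adj_pow w j * ki)"
proof -
  define \<psi> where "\<psi> = (1 / (q - 1 / q)) *\<^sub>C (k - ki)"
  have ef: "e * f = f * e + \<psi>" using e_f by (simp add: \<psi>_def algebra_simps)
  have psi: "\<psi> * adj_pow w j - q ^ (4 + 2 * j) *\<^sub>C (adj_pow w j * \<psi>)
      = ((q ^ (4 + 2 * j) - 1 / q ^ (4 + 2 * j)) / (q - 1 / q)) *\<^sub>C (adj_pow w j * ki)" for j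
  proof -
    have "ki * adj_pow w j = (1 / q ^ (4 + 2 * j)) *\<^sub>C (adj_pow w j * ki)"
      using k_conj_ki[OF adj_pow_weight[OF w(1)]] by simp
    then show ?thesis using adj_pow_weight[OF w(1), of j]
      by (simp add: \<psi>_def algebra_simps scaleC_distribs diff_divide_distrib)
  qed
  have step: "adj_pow w (Suc j) * f - f * adj_pow w (Suc j)
     = e * (adj_pow w j * f - f * adj_pow w j)
       - q ^ (4 + 2 * j) *\<^sub>C ((adj_pow w j * f - f * adj_pow w j) * e)
       + (\<psi> * adj_pow w j - q ^ (4 + 2 * j) *\<^sub>C (adj_pow w j * \<psi>))" for j
  proof -
    have "e * (f * v) = f * (e * v) + \<psi> * v" for v
      using ef by (metis distrib_right mult.assoc)
    then show ?thesis by (simp add: algebra_simps scaleC_distribs ef)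
  qed
  \<comment> \<open>In q-integers: [j+1] [j+4] + [2j+6] = [j+2] [j+5].\<close>
  have a_step: "a (Suc j) + (q ^ (4 + 2 * Suc j) - 1 / q ^ (4 + 2 * Suc j)) / (q - 1 / q) = a (Suc (Suc j))" for j
  proof -
    define p r t where "p = q ^ j" and "r = 1 / q" and "t = 1 / p"
    have inv: "q * r = 1" by (simp add: r_def)
    define A B C A' B' where "A = q ^ Suc j - 1 / q ^ Suc j" and "B = q ^ (Suc j + 3) - 1 / q ^ (Suc j + 3)"
      and "C = q ^ (4 + 2 * Suc j) - 1 / q ^ (4 + 2 * Suc j)"
      and "A' = q ^ Suc (Suc j) - 1 / q ^ Suc (Suc j)"
      and "B' = q ^ (Suc (Suc j) + 3) - 1 / q ^ (Suc (Suc j) + 3)"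
    have "A = q * p - r * t" "B = q ^ 4 * p - r ^ 4 * t" "C = q ^ 6 * p\<^sup>2 - r ^ 6 * t\<^sup>2"
      "A' = q\<^sup>2 * p - r\<^sup>2 * t" "B' = q ^ 5 * p - r ^ 5 * t"
      by (simp_all add: A_def B_def C_def A'_def B'_def p_def r_def t_def power_add power_mult
          eval_nat_numeral power_mult_distrib power_divide algebra_simps)
    moreover have "(q * p - r * t) * (q ^ 4 * p - r ^ 4 * t) + (q ^ 6 * p\<^sup>2 - r ^ 6 * t\<^sup>2) * (q - r)
        = (q\<^sup>2 * p - r\<^sup>2 * t) * (q ^ 5 * p - r ^ 5 * t)"
    proof -
      \<comment> \<open>As polynomials in q, r, p, t the two sides differ by a multiple of 1 - q r,
        which vanishes.\<close>
      have "(q * p - r * t) * (q ^ 4 * p - r ^ 4 * t) + (q ^ 6 * p\<^sup>2 - r ^ 6 * t\<^sup>2) * (q - r)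
          = (q\<^sup>2 * p - r\<^sup>2 * t) * (q ^ 5 * p - r ^ 5 * t)
            + (1 - q * r) * (q ^ 5 * p\<^sup>2 + r ^ 5 * t\<^sup>2 - q * r ^ 4 * p * t - q ^ 4 * r * p * t)"
        by (simp add: algebra_simps eval_nat_numeral)
      then show ?thesis by (simp add: inv)
    qed
    ultimately have "A * B + C * (q - 1 / q) = A' * B'" by (simp add: r_def)
    moreover have "A * B / d\<^sup>2 + C / d = (A * B + C * d) / d\<^sup>2" if "d \<noteq> 0" for d
      using that by (simp add: power2_eq_square add_divide_distrib)
    ultimately have "A * B / (q - 1 / q)\<^sup>2 + C / (q - 1 / q) = A' * B' / (q - 1 / q)\<^sup>2"
      using q_minus_inverse by metis
    then show ?thesis unfolding a_def A_def B_def C_def A'_def B'_def .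
  qed
  show ?thesis
  proof (induction j)
    case 0
    have "a 1 = (q ^ 4 - 1 / q ^ 4) / (q - 1 / q)"
      by (simp add: a_def power2_eq_square)
    then show ?case using step[of 0] w(2) psi[of 0] by simp
  next
    case (Suc j)
    let ?w = "adj_pow w j"
    have kie: "ki * e = (1 / q\<^sup>2) *\<^sub>C (e * ki)" using k_conj_ki[OF k_e] by simp
    have "e * (?w * ki) - q ^ (4 + 2 * Suc j) *\<^sub>C (?w * ki * e) = adj_pow w (Suc j) * ki"
    proof -
      have "q ^ (4 + 2 * Suc j) / q\<^sup>2 = q ^ (4 + 2 * j)"
        by (simp add: eval_nat_numeral)
      then show ?thesis by (simp add: mult.assoc kie left_diff_distrib)
    qed
    then have "e * (a (Suc j) *\<^sub>C (?w * ki)) - q ^ (4 + 2 * Suc j) *\<^sub>C (a (Suc j) *\<^sub>C (?w * ki) * e)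
       = a (Suc j) *\<^sub>C (adj_pow w (Suc j) * ki)"
      by (simp add: scaleC_diff_right mult.commute del: adj_pow.simps
          flip: \<open>e * (?w * ki) - q ^ (4 + 2 * Suc j) *\<^sub>C (?w * ki * e) = adj_pow w (Suc j) * ki\<close>)
    then show ?case using step[of "Suc j"] Suc psi[of "Suc j"] a_step[of j]
      by (simp add: scaleC_add_left[symmetric] del: adj_pow.simps)
  qed
qed

text \<open>The rank one fact behind all Serre type relations: a lowest weight vector of the
  adjoint action has non-positive weight, if the weights are bounded.\<close>

lemma weight_four_commuting_eq_0:
  assumes w: "k * w = q ^ 4 *\<^sub>C (w * k)" "w * f = f * w"
  shows "w = 0"
proof -
  obtain M where M: "\<And>m u. m \<ge> M \<Longrightarrow> k * u = q ^ m *\<^sub>C (u * k) \<Longrightarrow> u = 0"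
    using weights_bounded by blast
  \<comment> \<open>The weight exponent 4 + 2M lies beyond the bound M. From there the vanishing
    descends, as the coefficients [j+1] [j+4] are nonzero and \<open>ki\<close> is
    invertible.\<close>
  have "adj_pow w M = 0" by (rule M[OF _ adj_pow_weight[OF w(1)]]) simp
  moreover have "adj_pow w j = 0" if "adj_pow w (Suc j) = 0" for j
  proof -
    have "((q ^ Suc j - 1 / q ^ Suc j) * (q ^ (Suc j + 3) - 1 / q ^ (Suc j + 3)) / (q - 1 / q)\<^sup>2)
       *\<^sub>C (adj_pow w j * ki) = 0"
      using adj_pow_bracket[OF w, of j] that by simp
    then have "adj_pow w j * ki = 0"
      using q_powi_diff_inverse[of "Suc j"] q_powi_diff_inverse[of "Suc j + 3"] q_minus_inverse
      by (simp del: power_Suc)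
    then have "adj_pow w j * (ki * k) = 0" by (simp flip: mult.assoc del: ki_k)
    then show ?thesis by simp
  qed
  ultimately have "adj_pow w 0 = 0" by (induction M) blast+
  then show ?thesis by simp
qed

end

section \<open>Loop generators at level zero\<close>

text \<open>Drinfeld's loop generators \<open>x\<^sub>i, y\<^sub>j\<close> at level zero are built from \<open>x\<^sub>0 = X\<^sub>1\<^sup>+\<close>, \<open>x\<^sub>-\<^sub>1 = K\<^sup>-\<^sup>1 X\<^sub>0\<^sup>-\<close>,
  \<open>y\<^sub>0 = X\<^sub>1\<^sup>-\<close> and \<open>y\<^sub>1 = X\<^sub>0\<^sup>+ K\<close>, where \<open>K = K\<^sub>1 = K\<^sub>0\<^sup>-\<^sup>1\<close>.\<close>

locale loop_datum = generic_parameter q for q +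
  fixes k ki x0 xm y0 y1 :: "'a::complex_algebra"
  assumes k_ki [simp]: "k * ki = 1" and ki_k [simp]: "ki * k = 1"
    and k_x0: "k * x0 = q\<^sup>2 *\<^sub>C (x0 * k)" and k_xm: "k * xm = q\<^sup>2 *\<^sub>C (xm * k)"
    and k_y0: "k * y0 = (1 / q\<^sup>2) *\<^sub>C (y0 * k)" and k_y1: "k * y1 = (1 / q\<^sup>2) *\<^sub>C (y1 * k)"
    and x0_xm: "x0 * xm = q\<^sup>2 *\<^sub>C (xm * x0)"
    and y1_y0: "y1 * y0 = (1 / q\<^sup>2) *\<^sub>C (y0 * y1)"
    and x0_y0: "x0 * y0 - y0 * x0 = (1 / (q - 1 / q)) *\<^sub>C (k - ki)"
    and xm_y1: "xm * y1 - y1 * xm = (1 / (q - 1 / q)) *\<^sub>C (k - ki)"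
    and bounded_above: "\<exists>M. \<forall>m\<ge>M. \<forall>u. k * u = q ^ m *\<^sub>C (u * k) \<longrightarrow> u = 0"
    and bounded_below: "\<exists>M. \<forall>m\<ge>M. \<forall>u. ki * u = q ^ m *\<^sub>C (u * ki) \<longrightarrow> u = 0"
begin

text \<open>\<open>h1\<close> and \<open>hm\<close> are Drinfeld's imaginary root generators of
  degree 1 and -1 divided by [2]_q, so that commutators with them shift the loop index with
  coefficient 1.\<close>

definition h1 where "h1 = (1 / (q + 1 / q)) *\<^sub>C (ki * (x0 * y1 - y1 * x0))"
definition hm where "hm = (1 / (q + 1 / q)) *\<^sub>C (k * (xm * y0 - y0 * xm))"

text \<open>Each half of the sequence grows from its own starting element, \<open>x0\<close> upwards
  and \<open>xm\<close> downwards. That the two halves fit together is the content of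
  \<open>xp_h1\<close> and \<open>xp_hm\<close>.\<close>

definition xp :: "int \<Rightarrow> 'a" where
  "xp i = (if i \<ge> 0 then ((\<lambda>u. h1 * u - u * h1) ^^ nat i) x0
           else ((\<lambda>u. hm * u - u * hm) ^^ nat (- 1 - i)) xm)"

definition ym :: "int \<Rightarrow> 'a" where
  "ym j = (if j \<ge> 1 then ((\<lambda>u. u * h1 - h1 * u) ^^ nat (j - 1)) y1
           else ((\<lambda>u. u * hm - hm * u) ^^ nat (- j)) y0)"

text \<open>Over q - 1/q, this is Drinfeld's psi^+_s for s > 0, minus psi^-_s for s < 0, and the
  difference of both at s = 0.\<close>

definition psi :: "int \<Rightarrow> 'a" where
  "psi s = xp 0 * ym s - ym s * xp 0"

definition psi0 where "psi0 = (1 / (q - 1 / q)) *\<^sub>C (k - ki)"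

lemma conj_iff:
  assumes "c \<noteq> 0"
  shows "k * w = c *\<^sub>C (w * k) \<longleftrightarrow> ki * w = (1 / c) *\<^sub>C (w * ki)"
proof
  assume *: "k * w = c *\<^sub>C (w * k)"
  have "w * ki = ki * (k * w) * ki" by (simp flip: mult.assoc)
  also have "\<dots> = c *\<^sub>C (ki * w * (k * ki))" using * by (simp add: mult.assoc)
  finally have "w * ki = c *\<^sub>C (ki * w)" by simp
  then show "ki * w = (1 / c) *\<^sub>C (w * ki)" using assms by simp
next
  assume *: "ki * w = (1 / c) *\<^sub>C (w * ki)"
  have "w * k = k * (ki * w) * k" by (simp flip: mult.assoc)
  also have "\<dots> = (1 / c) *\<^sub>C (k * w * (ki * k))" using * by (simp add: mult.assoc)
  finally have "w * k = (1 / c) *\<^sub>C (k * w)" by simp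
  then show "k * w = c *\<^sub>C (w * k)" using assms by simp
qed

text \<open>The mirror symmetry sends x_i to x_{-1-i} and y_j to y_{1-j}, at the cost of inverting q
  and exchanging \<open>k\<close> with \<open>ki\<close>. Interpreting the locale along it transfers
  statements about upward shifts to downward shifts.\<close>

lemma flip_datum: "loop_datum (1 / q) ki k xm x0 y1 y0"
proof
  show "1 / q \<noteq> 0" by simp
  show "(1 / q) ^ m \<noteq> 1" if "m > 0" for m
    using q_power[OF that] by (simp add: power_divide)
  have c: "ki * w = (1 / q)\<^sup>2 *\<^sub>C (w * ki)" if "k * w = q\<^sup>2 *\<^sub>C (w * k)" for w
    using conj_iff[of "q\<^sup>2" w] that by (simp add: power_divide)
  show "ki * xm = (1 / q)\<^sup>2 *\<^sub>C (xm * ki)" "ki * x0 = (1 / q)\<^sup>2 *\<^sub>C (x0 * ki)"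
    using c k_x0 k_xm by simp_all
  have c': "ki * w = (1 / (1 / q)\<^sup>2) *\<^sub>C (w * ki)" if "k * w = (1 / q\<^sup>2) *\<^sub>C (w * k)" for w
    using conj_iff[of "1 / q\<^sup>2" w] that by (simp add: power_divide)
  show "ki * y1 = (1 / (1 / q)\<^sup>2) *\<^sub>C (y1 * ki)" "ki * y0 = (1 / (1 / q)\<^sup>2) *\<^sub>C (y0 * ki)"
    using c' k_y0 k_y1 by simp_all
  show "xm * x0 = (1 / q)\<^sup>2 *\<^sub>C (x0 * xm)" using x0_xm by (simp add: power_divide)
  show "y0 * y1 = (1 / (1 / q)\<^sup>2) *\<^sub>C (y1 * y0)" using y1_y0 by (simp add: power_divide)
  have "1 / (1 / q - 1 / (1 / q)) = - (1 / (q - 1 / q))"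
    by (metis div_by_1 divide_divide_eq_right minus_diff_eq divide_minus_right mult_1)
  then show "xm * y1 - y1 * xm = (1 / (1 / q - 1 / (1 / q))) *\<^sub>C (ki - k)"
    "x0 * y0 - y0 * x0 = (1 / (1 / q - 1 / (1 / q))) *\<^sub>C (ki - k)"
    by (simp_all only: xm_y1 x0_y0 scaleC_minus_left flip: scaleC_minus_right) simp_all
  have e: "(k * u = (1 / q) ^ m *\<^sub>C (u * k)) = (ki * u = q ^ m *\<^sub>C (u * ki))"
    "(ki * u = (1 / q) ^ m *\<^sub>C (u * ki)) = (k * u = q ^ m *\<^sub>C (u * k))" for m u
    using conj_iff[of "1 / q ^ m" u] conj_iff[of "q ^ m" u] by (simp_all add: power_divide)
  show "\<exists>M. \<forall>m\<ge>M. \<forall>u. ki * u = (1 / q) ^ m *\<^sub>C (u * ki) \<longrightarrow> u = 0"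
    "\<exists>M. \<forall>m\<ge>M. \<forall>u. k * u = (1 / q) ^ m *\<^sub>C (u * k) \<longrightarrow> u = 0"
    using bounded_above bounded_below by (simp_all only: e)
qed (simp_all)

lemma k_ki_assoc [simp]: "k * (ki * u) = u" "ki * (k * u) = u"
  by (simp_all flip: mult.assoc)

lemma sq: "(q\<^sup>2 - 1 / q\<^sup>2) / (q - 1 / q) = q + 1 / q"
proof -
  have "q\<^sup>2 - 1 / q\<^sup>2 = (q + 1 / q) * (q - 1 / q)" by (simp add: algebra_simps power2_eq_square)
  then show ?thesis using q_minus_inverse by (simp del: q_minus_inverse)
qed

text \<open>The coefficients are chosen so that the two contributions of \<open>ki\<close>
  cancel.\<close>

lemma psi0_shift:
  assumes "k * x = c *\<^sub>C (x * k)" "c \<noteq> 0"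
  shows "c *\<^sub>C (psi0 * x) - x * psi0 = ((c - 1 / c) / (q - 1 / q)) *\<^sub>C (k * x)"
proof -
  have ki: "ki * x = (1 / c) *\<^sub>C (x * ki)" and k: "x * k = (1 / c) *\<^sub>C (k * x)"
    using conj_iff[of c x] assms by simp_all
  have "c *\<^sub>C (psi0 * x) - x * psi0
      = (1 / (q - 1 / q)) *\<^sub>C (c *\<^sub>C (k * x) - c *\<^sub>C (ki * x) - x * k + x * ki)"
    by (simp add: psi0_def algebra_simps scaleC_distribs mult.commute)
  also have "c *\<^sub>C (k * x) - c *\<^sub>C (ki * x) - x * k + x * ki = (c - 1 / c) *\<^sub>C (k * x)"
    using assms(2) by (simp only: ki k) (simp add: scaleC_distribs)
  finally show ?thesis by simp
qed

lemma psi0_x: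
  assumes "k * x = q\<^sup>2 *\<^sub>C (x * k)"
  shows "q\<^sup>2 *\<^sub>C (psi0 * x) - x * psi0 = (q + 1 / q) *\<^sub>C (k * x)"
  using psi0_shift[OF assms] by (simp add: sq)

lemma psi0_y:
  assumes "k * y = (1 / q\<^sup>2) *\<^sub>C (y * k)"
  shows "(1 / q\<^sup>2) *\<^sub>C (psi0 * y) - y * psi0 = - ((q + 1 / q) *\<^sub>C (k * y))"
proof -
  have "(1 / q\<^sup>2 - 1 / (1 / q\<^sup>2)) / (q - 1 / q) = - (q + 1 / q)"
    unfolding sq[symmetric] by (simp add: minus_divide_left)
  then show ?thesis using psi0_shift[OF assms] by (simp only: scaleC_minus_left) simp
qed

lemma k_h1: "k * h1 = h1 * k"
proof -
  have 1: "k * (x0 * (y1 * u)) = x0 * (y1 * (k * u))" "k * (y1 * (x0 * u)) = y1 * (x0 * (k * u))" for u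
    using k_x0 k_y1 by (simp_all flip: mult.assoc) (simp_all add: mult.assoc)
  have "k * (x0 * y1 - y1 * x0) = (x0 * y1 - y1 * x0) * k"
    using 1[of 1] by (simp add: algebra_simps)
  then have "ki * (x0 * y1 - y1 * x0) * k = k * (ki * (x0 * y1 - y1 * x0))"
    by (metis k_ki_assoc mult.assoc)
  then show ?thesis by (simp add: h1_def)
qed


lemma k_hm: "k * hm = hm * k"
proof -
  have 1: "k * (xm * (y0 * u)) = xm * (y0 * (k * u))" "k * (y0 * (xm * u)) = y0 * (xm * (k * u))" for u
    using k_xm k_y0 by (simp_all flip: mult.assoc) (simp_all add: mult.assoc)
  have "k * (xm * y0 - y0 * xm) = (xm * y0 - y0 * xm) * k"
    using 1[of 1] by (simp add: algebra_simps)
  then have "k * (xm * y0 - y0 * xm) * k = k * (k * (xm * y0 - y0 * xm))"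
    by (metis mult.assoc)
  then show ?thesis by (simp add: hm_def)
qed

lemma kh1: "k * h1 = (1 / (q + 1 / q)) *\<^sub>C (x0 * y1 - y1 * x0)"
  by (simp add: h1_def)

text \<open>Bracketing the two quadratic relations of the datum shows that \<open>h1\<close> shifts the generators.\<close>

lemma h1_xm: "h1 * xm - xm * h1 = x0"
proof -
  define p c where "p = x0 * y1 - y1 * x0" and "c = q + 1 / q"
  have 1: "x0 * y1 = y1 * x0 + p" "xm * y1 = y1 * xm + psi0"
    using xm_y1 by (simp_all add: p_def psi0_def algebra_simps)
  \<comment> \<open>Both sides of \<open>x0_xm\<close> are commuted past \<open>y1\<close>. The
    terms with \<open>y1\<close> in front cancel by \<open>x0_xm\<close> itself, which leaves a
    relation between \<open>p\<close>, that is \<open>h1\<close>, and the generators.\<close>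
  have "x0 * xm * y1 = y1 * x0 * xm + p * xm + x0 * psi0"
    by (simp add: 1 algebra_simps) (simp add: 1 algebra_simps flip: mult.assoc)
  moreover have "xm * x0 * y1 = y1 * xm * x0 + psi0 * x0 + xm * p"
    by (simp add: 1 algebra_simps) (simp add: 1 algebra_simps flip: mult.assoc)
  ultimately have "y1 * x0 * xm + p * xm + x0 * psi0 = q\<^sup>2 *\<^sub>C (y1 * xm * x0 + psi0 * x0 + xm * p)"
    using x0_xm by simp
  moreover have "y1 * x0 * xm = q\<^sup>2 *\<^sub>C (y1 * xm * x0)" using x0_xm by (simp add: mult.assoc)
  ultimately have 2: "p * xm - q\<^sup>2 *\<^sub>C (xm * p) = (q + 1 / q) *\<^sub>C (k * x0)"
    using psi0_x[OF k_x0] by (simp add: scaleC_add_right algebra_simps)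
  have "p = (q + 1 / q) *\<^sub>C (k * h1)" by (simp add: kh1 p_def)
  moreover have "xm * (k * h1) = (1 / q\<^sup>2) *\<^sub>C (k * xm * h1)" by (simp add: k_xm mult.assoc)
  ultimately have "(q + 1 / q) *\<^sub>C (k * (h1 * xm - xm * h1)) = (q + 1 / q) *\<^sub>C (k * x0)"
    using 2 unfolding c_def[symmetric] by (simp add: algebra_simps scaleC_diff_right)
  then have "ki * (k * (h1 * xm - xm * h1)) = ki * (k * x0)"
    by (simp only: scaleC_left_cancel[OF q_plus_inverse])
  then show ?thesis by simp
qed

lemma h1_y0: "y0 * h1 - h1 * y0 = y1"
proof -
  define p c where "p = x0 * y1 - y1 * x0" and "c = q + 1 / q"
  have 1: "x0 * y1 = y1 * x0 + p" "x0 * y0 = y0 * x0 + psi0"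
    using x0_y0 by (simp_all add: p_def psi0_def algebra_simps)
  have "x0 * (y1 * y0) = y1 * y0 * x0 + y1 * psi0 + p * y0"
    by (simp add: 1 distrib_left distrib_right flip: mult.assoc) (simp add: 1 algebra_simps)
  moreover have "x0 * (y0 * y1) = y0 * y1 * x0 + y0 * p + psi0 * y1"
    by (simp add: 1 distrib_left distrib_right flip: mult.assoc) (simp add: 1 algebra_simps)
  ultimately have "y1 * y0 * x0 + y1 * psi0 + p * y0 = (1 / q\<^sup>2) *\<^sub>C (y0 * y1 * x0 + y0 * p + psi0 * y1)"
    using y1_y0 by simp
  moreover have "y1 * y0 * x0 = (1 / q\<^sup>2) *\<^sub>C (y0 * y1 * x0)" using y1_y0 by simp
  ultimately have "p * y0 - (1 / q\<^sup>2) *\<^sub>C (y0 * p) = (1 / q\<^sup>2) *\<^sub>C (psi0 * y1) - y1 * psi0"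
    by (simp add: scaleC_add_right algebra_simps)
  then have 2: "p * y0 - (1 / q\<^sup>2) *\<^sub>C (y0 * p) = - ((q + 1 / q) *\<^sub>C (k * y1))"
    by (simp only: psi0_y[OF k_y1])
  have "p = (q + 1 / q) *\<^sub>C (k * h1)" by (simp add: kh1 p_def)
  moreover have "y0 * (k * h1) = q\<^sup>2 *\<^sub>C (k * y0 * h1)" by (simp add: k_y0 mult.assoc)
  ultimately have "(q + 1 / q) *\<^sub>C (k * (y0 * h1 - h1 * y0)) = (q + 1 / q) *\<^sub>C (k * y1)"
    using 2 unfolding c_def[symmetric] by (simp add: algebra_simps scaleC_diff_right)
  then have "ki * (k * (y0 * h1 - h1 * y0)) = ki * (k * y1)"
    by (simp only: scaleC_left_cancel[OF q_plus_inverse])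
  then show ?thesis by simp
qed

end

section \<open>Shifting the loop index in both directions\<close>

context loop_datum
begin

interpretation flip: loop_datum "1 / q" ki k xm x0 y1 y0 by (rule flip_datum)

lemma flip_h1: "flip.h1 = hm" and flip_hm: "flip.hm = h1"
  by (simp_all add: flip.h1_def flip.hm_def h1_def hm_def add.commute)

lemma hm_x0: "hm * x0 - x0 * hm = xm" and hm_y1: "y1 * hm - hm * y1 = y0"
  using flip.h1_xm flip.h1_y0 by (simp_all add: flip_h1)

lemma flip_xp: "flip.xp i = xp (- 1 - i)" and flip_ym: "flip.ym j = ym (1 - j)"
  unfolding flip.xp_def flip.ym_def xp_def ym_def flip_h1 flip_hm
  by (auto simp: algebra_simps intro!: arg_cong2[where f = "\<lambda>i. (_ ^^ i)"] arg_cong[where f = nat])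

text \<open>Commuting with \<open>h1\<close> is a derivation; it turns [xm, y0] into [x0, y0] -
  [xm, y1], and both of these brackets equal \<open>psi0\<close>.\<close>

lemma h1_hm: "h1 * hm = hm * h1"
proof -
  have kh: "k * (h1 * u) = h1 * (k * u)" for u
    using k_h1 by (metis mult.assoc)
  have y: "y0 * h1 = h1 * y0 + y1" and x: "xm * h1 = h1 * xm - x0"
    using h1_y0 h1_xm by (simp_all add: algebra_simps)
  have "(xm * y0 - y0 * xm) * h1 - h1 * (xm * y0 - y0 * xm)
     = (xm * y1 - y1 * xm) - (x0 * y0 - y0 * x0)"
    by (simp add: left_diff_distrib right_diff_distrib mult.assoc y x distrib_left)
       (simp add: y x left_diff_distrib distrib_right flip: mult.assoc)
  also have "\<dots> = 0" by (simp add: x0_y0 xm_y1)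
  finally have "(xm * y0 - y0 * xm) * h1 = h1 * (xm * y0 - y0 * xm)" by simp
  then have "k * (xm * y0 - y0 * xm) * h1 = h1 * (k * (xm * y0 - y0 * xm))"
    by (simp add: mult.assoc kh)
  then show ?thesis by (simp add: hm_def)
qed

end

text \<open>The Leibniz rule for a q-commutator. Where the q-commutator is known to vanish, it
  converts a quadratic relation between a and b into an exchange relation involving the brackets s
  and t; where the right side vanishes, it shows that the q-commutator commutes with y.\<close>

lemma (in complex_algebra) q_commutator_bracket:
  assumes "a * y = y * a + s" "b * y = y * b + t"
  shows "(b * a - c *\<^sub>C (a * b)) * y - y * (b * a - c *\<^sub>C (a * b))
    = (t * a - c *\<^sub>C (a * t)) - (c *\<^sub>C (s * b) - b * s)"
proof -
  have "a * (y * u) = y * (a * u) + s * u" "b * (y * u) = y * (b * u) + t * u" for u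
    using assms by (metis distrib_right mult.assoc)+
  then show ?thesis by (simp add: algebra_simps assms scaleC_distribs)
qed

context loop_datum
begin

lemma xp_0 [simp]: "xp 0 = x0" and xp_m1 [simp]: "xp (- 1) = xm"
  and ym_0 [simp]: "ym 0 = y0" and ym_1 [simp]: "ym 1 = y1"
  by (simp_all add: xp_def ym_def)

lemma xp_h1: "h1 * xp i - xp i * h1 = xp (i + 1)"
proof (cases "i \<ge> 0")
  case True
  then show ?thesis by (simp add: xp_def nat_add_distrib)
next
  case False
  define D D' where "D = (\<lambda>u. h1 * u - u * h1)" and "D' = (\<lambda>u. hm * u - u * hm)"
  \<comment> \<open>As \<open>h1\<close> and \<open>hm\<close> commute, the shift by
    \<open>h1\<close> passes through all shifts by \<open>hm\<close> down to \<open>xm\<close>,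
    which it turns into \<open>x0\<close>; this undoes one of the downward shifts.\<close>
  have "D (D' u) = D' (D u)" for u
    by (simp add: D_def D'_def algebra_simps h1_hm) (simp add: h1_hm flip: mult.assoc)
  then have *: "D ((D' ^^ n) u) = (D' ^^ n) (D u)" for n u by (induction n) simp_all
  define n where "n = nat (- 1 - i)"
  have "xp (i + 1) = (D' ^^ n) x0"
  proof (cases n)
    case 0
    then have "i = - 1" using False by (simp add: n_def)
    then show ?thesis by (simp add: n_def)
  next
    case (Suc m)
    then have "nat (- 1 - (i + 1)) = m" "\<not> i + 1 \<ge> 0" by (simp_all add: n_def)
    moreover have "D' x0 = xm" by (simp add: D'_def hm_x0)
    ultimately show ?thesis
      using Suc by (simp add: xp_def D'_def[symmetric] funpow_Suc_right del: funpow.simps)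
  qed
  moreover have "D xm = x0" by (simp add: D_def h1_xm)
  ultimately show ?thesis
    using False *[of n xm] by (simp add: xp_def D_def D'_def n_def)
qed

lemma ym_h1: "ym j * h1 - h1 * ym j = ym (j + 1)"
proof (cases "j \<ge> 1")
  case True
  then have "nat (j + 1 - 1) = Suc (nat (j - 1))" by simp
  then show ?thesis using True by (simp add: ym_def)
next
  case False
  define D D' where "D = (\<lambda>u. u * h1 - h1 * u)" and "D' = (\<lambda>u. u * hm - hm * u)"
  have "D (D' u) = D' (D u)" for u
    by (simp add: D_def D'_def algebra_simps h1_hm) (simp add: h1_hm flip: mult.assoc)
  then have *: "D ((D' ^^ n) u) = (D' ^^ n) (D u)" for n u by (induction n) simp_all
  define n where "n = nat (- j)"
  have "ym (j + 1) = (D' ^^ n) y1"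
  proof (cases n)
    case 0
    then have "j = 0" using False by (simp add: n_def)
    then show ?thesis by (simp add: n_def)
  next
    case (Suc m)
    then have "nat (- (j + 1)) = m" "\<not> j + 1 \<ge> 1" by (simp_all add: n_def)
    moreover have "D' y1 = y0" by (simp add: D'_def hm_y1)
    ultimately show ?thesis
      using Suc by (simp add: ym_def D'_def[symmetric] funpow_Suc_right del: funpow.simps)
  qed
  moreover have "D y0 = y1" by (simp add: D_def h1_y0)
  ultimately show ?thesis
    using False *[of n y0] by (simp add: ym_def D_def D'_def n_def)
qed

end

context loop_datum
begin

interpretation flip: loop_datum "1 / q" ki k xm x0 y1 y0 by (rule flip_datum)

lemma xp_hm: "hm * xp i - xp i * hm = xp (i - 1)"
  using flip.xp_h1[of "- 1 - i"] by (simp add: flip_xp flip_h1)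

lemma ym_hm: "ym j * hm - hm * ym j = ym (j - 1)"
  using flip.ym_h1[of "1 - j"] by (simp add: flip_ym flip_h1)

lemma weight_shift:
  assumes "k * w = c *\<^sub>C (w * k)" "k * h = h * k"
  shows "k * (h * w - w * h) = c *\<^sub>C ((h * w - w * h) * k)"
proof -
  have "k * (h * w) = c *\<^sub>C (h * w * k)" using assms by (metis mult.assoc mult_scaleC_right)
  moreover have "k * (w * h) = c *\<^sub>C (w * h * k)" using assms by (metis mult.assoc mult_scaleC_left)
  ultimately show ?thesis by (simp add: algebra_simps scaleC_distribs)
qed

lemma weight_shift':
  assumes "k * w = c *\<^sub>C (w * k)" "k * h = h * k"
  shows "k * (w * h - h * w) = c *\<^sub>C ((w * h - h * w) * k)"
  using weight_shift[OF assms] by (metis minus_diff_eq mult_minus_left mult_minus_right scaleC_minus_right)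

lemma k_xp: "k * xp i = q\<^sup>2 *\<^sub>C (xp i * k)"
proof (induction i rule: int_induct[where k = 0])
  case (step1 i)
  then show ?case using weight_shift[OF step1(2) k_h1] by (simp add: xp_h1)
next
  case (step2 i)
  then show ?case using weight_shift[OF step2(2) k_hm] by (simp add: xp_hm)
qed (simp add: k_x0)

lemma k_ym: "k * ym j = (1 / q\<^sup>2) *\<^sub>C (ym j * k)"
proof (induction j rule: int_induct[where k = 0])
  case (step1 j)
  then show ?case using weight_shift'[OF step1(2) k_h1] by (simp add: ym_h1)
next
  case (step2 j)
  then show ?case using weight_shift'[OF step2(2) k_hm] by (simp add: ym_hm)
qed (simp add: k_y0)

definition brk :: "int \<Rightarrow> int \<Rightarrow> 'a" where
  "brk i j = xp i * ym j - ym j * xp i"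

lemma brk_0_eq: "brk 0 s = psi s"
  by (simp add: brk_def psi_def)

lemma xp_ym: "xp i * ym j = ym j * xp i + brk i j"
  by (simp add: brk_def)

lemma h1_brk: "h1 * brk i j - brk i j * h1 = brk (i + 1) j - brk i (j + 1)"
proof -
  have 1: "h1 * xp i = xp i * h1 + xp (i + 1)" "h1 * ym j = ym j * h1 - ym (j + 1)"
    using xp_h1[of i] ym_h1[of j] by (simp_all add: algebra_simps)
  have 2: "h1 * (xp i * u) = xp i * (h1 * u) + xp (i + 1) * u"
    "h1 * (ym j * u) = ym j * (h1 * u) - ym (j + 1) * u" for u
    using 1 by (simp_all add: distrib_right left_diff_distrib flip: mult.assoc)
  show ?thesis by (simp add: brk_def right_diff_distrib left_diff_distrib mult.assoc 2 1 distrib_left)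
qed

end

context loop_datum
begin

interpretation flip: loop_datum "1 / q" ki k xm x0 y1 y0 by (rule flip_datum)

lemma hm_brk: "hm * brk i j - brk i j * hm = brk (i - 1) j - brk i (j - 1)"
  using flip.h1_brk[of "- 1 - i" "1 - j"]
  by (simp add: flip.brk_def brk_def flip_xp flip_ym flip_h1 algebra_simps)

lemma psi_1: "psi 1 = (q + 1 / q) *\<^sub>C (k * h1)"
  by (simp add: kh1 psi_def)

lemma psi_1_h: "h1 * psi 1 = psi 1 * h1" "hm * psi 1 = psi 1 * hm"
proof -
  have "h1 * (k * h1) = k * h1 * h1" "hm * (k * h1) = k * h1 * hm"
    using k_h1 k_hm h1_hm by (metis mult.assoc)+
  then show "h1 * psi 1 = psi 1 * h1" "hm * psi 1 = psi 1 * hm" by (simp_all add: psi_1)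
qed

lemma comm_ki: "k * u = u * k \<Longrightarrow> ki * u = u * ki"
  using conj_iff[of 1 u] by simp

lemma psi0_comm: "k * u = u * k \<Longrightarrow> u * psi0 = psi0 * u"
  using comm_ki[of u] by (simp add: psi0_def algebra_simps)

lemma brk_level_01: "brk i (- i) = psi0 \<and> brk i (1 - i) = psi 1"
proof (induction i rule: int_induct[where k = 0])
  case base
  then show ?case by (simp add: brk_def psi_def psi0_def x0_y0)
next
  case (step1 i)
  then have b: "brk i (- i) = psi0" "brk i (1 - i) = psi 1" by auto
  have "brk (i + 1) (- i) = brk i (1 - i)"
    using h1_brk[of i "- i"] psi0_comm[OF k_h1] by (simp add: b(1) add.commute)
  with b have c: "brk (i + 1) (- i) = psi 1" by simp
  then show ?case using hm_brk[of "i + 1" "- i"] psi_1_h(2) b by simp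
next
  case (step2 i)
  then have b: "brk i (- i) = psi0" "brk i (1 - i) = psi 1" by auto
  have "brk (i - 1) (1 - i) = brk i (- i)"
    using hm_brk[of i "1 - i"] psi_1_h(2) by (simp add: b(2))
  with b have c: "brk (i - 1) (1 - i) = psi0" by simp
  then show ?case using h1_brk[of "i - 1" "1 - i"] psi0_comm[OF k_h1] b by (simp add: add.commute)
qed

lemma psi_0: "psi 0 = psi0"
  using brk_level_01[of 0] by (simp add: brk_0_eq)

text \<open>By \<open>brk_level_01\<close>, x_l and y_{-l} span a quantum sl2 with \<open>k\<close>.
  The q-commutator of x_{l+1} and x_l has weight q^4, and its bracket with y_{-l} involves only
  psi_0 and psi_1, whose contributions cancel. The rank one fact then makes it zero.\<close>

lemma xp_quadratic: "xp (l + 1) * xp l = q\<^sup>2 *\<^sub>C (xp l * xp (l + 1))"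
proof -
  interpret sl2: uq_sl2_triple q k ki "xp l" "ym (- l)"
    using brk_level_01[of l] bounded_above
    by unfold_locales (simp_all add: k_xp brk_def psi0_def)
  define w where "w = xp (l + 1) * xp l - q\<^sup>2 *\<^sub>C (xp l * xp (l + 1))"
  have kx: "k * (xp i * u) = q\<^sup>2 *\<^sub>C (xp i * (k * u))" for i u
    using k_xp[of i] by (simp flip: mult.assoc)
  have "k * w = q ^ 4 *\<^sub>C (w * k)"
    by (simp add: w_def right_diff_distrib left_diff_distrib scaleC_distribs kx mult.assoc k_xp
        eval_nat_numeral)
  moreover have "w * ym (- l) = ym (- l) * w"
  proof -
    have 1: "xp l * ym (- l) = ym (- l) * xp l + psi0" "xp (l + 1) * ym (- l) = ym (- l) * xp (l + 1) + psi 1"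
      using brk_level_01[of l] brk_level_01[of "l + 1"] by (simp_all add: brk_def algebra_simps)
    define c where "c = q + 1 / q"
    have 3: "psi 1 * xp l - q\<^sup>2 *\<^sub>C (xp l * psi 1) = c *\<^sub>C (k * xp (l + 1))"
    proof -
      have "xp l * (k * u) = (1 / q\<^sup>2) *\<^sub>C (k * (xp l * u))" for u using kx by simp
      then show ?thesis
        by (simp add: psi_1 c_def[symmetric] mult.assoc scaleC_diff_right flip: xp_h1)
           (simp add: algebra_simps scaleC_distribs)
    qed
    have "w * ym (- l) - ym (- l) * w = (psi 1 * xp l - q\<^sup>2 *\<^sub>C (xp l * psi 1))
       - (q\<^sup>2 *\<^sub>C (psi0 * xp (l + 1)) - xp (l + 1) * psi0)"
      unfolding w_def by (rule q_commutator_bracket[OF 1])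
    also have "\<dots> = 0" by (simp only: 3 psi0_x[OF k_xp] c_def) simp
    finally show ?thesis by simp
  qed
  ultimately have "w = 0" by (rule sl2.weight_four_commuting_eq_0)
  then show ?thesis by (simp add: w_def)
qed

text \<open>The same argument with the roles exchanged: \<open>ki\<close> replaces \<open>k\<close>,
  y_l raises and x_{-l} lowers. This is where the bound from below enters.\<close>

lemma ym_quadratic: "ym (l + 1) * ym l = (1 / q\<^sup>2) *\<^sub>C (ym l * ym (l + 1))"
proof -
  have kiy: "ki * ym i = q\<^sup>2 *\<^sub>C (ym i * ki)" for i
    using conj_iff[of "1 / q\<^sup>2" "ym i"] k_ym by simp
  have brk': "ym l * xp (- l) - xp (- l) * ym l = (1 / (q - 1 / q)) *\<^sub>C (ki - k)"
    using brk_level_01[of "- l"] by (simp add: brk_def psi0_def scaleC_diff_right algebra_simps)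
  interpret sl2: uq_sl2_triple q ki k "ym l" "xp (- l)"
    using bounded_below by unfold_locales (simp_all add: kiy brk')
  define w where "w = ym (l + 1) * ym l - (1 / q\<^sup>2) *\<^sub>C (ym l * ym (l + 1))"
  have ky: "ki * (ym i * u) = q\<^sup>2 *\<^sub>C (ym i * (ki * u))" for i u
    using kiy[of i] by (simp flip: mult.assoc)
  have ky': "k * (ym i * u) = (1 / q\<^sup>2) *\<^sub>C (ym i * (k * u))" for i u
    using k_ym[of i] by (simp flip: mult.assoc)
  have "ki * w = q ^ 4 *\<^sub>C (w * ki)"
    by (simp add: w_def right_diff_distrib left_diff_distrib scaleC_distribs ky mult.assoc kiy
        eval_nat_numeral)
  moreover have "w * xp (- l) = xp (- l) * w"
  proof -
    have 1: "ym l * xp (- l) = xp (- l) * ym l + - psi0"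
      "ym (l + 1) * xp (- l) = xp (- l) * ym (l + 1) + - psi 1"
      using brk_level_01[of "- l"] by (simp_all add: brk_def algebra_simps)
    define c where "c = q + 1 / q"
    have 3: "psi 1 * ym l - (1 / q\<^sup>2) *\<^sub>C (ym l * psi 1) = - (c *\<^sub>C (k * ym (l + 1)))"
    proof -
      have "ym l * (k * u) = q\<^sup>2 *\<^sub>C (k * (ym l * u))" for u using ky' by simp
      then show ?thesis
        by (simp add: psi_1 c_def[symmetric] mult.assoc scaleC_diff_right flip: ym_h1)
           (simp add: algebra_simps scaleC_distribs)
    qed
    have "w * xp (- l) - xp (- l) * w = - (psi 1 * ym l - (1 / q\<^sup>2) *\<^sub>C (ym l * psi 1))
       + ((1 / q\<^sup>2) *\<^sub>C (psi0 * ym (l + 1)) - ym (l + 1) * psi0)"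
      using q_commutator_bracket[OF 1, of "1 / q\<^sup>2"] by (simp add: w_def)
    also have "\<dots> = 0" by (simp only: 3 psi0_y[OF k_ym] c_def) simp
    finally show ?thesis by simp
  qed
  ultimately have "w = 0" by (rule sl2.weight_four_commuting_eq_0)
  then show ?thesis by (simp add: w_def)
qed

end

text \<open>In generating series each exchange relation moves the series of the p past x or y at the
  price of a linear factor on either side. The claim compares coefficients after multiplying by both
  factors; u v = 1 makes the extreme coefficients equal to 1.\<close>

lemma (in complex_algebra) two_step_exchange:
  assumes uv: "u * v = 1"
    and "p2 * x = u *\<^sub>C (p1 * x') + u *\<^sub>C (x * p2) - x' * p1"
    and "p1 * x = u *\<^sub>C (p0 * x') + u *\<^sub>C (x * p1) - x' * p0"
    and "p2 * y = v *\<^sub>C (p1 * y') + v *\<^sub>C (y * p2) - y' * p1"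
    and "p1 * y = v *\<^sub>C (p0 * y') + v *\<^sub>C (y * p1) - y' * p0"
  shows "p2 * (x * y) - u *\<^sub>C (p1 * (x' * y)) - v *\<^sub>C (p1 * (x * y')) + p0 * (x' * y')
    = x * y * p2 - v *\<^sub>C (x' * y * p1) - u *\<^sub>C (x * y' * p1) + x' * y' * p0"
proof -
  have vu: "v * u = 1" using uv by (simp add: mult.commute)
  have 1: "p2 * (x * z) = u *\<^sub>C (p1 * (x' * z)) + u *\<^sub>C (x * (p2 * z)) - x' * (p1 * z)"
    "p1 * (x * z) = u *\<^sub>C (p0 * (x' * z)) + u *\<^sub>C (x * (p1 * z)) - x' * (p0 * z)" for z
    using assms(2,3) by (simp_all add: distrib_right left_diff_distrib flip: mult.assoc)
  show ?thesis
    by (simp add: 1 assms(4,5) distrib_left right_diff_distrib scaleC_distribs uv vu mult.assoc)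
      (simp add: algebra_simps)
qed

section \<open>Drinfeld's relation [x_i, y_j] = psi_{i+j} by induction on i + j\<close>

context loop_datum
begin

text \<open>The coefficients of Drinfeld's series psi^+ over q - 1/q. They differ from
  \<open>psi\<close> only at index 0, where the part with \<open>ki\<close> belongs to psi^-. With
  \<open>phi\<close> the exchange relations take one form down to index 0.\<close>

definition phi :: "nat \<Rightarrow> 'a" where
  "phi m = (if m = 0 then (1 / (q - 1 / q)) *\<^sub>C k else psi (int m))"

definition level :: "int \<Rightarrow> bool" where
  "level s \<longleftrightarrow> (\<forall>i. brk i (s - i) = psi s)"

lemma levelD: "level s \<Longrightarrow> i + j = s \<Longrightarrow> brk i j = psi s"
  unfolding level_def by (metis add_diff_cancel_left')

lemma level_01: "level 0" "level 1"
  using brk_level_01 by (simp_all add: level_def psi_0)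

lemma k_brk: "k * brk i j = brk i j * k"
proof -
  have 1: "k * (xp i * u) = q\<^sup>2 *\<^sub>C (xp i * (k * u))" "k * (ym j * u) = (1 / q\<^sup>2) *\<^sub>C (ym j * (k * u))" for u
    using k_xp[of i] k_ym[of j] by (simp_all flip: mult.assoc)
  show ?thesis by (simp add: brk_def algebra_simps k_xp k_ym 1)
qed

lemma k_psi: "k * psi s = psi s * k"
  using k_brk[of 0 s] by (simp add: brk_0_eq)

text \<open>In this combination the \<open>ki\<close> part of psi_0 contributes nothing, so psi_0
  may be traded for \<open>phi 0\<close>.\<close>

lemma phi_0_shift:
  assumes "k * x = c *\<^sub>C (x * k)" "c \<noteq> 0"
  shows "c *\<^sub>C (phi 0 * x) - x * phi 0 = c *\<^sub>C (psi 0 * x) - x * psi 0"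
proof -
  have "x * k = (1 / c) *\<^sub>C (k * x)" using assms by simp
  then have "c *\<^sub>C (phi 0 * x) - x * phi 0 = ((c - 1 / c) / (q - 1 / q)) *\<^sub>C (k * x)"
    by (simp add: phi_def diff_divide_distrib scaleC_distribs mult.commute)
  then show ?thesis using psi0_shift[OF assms] by (simp add: psi_0)
qed

text \<open>Bracketing \<open>xp_quadratic\<close> with y_{m-l} turns it into an exchange relation.
  Only brackets of total index m and m + 1 occur, which makes the relation available in the midst of
  the induction.\<close>

lemma phi_xp:
  assumes "level (int m)" "level (int m + 1)"
  shows "phi (Suc m) * xp l
    = q\<^sup>2 *\<^sub>C (phi m * xp (l + 1)) + q\<^sup>2 *\<^sub>C (xp l * phi (Suc m)) - xp (l + 1) * phi m"
proof -
  have "xp l * ym (int m - l) = ym (int m - l) * xp l + psi (int m)"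
    "xp (l + 1) * ym (int m - l) = ym (int m - l) * xp (l + 1) + psi (int m + 1)"
    using levelD[OF assms(1), of l "int m - l"] levelD[OF assms(2), of "l + 1" "int m - l"]
    by (simp_all add: xp_ym)
  from q_commutator_bracket[OF this, of "q\<^sup>2"]
  have "psi (int m + 1) * xp l - q\<^sup>2 *\<^sub>C (xp l * psi (int m + 1))
      = q\<^sup>2 *\<^sub>C (psi (int m) * xp (l + 1)) - xp (l + 1) * psi (int m)"
    by (simp add: xp_quadratic)
  also have "\<dots> = q\<^sup>2 *\<^sub>C (phi m * xp (l + 1)) - xp (l + 1) * phi m"
    using phi_0_shift[OF k_xp] by (cases "m = 0") (simp_all add: phi_def[of m])
  finally show ?thesis by (simp add: phi_def[of "Suc m"] add.commute algebra_simps)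
qed

lemma phi_ym:
  assumes "level (int m)" "level (int m + 1)"
  shows "phi (Suc m) * ym l
    = (1 / q\<^sup>2) *\<^sub>C (phi m * ym (l + 1)) + (1 / q\<^sup>2) *\<^sub>C (ym l * phi (Suc m)) - ym (l + 1) * phi m"
proof -
  have "ym l * xp (int m - l) = xp (int m - l) * ym l + - psi (int m)"
    "ym (l + 1) * xp (int m - l) = xp (int m - l) * ym (l + 1) + - psi (int m + 1)"
    using levelD[OF assms(1), of "int m - l" l] levelD[OF assms(2), of "int m - l" "l + 1"]
    by (simp_all add: xp_ym)
  from q_commutator_bracket[OF this, of "1 / q\<^sup>2"]
  have "psi (int m + 1) * ym l - (1 / q\<^sup>2) *\<^sub>C (ym l * psi (int m + 1))
      = (1 / q\<^sup>2) *\<^sub>C (psi (int m) * ym (l + 1)) - ym (l + 1) * psi (int m)"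
    by (simp add: ym_quadratic) (simp add: algebra_simps)
  also have "\<dots> = (1 / q\<^sup>2) *\<^sub>C (phi m * ym (l + 1)) - ym (l + 1) * phi m"
    using phi_0_shift[OF k_ym] by (cases "m = 0") (simp_all add: phi_def[of m])
  finally show ?thesis by (simp add: phi_def[of "Suc m"] add.commute algebra_simps)
qed

text \<open>\<open>two_step_exchange\<close> applies to the product of x and y in either order, with
  q^2 and q^-2 interchanged. The resulting coefficients agree, so that subtraction leaves brackets
  only.\<close>

lemma phi_brk:
  assumes "level (int m)" "level (int m + 1)" "level (int m + 2)"
  shows "phi (m + 2) * brk i j - q\<^sup>2 *\<^sub>C (phi (m + 1) * brk (i + 1) j)
      - (1 / q\<^sup>2) *\<^sub>C (phi (m + 1) * brk i (j + 1)) + phi m * brk (i + 1) (j + 1)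
    = brk i j * phi (m + 2) - (1 / q\<^sup>2) *\<^sub>C (brk (i + 1) j * phi (m + 1))
      - q\<^sup>2 *\<^sub>C (brk i (j + 1) * phi (m + 1)) + brk (i + 1) (j + 1) * phi m"
proof -
  have l: "level (int (Suc m))" "level (int (Suc m) + 1)" using assms by (simp_all add: add.commute)
  have inv: "q\<^sup>2 * (1 / q\<^sup>2) = 1" "(1 / q\<^sup>2) * q\<^sup>2 = 1" by simp_all
  let ?P = "\<lambda>u v x x' y y'. phi (Suc (Suc m)) * (x * y) - u *\<^sub>C (phi (Suc m) * (x' * y))
    - v *\<^sub>C (phi (Suc m) * (x * y')) + phi m * (x' * y')"
  let ?Q = "\<lambda>u v x x' y y'. x * y * phi (Suc (Suc m)) - v *\<^sub>C (x' * y * phi (Suc m))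
    - u *\<^sub>C (x * y' * phi (Suc m)) + x' * y' * phi m"
  note px = phi_xp[OF l, of i] phi_xp[OF assms(1,2), of i]
  note py = phi_ym[OF l, of j] phi_ym[OF assms(1,2), of j]
  note xy = two_step_exchange[OF inv(1) px py] and yx = two_step_exchange[OF inv(2) py px]
  have "phi (m + 2) * brk i j - q\<^sup>2 *\<^sub>C (phi (m + 1) * brk (i + 1) j)
      - (1 / q\<^sup>2) *\<^sub>C (phi (m + 1) * brk i (j + 1)) + phi m * brk (i + 1) (j + 1)
    = ?P (q\<^sup>2) (1 / q\<^sup>2) (xp i) (xp (i + 1)) (ym j) (ym (j + 1))
      - ?P (1 / q\<^sup>2) (q\<^sup>2) (ym j) (ym (j + 1)) (xp i) (xp (i + 1))"
    by (simp add: brk_def right_diff_distrib scaleC_diff_right)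
  also have "\<dots> = ?Q (q\<^sup>2) (1 / q\<^sup>2) (xp i) (xp (i + 1)) (ym j) (ym (j + 1))
      - ?Q (1 / q\<^sup>2) (q\<^sup>2) (ym j) (ym (j + 1)) (xp i) (xp (i + 1))"
    by (simp only: xy yx)
  also have "\<dots> = brk i j * phi (m + 2) - (1 / q\<^sup>2) *\<^sub>C (brk (i + 1) j * phi (m + 1))
      - q\<^sup>2 *\<^sub>C (brk i (j + 1) * phi (m + 1)) + brk (i + 1) (j + 1) * phi m"
    by (simp add: brk_def left_diff_distrib scaleC_diff_right)
  finally show ?thesis .
qed

text \<open>It suffices that \<open>h1\<close> commutes with psi_n: then \<open>h1_brk\<close>
  slides the brackets of total index n + 1 into each other. As psi_1 is a multiple of
  \<open>k * h1\<close>, this means that psi_1 and psi_n commute. The commutators of psi_m with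
  psi_{n+1-m} satisfy a linear recurrence in m by \<open>phi_brk\<close>, and they change sign under
  m -> n + 1 - m. Since q is no root of unity, only zero is compatible with both.\<close>

lemma level_Suc:
  assumes n: "n \<ge> 1" and lev: "\<And>m. m \<le> n \<Longrightarrow> level (int m)"
  shows "level (int n + 1)"
proof -
  define N where "N = int n + 1"
  define \<kappa> where "\<kappa> m = (if m = 0 then 0 else phi m * psi (N - int m) - psi (N - int m) * phi m)" for m
  define g where "g m = q ^ (2 * m) - 1 / q ^ (2 * m)" for m
  have rec: "\<kappa> (m + 2) = (q\<^sup>2 + 1 / q\<^sup>2) *\<^sub>C \<kappa> (m + 1) - \<kappa> m" if m: "m + 2 \<le> n" for m
  proof -
    define j where "j = N - int m - 2"
    have j: "j = int (n - m - 1)" "j + 1 = int (n - m)" using m by (simp_all add: j_def N_def)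
    have "level j" unfolding j(1) by (rule lev) simp
    moreover have "level (j + 1)" unfolding j(2) by (rule lev) simp
    ultimately have b: "brk 0 j = psi j" "brk 1 j = psi (j + 1)" "brk 0 (j + 1) = psi (j + 1)"
      by (simp_all add: levelD add.commute)
    \<comment> \<open>For m = 0 this bracket has total index N, which is not yet under control; but
      \<open>phi 0\<close> is a multiple of \<open>k\<close> and commutes with every bracket. This
      is why \<open>\<kappa> 0\<close> is set to 0.\<close>
    have c: "phi m * brk 1 (j + 1) - brk 1 (j + 1) * phi m = \<kappa> m"
    proof (cases "m = 0")
      case True
      then show ?thesis by (simp add: \<kappa>_def phi_def k_brk)
    next
      case False
      have e: "int (n + 1 - m) = j + 2" using m by (simp add: j_def N_def)
      have "level (j + 2)" unfolding e[symmetric] using False by (intro lev) simp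
      then have "brk 1 (j + 1) = psi (j + 2)" by (rule levelD) simp
      then show ?thesis using False by (simp add: \<kappa>_def j_def)
    qed
    have "level (int m)" "level (int m + 1)" "level (int m + 2)"
      using lev[of m] lev[of "m + 1"] lev[of "m + 2"] m by (simp_all add: add.commute)
    from phi_brk[OF this, of 0 j]
    have "phi (m + 2) * psi j - psi j * phi (m + 2) + (phi m * brk 1 (j + 1) - brk 1 (j + 1) * phi m)
      = (q\<^sup>2 + 1 / q\<^sup>2) *\<^sub>C (phi (m + 1) * psi (j + 1) - psi (j + 1) * phi (m + 1))"
      by (simp add: b scaleC_distribs) (simp add: algebra_simps)
    then show ?thesis by (simp add: c) (simp add: \<kappa>_def j_def algebra_simps)
  qed
  have g_rec: "g (m + 2) = (q\<^sup>2 + 1 / q\<^sup>2) * g (m + 1) - g m" for m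
  proof -
    define p where "p = q ^ (2 * m)"
    have "p \<noteq> 0" by (simp add: p_def)
    have "q ^ (2 * (m + 1)) = p * q\<^sup>2" "q ^ (2 * (m + 2)) = p * q ^ 4"
      by (simp_all add: p_def power_add power2_eq_square eval_nat_numeral)
    with \<open>p \<noteq> 0\<close> show ?thesis
      unfolding g_def p_def[symmetric] by (simp add: field_simps eval_nat_numeral)
  qed
  \<comment> \<open>The solution of the recurrence with value 0 at 0 is proportional to q^(2m) -
    q^(-2m).\<close>
  have sol: "g 1 *\<^sub>C \<kappa> m = g m *\<^sub>C \<kappa> 1" if "m \<le> n" for m
    using that
  proof (induction m rule: less_induct)
    case (less m)
    consider "m = 0" | "m = 1" | m' where "m = m' + 2" by (metis One_nat_def add_2_eq_Suc' not0_implies_Suc)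
    then show ?case
    proof cases
      case 3
      then have "g 1 *\<^sub>C \<kappa> m = (q\<^sup>2 + 1 / q\<^sup>2) *\<^sub>C (g 1 *\<^sub>C \<kappa> (m' + 1)) - g 1 *\<^sub>C \<kappa> m'"
        using less.prems rec[of m'] by (simp add: scaleC_diff_right mult.commute)
      also have "\<dots> = g m *\<^sub>C \<kappa> 1"
        using 3 less g_rec[of m'] by (simp add: scaleC_diff_left)
      finally show ?thesis .
    qed (simp_all add: \<kappa>_def g_def)
  qed
  \<comment> \<open>Both ends of the recurrence are commutators of psi_1 and psi_n, in opposite
    order.\<close>
  have "\<kappa> n = - \<kappa> 1" using n by (simp add: \<kappa>_def N_def phi_def)
  then have "(g 1 + g n) *\<^sub>C \<kappa> 1 = 0" using sol[of n]
    by (simp add: scaleC_add_left flip: eq_neg_iff_add_eq_0) (metis minus_minus)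
  moreover have "g 1 + g n \<noteq> 0"
  proof
    assume "g 1 + g n = 0"
    \<comment> \<open>With a = q^2 and b = q^(2n), the sum a - 1/a + b - 1/b equals (a + b) (a b -
      1) / (a b).\<close>
    then have "(q ^ (2 * n) + q\<^sup>2) * (q ^ (2 * n + 2) - 1) = 0"
      by (simp add: g_def field_simps power_add power2_eq_square)
    then have "q ^ (2 * n) + q\<^sup>2 = 0" using q_power[of "2 * n + 2"] by simp
    moreover have "q ^ (2 * n) = q\<^sup>2 * q ^ (2 * (n - 1))"
    proof -
      have "2 * n = 2 + 2 * (n - 1)" using n by simp
      show ?thesis by (subst \<open>2 * n = 2 + 2 * (n - 1)\<close>) (rule power_add)
    qed
    ultimately have "q\<^sup>2 * (q ^ (2 * (n - 1)) + 1) = 0"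
      by (metis add.commute distrib_left mult_1_right)
    then have "q ^ (2 * (n - 1)) = - 1" by (simp add: eq_neg_iff_add_eq_0)
    then have "q ^ (2 * (n - 1) + 2 * (n - 1)) = 1" by (simp only: power_add) simp
    then have "\<not> 2 * (n - 1) + 2 * (n - 1) > 0" using q_power by blast
    then have "n = 1" using n by simp
    then show False using \<open>q ^ (2 * (n - 1)) = - 1\<close> by simp
  qed
  ultimately have "\<kappa> 1 = 0" by simp
  then have "psi 1 * psi (int n) = psi (int n) * psi 1" by (simp add: \<kappa>_def N_def phi_def)
  then have "k * h1 * psi (int n) = psi (int n) * (k * h1)"
    by (simp add: psi_1 scaleC_left_cancel)
  moreover have "psi (int n) * (k * h1) = k * (psi (int n) * h1)"
    by (simp flip: mult.assoc k_psi)
  ultimately have "k * (h1 * psi (int n)) = k * (psi (int n) * h1)"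
    by (simp add: mult.assoc)
  then have h: "h1 * psi (int n) = psi (int n) * h1" by (metis k_ki_assoc(2))
  have step: "brk (i + 1) j = brk i (j + 1)" if "i + j = int n" for i j
    using h1_brk[of i j] levelD[OF lev[of n] that] h by simp
  have "brk i (N - i) = brk 0 N" for i
  proof (induction i rule: int_induct[where k = 0])
    case (step1 i)
    then show ?case using step[of i "N - i - 1"] by (simp add: N_def algebra_simps)
  next
    case (step2 i)
    then show ?case using step[of "i - 1" "N - i"] by (simp add: N_def algebra_simps)
  qed simp
  then show ?thesis by (simp add: level_def N_def brk_0_eq)
qed

lemma level_nat: "level (int n)"
proof (induction n rule: less_induct)
  case (less n)
  consider "n = 0" | "n = 1" | m where "n = Suc m" "m \<ge> 1"
    by (metis One_nat_def Suc_le_eq neq0_conv not0_implies_Suc)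
  then show ?case
  proof cases
    case 3
    then show ?thesis using level_Suc[of m] less by (simp add: add.commute)
  qed (simp_all add: level_01)
qed

end

section \<open>Negative loop indices, and commutativity of the psi_s\<close>

context loop_datum
begin

interpretation flip: loop_datum "1 / q" ki k xm x0 y1 y0 by (rule flip_datum)

lemma flip_brk: "flip.brk i j = brk (- 1 - i) (1 - j)"
  by (simp add: flip.brk_def brk_def flip_xp flip_ym)

text \<open>The left side is by definition the bracket of \<open>xm\<close> with y_{1-n}. The
  bracket relation of the mirrored datum moves it to a bracket with \<open>x0\<close>.\<close>

lemma flip_psi: "flip.psi (int n) = psi (- int n)"
proof -
  have "flip.psi (int n) = flip.brk (- 1) (1 + int n)"
    using flip.levelD[OF flip.level_nat, of "- 1" "1 + int n" n] by simp
  also have "\<dots> = psi (- int n)" by (simp add: flip_brk brk_0_eq)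
  finally show ?thesis .
qed

lemma brk_eq: "brk i j = psi (i + j)"
proof (cases "i + j \<ge> 0")
  case True
  then show ?thesis using levelD[OF level_nat, of i j "nat (i + j)"] by simp
next
  case False
  then have "flip.brk (- 1 - i) (1 - j) = flip.psi (int (nat (- i - j)))"
    by (intro flip.levelD[OF flip.level_nat]) simp
  also have "\<dots> = psi (i + j)" using False by (subst flip_psi) (simp add: add.commute)
  finally show ?thesis by (simp add: flip_brk)
qed

theorem xp_ym_psi: "xp i * ym j = ym j * xp i + psi (i + j)"
  using brk_eq[of i j] by (simp add: brk_def algebra_simps)

lemma h1_psi: "h1 * psi s = psi s * h1"
  using h1_brk[of 0 s] by (simp add: brk_eq add.commute)

text \<open>Now that all brackets are known to be psi, \<open>phi_brk\<close> becomes a relation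
  between commutators of phi with psi. Those with \<open>phi m\<close> and
  \<open>phi (m + 1)\<close> vanish by induction for every psi, hence so do those with
  \<open>phi (m + 2)\<close>.\<close>

lemma phi_psi: "phi m * psi s = psi s * phi m"
proof (induction m arbitrary: s rule: less_induct)
  case (less m)
  consider "m = 0" | "m = 1" | m' where "m = m' + 2"
    by (metis One_nat_def add_2_eq_Suc' not0_implies_Suc)
  then show ?case
  proof cases
    case 1
    then show ?thesis by (simp add: phi_def k_psi)
  next
    case 2
    have "k * h1 * psi s = psi s * (k * h1)"
      using h1_psi[of s] k_psi[of s] by (metis mult.assoc)
    with 2 show ?thesis by (simp add: phi_def psi_1)
  next
    case 3
    define j where "j = s - 1"
    have "level (int m')" "level (int m' + 1)" "level (int m' + 2)"
      using level_nat[of m'] level_nat[of "m' + 1"] level_nat[of "m' + 2"] by (simp_all add: add.commute)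
    from phi_brk[OF this, of 0 s]
    have "phi (m' + 2) * psi s - q\<^sup>2 *\<^sub>C (phi (m' + 1) * psi (s + 1))
      - (1 / q\<^sup>2) *\<^sub>C (phi (m' + 1) * psi (s + 1)) + phi m' * psi (s + 2)
      = psi s * phi (m' + 2) - (1 / q\<^sup>2) *\<^sub>C (psi (s + 1) * phi (m' + 1))
      - q\<^sup>2 *\<^sub>C (psi (s + 1) * phi (m' + 1)) + psi (s + 2) * phi m'"
      by (simp add: brk_eq add.commute)
    moreover have "phi (m' + 1) * psi (s + 1) = psi (s + 1) * phi (m' + 1)"
      "phi m' * psi (s + 2) = psi (s + 2) * phi m'"
      using less[of "m' + 1"] less[of m'] 3 by simp_all
    ultimately show ?thesis using 3 by simp
  qed
qed

lemma psi_psi_nat: "psi (int m) * psi s = psi s * psi (int m)"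
  using phi_psi[of m s] psi0_comm[OF k_psi] by (cases "m = 0") (simp_all add: phi_def psi_0)

lemma phi_xp': "phi (Suc m) * xp l
    = q\<^sup>2 *\<^sub>C (phi m * xp (l + 1)) + q\<^sup>2 *\<^sub>C (xp l * phi (Suc m)) - xp (l + 1) * phi m"
  using phi_xp[of m l] level_nat[of m] level_nat[of "Suc m"] by (simp add: add.commute)

end

context loop_datum
begin

interpretation flip: loop_datum "1 / q" ki k xm x0 y1 y0 by (rule flip_datum)

theorem psi_psi: "psi s * psi t = psi t * psi s"
proof -
  consider m where "s = int m" | m where "t = int m" | m n where "s = - int m" "t = - int n"
    by (metis int_cases2)
  then show ?thesis
  proof cases
    case (3 m n)
    then show ?thesis using flip.psi_psi_nat[of m "int n"] by (simp add: flip_psi)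
  qed (simp_all add: psi_psi_nat)
qed

theorem xp_phi:
  "xp l * phi (Suc m) = (1 / q\<^sup>2) *\<^sub>C (phi (Suc m) * xp l + xp (l + 1) * phi m) - phi m * xp (l + 1)"
  by (simp add: phi_xp' algebra_simps scaleC_distribs)

end

section \<open>Operators on sequences\<close>

text \<open>A single type in which the matrices of every size embed, so that the results on
  \<open>complex_algebra\<close> apply to representations of any dimension.\<close>

typedef op = "{f :: (nat \<Rightarrow> complex) \<Rightarrow> nat \<Rightarrow> complex.
  (\<forall>u v. f (\<lambda>i. u i + v i) = (\<lambda>i. f u i + f v i)) \<and> (\<forall>c u. f (\<lambda>i. c * u i) = (\<lambda>i. c * f u i))}"
  morphisms app Op
  by (rule exI[of _ "\<lambda>u i. 0"]) simp

setup_lifting type_definition_op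

lemma app_add: "app f (\<lambda>i. u i + v i) = (\<lambda>i. app f u i + app f v i)"
  and app_scale: "app f (\<lambda>i. c * u i) = (\<lambda>i. c * app f u i)"
  using app[of f] by auto

lemma app_zero [simp]: "app f (\<lambda>i. 0) = (\<lambda>i. 0)"
  using app_scale[of f 0] by simp

lemma app_sum: "app f (\<lambda>i. \<Sum>s\<in>S. u s i) = (\<lambda>i. \<Sum>s\<in>S. app f (u s) i)"
  by (induction S rule: infinite_finite_induct) (simp_all add: app_add)

lemma op_eqI: "(\<And>u i. app f u i = app g u i) \<Longrightarrow> f = g"
  by (metis app_inject ext)

instantiation op :: complex_algebra
begin

lift_definition zero_op :: op is "\<lambda>u i. 0" by simp
lift_definition one_op :: op is "\<lambda>u. u" by simp
lift_definition plus_op :: "op \<Rightarrow> op \<Rightarrow> op" is "\<lambda>f g u i. f u i + g u i" by (simp add: algebra_simps)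
lift_definition minus_op :: "op \<Rightarrow> op \<Rightarrow> op" is "\<lambda>f g u i. f u i - g u i" by (simp add: algebra_simps)
lift_definition uminus_op :: "op \<Rightarrow> op" is "\<lambda>f u i. - f u i" by simp
lift_definition times_op :: "op \<Rightarrow> op \<Rightarrow> op" is "\<lambda>f g u. f (g u)" by simp
lift_definition scaleC_op :: "complex \<Rightarrow> op \<Rightarrow> op" is "\<lambda>c f u i. c * f u i"
  by (simp add: algebra_simps)

instance
proof
  show "(0 :: op) \<noteq> 1"
  proof
    assume "(0 :: op) = 1"
    then have "app (0 :: op) (\<lambda>i. 1) 0 = app 1 (\<lambda>i. 1) 0" by simp
    then show False by (simp add: zero_op.rep_eq one_op.rep_eq)
  qed
qed (transfer; auto simp: algebra_simps fun_eq_iff)+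

end

lemmas op_rep_eq = zero_op.rep_eq one_op.rep_eq plus_op.rep_eq minus_op.rep_eq
  uminus_op.rep_eq times_op.rep_eq scaleC_op.rep_eq

text \<open>A matrix of size \<open>n > 0\<close> acts diagonally on consecutive blocks of length \<open>n\<close>, so that
  the embedding is unital.\<close>

lift_definition op_of :: "nat \<Rightarrow> complex mat \<Rightarrow> op" is
  "\<lambda>n A u i. \<Sum>j = 0..<n. A $$ (i mod n, j) * u (n * (i div n) + j)"
  by (simp add: algebra_simps sum.distrib sum_distrib_left)

lemma app_op_of: "i < n \<Longrightarrow> app (op_of n A) u i = (\<Sum>j = 0..<n. A $$ (i, j) * u j)"
  by (simp add: op_of.rep_eq)

lemma op_of_mult:
  assumes "A \<in> carrier_mat n n" "B \<in> carrier_mat n n"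
  shows "op_of n (A * B) = op_of n A * op_of n B"
proof (cases "n = 0")
  case False
  show ?thesis
  proof (rule op_eqI)
    fix u i
    define c where "c = n * (i div n)"
    have r: "i mod n < n" using False by simp
    have "app (op_of n (A * B)) u i = (\<Sum>j = 0..<n. (\<Sum>l = 0..<n. A $$ (i mod n, l) * B $$ (l, j)) * u (c + j))"
      using assms r by (simp add: op_of.rep_eq c_def scalar_prod_def)
    also have "\<dots> = (\<Sum>l = 0..<n. \<Sum>j = 0..<n. A $$ (i mod n, l) * (B $$ (l, j) * u (c + j)))"
      by (subst sum.swap) (simp add: sum_distrib_right mult.assoc)
    also have "\<dots> = (\<Sum>l = 0..<n. A $$ (i mod n, l) * app (op_of n B) u (c + l))"
      using False by (simp add: op_of.rep_eq c_def sum_distrib_left)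
    finally show "app (op_of n (A * B)) u i = app (op_of n A * op_of n B) u i"
      by (simp add: op_rep_eq op_of.rep_eq c_def)
  qed
qed (auto intro!: op_eqI simp: op_of.rep_eq op_rep_eq)

lemma op_of_add:
  "A \<in> carrier_mat n n \<Longrightarrow> B \<in> carrier_mat n n \<Longrightarrow> op_of n (A + B) = op_of n A + op_of n B"
  by (rule op_eqI, cases "n = 0")
    (auto simp: op_of.rep_eq op_rep_eq algebra_simps sum.distrib)

lemma op_of_smult:
  "A \<in> carrier_mat n n \<Longrightarrow> op_of n (c \<cdot>\<^sub>m A) = c *\<^sub>C op_of n A"
  by (rule op_eqI, cases "n = 0")
    (auto simp: op_of.rep_eq op_rep_eq algebra_simps sum_distrib_left)

lemma op_of_one: "n > 0 \<Longrightarrow> op_of n (1\<^sub>m n) = 1"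
  by (rule op_eqI) (simp add: op_of.rep_eq op_rep_eq if_distrib[of "\<lambda>c. c * _"] cong: if_cong)

lemma op_of_zero: "op_of n (0\<^sub>m n n) = 0"
  by (rule op_eqI, cases "n = 0") (auto simp: op_of.rep_eq op_rep_eq)

lemma op_of_inject:
  assumes "op_of n A = op_of n B" "A \<in> carrier_mat n n" "B \<in> carrier_mat n n"
  shows "A = B"
proof (rule eq_matI)
  fix i j assume "i < dim_row B" "j < dim_col B"
  then have ij: "i < n" "j < n" using assms by auto
  have "app (op_of n A) (\<lambda>l. if l = j then 1 else 0) i = app (op_of n B) (\<lambda>l. if l = j then 1 else 0) i"
    using assms(1) by simp
  then show "A $$ (i, j) = B $$ (i, j)"
    using ij by (simp add: app_op_of if_distrib cong: if_cong)
qed (use assms in auto)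

section \<open>Matrices of type one\<close>

definition qdiag :: "complex \<Rightarrow> nat \<Rightarrow> (nat \<Rightarrow> int) \<Rightarrow> complex mat" where
  "qdiag q n w = mat n n (\<lambda>(i, j). if i = j then q powi w i else 0)"

lemma qdiag_carrier [simp]: "qdiag q n w \<in> carrier_mat n n"
  by (simp add: qdiag_def)

definition type_one_mat :: "complex \<Rightarrow> complex mat \<Rightarrow> bool" where
  "type_one_mat q A \<longleftrightarrow> diagonalizable A \<and> (\<forall>c. eigenvalue A c \<longrightarrow> (\<exists>k::int. c = q powi k))"

lemma type_one_matE:
  assumes "type_one_mat q A" "A \<in> carrier_mat n n"
  obtains w P P' where "P \<in> carrier_mat n n" "P' \<in> carrier_mat n n" "P * P' = 1\<^sub>m n" "P' * P = 1\<^sub>m n"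
    "A = P * qdiag q n w * P'"
proof -
  obtain D P P' where D: "similar_mat_wit A D P P'" "diagonal_mat D"
    using assms unfolding type_one_mat_def diagonalizable_def similar_mat_def by blast
  note c = similar_mat_witD2[OF assms(2) D(1)]
  have "\<exists>k::int. D $$ (i, i) = q powi k" if i: "i < n" for i
  proof -
    have "eigenvalue A (D $$ (i, i))"
    proof -
      let ?v = "P *\<^sub>v unit_vec n i"
      have "D *\<^sub>v unit_vec n i = D $$ (i, i) \<cdot>\<^sub>v unit_vec n i"
        using D(2) c i unfolding diagonal_mat_def
        by (intro eq_vecI) (auto simp: scalar_prod_def unit_vec_def if_distrib cong: if_cong)
      moreover have "A *\<^sub>v ?v = P *\<^sub>v (D *\<^sub>v (P' *\<^sub>v (P *\<^sub>v unit_vec n i)))"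
        using c by (simp add: assoc_mult_mat_vec[of _ n n _ n])
      moreover have "P' *\<^sub>v (P *\<^sub>v unit_vec n i) = unit_vec n i"
        using c by (simp flip: assoc_mult_mat_vec)
      ultimately have "A *\<^sub>v ?v = D $$ (i, i) \<cdot>\<^sub>v ?v"
        using c by (simp add: mult_mat_vec[of _ n n])
      moreover have "?v \<noteq> 0\<^sub>v n"
      proof
        assume "?v = 0\<^sub>v n"
        then have "P' *\<^sub>v (P *\<^sub>v unit_vec n i) = 0\<^sub>v n" using c by auto
        then have "unit_vec n i = (0\<^sub>v n :: complex vec)"
          using \<open>P' *\<^sub>v (P *\<^sub>v unit_vec n i) = unit_vec n i\<close> by simp
        then show False using i by simp
      qed
      ultimately show ?thesis using c unfolding eigenvalue_def eigenvector_def
        by (intro exI[of _ ?v]) auto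
    qed
    then show ?thesis using assms(1) by (auto simp: type_one_mat_def)
  qed
  then obtain w :: "nat \<Rightarrow> int" where w: "\<And>i. i < n \<Longrightarrow> D $$ (i, i) = q powi w i" by metis
  have "D = qdiag q n w"
    using c w D(2) by (intro eq_matI) (auto simp: qdiag_def diagonal_mat_def)
  then show thesis using that[of P P' w] c by auto
qed

lemma type_one_matI:
  assumes "P \<in> carrier_mat n n" "P' \<in> carrier_mat n n" "P * P' = 1\<^sub>m n" "P' * P = 1\<^sub>m n"
    "A = P * qdiag q n w * P'"
  shows "type_one_mat q A"
proof -
  have c: "A \<in> carrier_mat n n" using assms by auto
  have s: "similar_mat_wit A (qdiag q n w) P P'"
    using assms c by (intro similar_mat_witI) auto
  have "diagonalizable A"
    unfolding diagonalizable_def similar_mat_def using s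
    by (intro exI[of _ "qdiag q n w"]) (auto simp: diagonal_mat_def qdiag_def)
  moreover have "\<exists>k::int. e = q powi k" if ev: "eigenvalue A e" for e
  proof -
    have "poly (char_poly A) e = 0" using ev eigenvalue_root_char_poly[OF c] by simp
    also have "char_poly A = char_poly (qdiag q n w)"
      by (rule char_poly_similar) (use s in \<open>auto simp: similar_mat_def\<close>)
    finally have "eigenvalue (qdiag q n w) e"
      using eigenvalue_root_char_poly[of "qdiag q n w" n] by simp
    then obtain v where v: "v \<in> carrier_vec n" "v \<noteq> 0\<^sub>v n" "qdiag q n w *\<^sub>v v = e \<cdot>\<^sub>v v"
      by (auto simp: eigenvalue_def eigenvector_def qdiag_def)
    obtain i where i: "i < n" "v $ i \<noteq> 0"
      using v(1,2) by (metis eq_vecI carrier_vecD index_zero_vec)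
    have "(qdiag q n w *\<^sub>v v) $ i = q powi w i * v $ i"
      using i v(1) by (simp add: qdiag_def scalar_prod_def if_distrib[of "\<lambda>c. c * _"] cong: if_cong)
    then have "q powi w i * v $ i = e * v $ i" using v i by simp
    then show ?thesis using i by auto
  qed
  ultimately show ?thesis by (simp add: type_one_mat_def)
qed

lemma app_qdiag:
  "app (op_of n (qdiag q n w)) u i = (if n = 0 then 0 else q powi w (i mod n) * u i)"
proof (cases "n = 0")
  case False
  then have "i mod n < n" by simp
  then have "(\<Sum>j = 0..<n. qdiag q n w $$ (i mod n, j) * u (n * (i div n) + j))
      = (\<Sum>j = 0..<n. if j = i mod n then q powi w (i mod n) * u (n * (i div n) + j) else 0)"
    by (intro sum.cong) (auto simp: qdiag_def)
  also have "\<dots> = q powi w (i mod n) * u i" using \<open>i mod n < n\<close> by simp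
  finally show ?thesis using False by (simp add: op_of.rep_eq)
qed (simp add: op_of.rep_eq)

context generic_parameter
begin

lemma q_powi_eq_1_iff: "q powi k = 1 \<longleftrightarrow> k = 0"
proof
  assume *: "q powi k = 1"
  show "k = 0"
  proof (rule ccontr)
    assume "k \<noteq> 0"
    moreover have "q ^ nat \<bar>k\<bar> = 1"
      using * by (cases "k \<ge> 0") (simp_all add: power_int_def field_simps)
    ultimately show False using q_power[of "nat \<bar>k\<bar>"] by simp
  qed
qed simp

lemma q_powi_inject: "q powi k = q powi l \<longleftrightarrow> k = l"
  using q_powi_eq_1_iff[of "k - l"] by (auto simp: power_int_diff)

text \<open>The operator x is arbitrary and need not come from a matrix, so a sequence is cut into
  its finitely many weight components before x is applied.\<close>

lemma qdiag_bounded: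
  assumes n: "n > 0"
  shows "\<exists>M. \<forall>m\<ge>M. \<forall>x. op_of n (qdiag q n w) * x = q ^ m *\<^sub>C (x * op_of n (qdiag q n w)) \<longrightarrow> x = 0"
proof (intro exI allI impI)
  define B where "B = Max ((\<lambda>i. \<bar>w i\<bar>) ` {..<n})"
  have B: "\<bar>w i\<bar> \<le> B" if "i < n" for i unfolding B_def using that by (intro Max_ge) auto
  \<comment> \<open>All weights lie between -B and B, so no two of them differ by more than
    2B.\<close>
  fix m x assume m: "m \<ge> nat (2 * B + 1)"
    and x: "op_of n (qdiag q n w) * x = q ^ m *\<^sub>C (x * op_of n (qdiag q n w))"
  define S where "S = w ` {..<n}"
  show "x = 0"
  proof (rule op_eqI)
    fix u :: "nat \<Rightarrow> complex" and i
    define us where "us s i = (if w (i mod n) = s then u i else 0)" for s i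
    have "u = (\<lambda>i. \<Sum>s\<in>S. us s i)"
      using n by (auto simp: us_def S_def fun_eq_iff)
    then have "app x u i = (\<Sum>s\<in>S. app x (us s) i)" by (metis app_sum)
    also have "\<dots> = 0"
    proof (rule sum.neutral, safe)
      fix s assume s: "s \<in> S"
      have d: "app (op_of n (qdiag q n w)) (us s) = (\<lambda>i. q powi s * us s i)"
        using n by (auto simp: app_qdiag us_def fun_eq_iff)
      have "app (op_of n (qdiag q n w) * x) (us s) i = app (q ^ m *\<^sub>C (x * op_of n (qdiag q n w))) (us s) i"
        using x by simp
      then have "q powi w (i mod n) * app x (us s) i = q ^ m * (q powi s * app x (us s) i)"
        using n by (simp add: op_rep_eq d app_scale app_qdiag)
      then have *: "q powi w (i mod n) * app x (us s) i = q powi (int m + s) * app x (us s) i"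
        by (simp add: power_int_add)
      have "\<bar>s\<bar> \<le> B" "\<bar>w (i mod n)\<bar> \<le> B" using s n B by (auto simp: S_def)
      then have "w (i mod n) \<noteq> int m + s" using m by linarith
      then show "app x (us s) i = 0" using * by (simp add: q_powi_inject)
    qed
    finally show "app x u i = app 0 u i" by (simp add: op_rep_eq)
  qed
qed

lemma type_one_bounded:
  assumes A: "type_one_mat q A" "A \<in> carrier_mat n n" and n: "n > 0"
  shows "\<exists>M. \<forall>m\<ge>M. \<forall>x. op_of n A * x = q ^ m *\<^sub>C (x * op_of n A) \<longrightarrow> x = 0"
proof -
  obtain w P P' where P: "P \<in> carrier_mat n n" "P' \<in> carrier_mat n n" "P * P' = 1\<^sub>m n" "P' * P = 1\<^sub>m n"
    "A = P * qdiag q n w * P'"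
    using type_one_matE[OF A] by metis
  define p p' d where "p = op_of n P" and "p' = op_of n P'" and "d = op_of n (qdiag q n w)"
  have pp: "p * p' = 1" "p' * p = 1"
    using P n by (simp_all add: p_def p'_def op_of_one flip: op_of_mult)
  have a: "op_of n A = p * d * p'"
    using P by (simp add: p_def p'_def d_def op_of_mult[of _ n] mult_carrier_mat[of _ n n _ n])
  obtain M where M: "\<And>m x. m \<ge> M \<Longrightarrow> d * x = q ^ m *\<^sub>C (x * d) \<Longrightarrow> x = 0"
    using qdiag_bounded[OF n, of w] unfolding d_def by blast
  have pp': "p * (p' * u) = u" "p' * (p * u) = u" for u using pp by (simp_all flip: mult.assoc)
  show ?thesis
  proof (intro exI allI impI)
    fix m x assume "m \<ge> M" and x: "op_of n A * x = q ^ m *\<^sub>C (x * op_of n A)"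
    have "p' * (p * d * p' * x) * p = p' * (q ^ m *\<^sub>C (x * (p * d * p'))) * p"
      using x a by simp
    then have "d * (p' * x * p) = q ^ m *\<^sub>C (p' * x * p * d)"
      by (simp add: mult.assoc pp' pp)
    then have "p' * x * p = 0" using M \<open>m \<ge> M\<close> by blast
    then have "p * (p' * x * p) * p' = 0" by simp
    then show "x = 0" by (simp add: mult.assoc pp' pp)
  qed
qed

end

lemma type_one_mat_inverse:
  assumes "q \<noteq> 0" "type_one_mat q A" "A \<in> carrier_mat n n" "B \<in> carrier_mat n n" "A * B = 1\<^sub>m n"
  shows "type_one_mat q B"
proof -
  obtain w P P' where P: "P \<in> carrier_mat n n" "P' \<in> carrier_mat n n" "P * P' = 1\<^sub>m n" "P' * P = 1\<^sub>m n"
    "A = P * qdiag q n w * P'"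
    using type_one_matE[OF assms(2,3)] by metis
  let ?D = "qdiag q n w" and ?E = "qdiag q n (\<lambda>i. - w i)"
  have ED: "?E * ?D = 1\<^sub>m n"
    using assms(1) by (intro eq_matI) (auto simp: qdiag_def scalar_prod_def if_distrib power_int_minus cong: if_cong)
  have "P * ?E * P' * A = P * ?E * (P' * P) * ?D * P'"
    using P(1,2) by (simp add: P(5) assoc_mult_mat[of _ n n _ n _ n] mult_carrier_mat[of _ n n _ n])
  also have "\<dots> = P * (?E * ?D) * P'"
    using P(1,2) by (simp add: P(4) left_mult_one_mat[of _ n n] assoc_mult_mat[of _ n n _ n _ n] mult_carrier_mat[of _ n n _ n])
  also have "\<dots> = 1\<^sub>m n" using P by (simp add: ED)
  finally have "P * ?E * P' * A * B = B" using assms by simp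
  moreover have "P * ?E * P' * A * B = P * ?E * P'"
    using P(1,2) assms(3-5) by (simp add: assoc_mult_mat[of _ n n _ n _ n] mult_carrier_mat[of _ n n _ n])
  ultimately show ?thesis by (intro type_one_matI[OF P(1-4), where w = "\<lambda>i. - w i"]) simp
qed

section \<open>Evaluating elements of free algebras\<close>

lemma keys_sum_superset:
  assumes "finite A" "Poly_Mapping.keys f \<subseteq> A" "\<And>w. g w 0 = 0"
  shows "(\<Sum>w\<in>Poly_Mapping.keys f. g w (Poly_Mapping.lookup f w)) = (\<Sum>w\<in>A. g w (Poly_Mapping.lookup f w))"
  using assms by (intro sum.mono_neutral_left) (auto simp: in_keys_iff)

lemma keys_sum_add:
  assumes "\<And>w. g w 0 = 0" "\<And>w a b. g w (a + b) = g w a + g w b"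
  shows "(\<Sum>w\<in>Poly_Mapping.keys (f + h). g w (Poly_Mapping.lookup (f + h) w))
    = (\<Sum>w\<in>Poly_Mapping.keys f. g w (Poly_Mapping.lookup f w))
      + (\<Sum>w\<in>Poly_Mapping.keys h. g w (Poly_Mapping.lookup h w))"
proof -
  let ?A = "Poly_Mapping.keys f \<union> Poly_Mapping.keys h"
  have "Poly_Mapping.keys (f + h) \<subseteq> ?A" by (rule Poly_Mapping.keys_add)
  then show ?thesis
    using assms by (subst (1 2 3) keys_sum_superset[where A = ?A]) (auto simp: lookup_add sum.distrib)
qed

lemma keys_sum_single:
  assumes "\<And>w. g w 0 = 0"
  shows "(\<Sum>w\<in>Poly_Mapping.keys (Poly_Mapping.single k c). g w (Poly_Mapping.lookup (Poly_Mapping.single k c) w)) = g k c"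
  using assms by (cases "c = 0") simp_all

lemma poly_mapping_induct_add [case_names single add]:
  fixes f :: "'k \<Rightarrow>\<^sub>0 'b::comm_monoid_add"
  assumes single: "\<And>k c. P (Poly_Mapping.single k c)"
    and add: "\<And>f g. P f \<Longrightarrow> P g \<Longrightarrow> P (f + g)"
  shows "P f"
proof -
  have "P (\<Sum>w\<in>A. Poly_Mapping.single w (Poly_Mapping.lookup f w))" if "finite A" for A
    using that
  proof induction
    case empty
    then show ?case using single[of undefined 0] by simp
  qed (simp add: single add)
  moreover have "(\<Sum>w\<in>Poly_Mapping.keys f. Poly_Mapping.single w (Poly_Mapping.lookup f w)) = f"
    by (rule poly_mapping_eqI)
      (simp add: lookup_sum lookup_single when_def in_keys_iff)
  ultimately show ?thesis by (metis finite_keys)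
qed

lemma free_alg_induct [case_names scal gen add mult]:
  fixes f :: "'g free_alg"
  assumes scal: "\<And>c. P (scal c)" and gen: "\<And>x. P (gen x)"
    and add: "\<And>f g. P f \<Longrightarrow> P g \<Longrightarrow> P (f + g)"
    and mult: "\<And>f g. P f \<Longrightarrow> P g \<Longrightarrow> P (f * g)"
  shows "P f"
proof (induction f rule: poly_mapping_induct_add)
  case (single k c)
  obtain xs where k: "k = Word xs" by (cases k)
  have "P (Poly_Mapping.single (Word xs) c)"
  proof (induction xs)
    case Nil
    then show ?case using scal by (simp add: zero_word_def)
  next
    case (Cons x xs)
    have "Poly_Mapping.single (Word (x # xs)) c = gen x * Poly_Mapping.single (Word xs) c"
      by (simp add: mult_single plus_word_def)
    then show ?case using mult[OF gen Cons] by simp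
  qed
  then show ?case by (simp add: k)
qed (rule add)

text \<open>A common frame for the evaluation in operator algebras, for \<open>comult\<close> and
  for \<open>counit\<close>.\<close>

locale scalar_embedding =
  fixes s :: "complex \<Rightarrow> 'r::ring_1"
  assumes s_add: "s (a + b) = s a + s b" and s_mult: "s (a * b) = s a * s b"
    and s_one: "s 1 = 1" and s_central: "s a * x = x * s a"
begin

lemma s_zero: "s 0 = 0"
  using s_add[of 0 0] by simp

lemma free_lift_add: "free_lift s h (f + g) = free_lift s h f + free_lift s h g"
  unfolding free_lift_def by (rule keys_sum_add) (simp_all add: s_add s_zero distrib_right)

lemma free_lift_single:
  "free_lift s h (Poly_Mapping.single w c) = s c * prod_list (map h (letters w))"
  unfolding free_lift_def by (subst keys_sum_single) (simp_all add: s_zero)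

lemma free_lift_scal [simp]: "free_lift s h (scal c) = s c"
  by (simp add: free_lift_single zero_word_def)

lemma free_lift_gen [simp]: "free_lift s h (gen x) = h x"
  by (simp add: free_lift_single s_one)

lemma free_lift_one [simp]: "free_lift s h 1 = 1"
  using free_lift_scal[of h 1] by (simp only: single_one s_one)

lemma free_lift_zero [simp]: "free_lift s h 0 = 0"
  by (simp add: free_lift_def)

lemma free_lift_mult [simp]: "free_lift s h (f * g) = free_lift s h f * free_lift s h g"
proof (induction f rule: poly_mapping_induct_add)
  case (single u a)
  show ?case
  proof (induction g rule: poly_mapping_induct_add)
    case (single v b)
    have "s a * (prod_list (map h (letters u)) * (s b * x)) = s a * (s b * (prod_list (map h (letters u)) * x))" for x
      by (metis mult.assoc s_central)
    then show ?case by (simp add: mult_single free_lift_single plus_word_def s_mult mult.assoc)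
  qed (simp add: distrib_left free_lift_add)
qed (simp add: distrib_right free_lift_add)

lemma free_lift_diff [simp]: "free_lift s h (f - g) = free_lift s h f - free_lift s h g"
  using free_lift_add[of h "f - g" g] by (simp add: algebra_simps)

lemma free_lift_power [simp]: "free_lift s h (f ^ n) = free_lift s h f ^ n"
  by (induction n) simp_all

end

interpretation scaleC_embedding: scalar_embedding "\<lambda>c. c *\<^sub>C (1 :: 'a::complex_algebra)"
  by unfold_locales (simp_all add: scaleC_add_left mult.commute)

interpretation scal_embedding: scalar_embedding "scal :: complex \<Rightarrow> 'g free_alg2"
proof
  fix a and x :: "'g free_alg2"
  show "scal a * x = x * scal a"
    by (induction x rule: poly_mapping_induct_add)
      (simp_all add: mult_single distrib_left distrib_right mult.commute)
qed (simp_all add: single_add mult_single)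

interpretation id_embedding: scalar_embedding "\<lambda>c::complex. c"
  by unfold_locales (simp_all add: mult.commute)

section \<open>Representations and their generators\<close>

lemma uq_ideal: "ideal (uq_ideal q) class_ring"
  unfolding uq_ideal_def by (rule ring.genideal_ideal[OF class_ring.ring_axioms]) simp

lemma uq_relators_in_ideal: "r \<in> uq_relators q \<Longrightarrow> r \<in> uq_ideal q"
  unfolding uq_ideal_def genideal_def by blast

lemma uq_class_mult: "uq_class q f \<otimes>\<^bsub>Uq q\<^esub> uq_class q g = uq_class q (f * g)"
  using ideal.rcoset_mult_add[OF uq_ideal[of q], of f g]
  by (simp add: uq_class_def Uq_def FactRing_def)

lemma uq_class_add: "uq_class q f \<oplus>\<^bsub>Uq q\<^esub> uq_class q g = uq_class q (f + g)"
proof -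
  interpret ideal "uq_ideal q" class_ring by (rule uq_ideal)
  show ?thesis using a_rcos_sum[of f g] by (simp add: uq_class_def Uq_def FactRing_def)
qed

lemma uq_class_one: "\<one>\<^bsub>Uq q\<^esub> = uq_class q 1"
  by (simp add: uq_class_def Uq_def FactRing_def)

lemma carrier_Uq: "carrier (Uq q) = range (uq_class q)"
  by (auto simp: Uq_def FactRing_def A_RCOSETS_def' uq_class_def)

lemma mem_uq_class: "g \<in> uq_class q f \<longleftrightarrow> g - f \<in> uq_ideal q"
  by (force simp: uq_class_def a_r_coset_def' algebra_simps)

lemma uq_class_eqI: "g \<in> uq_class q f \<Longrightarrow> uq_class q g = uq_class q f"
proof -
  interpret ideal "uq_ideal q" class_ring by (rule uq_ideal)
  assume "g \<in> uq_class q f"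
  then show ?thesis unfolding uq_class_def by (intro a_repr_independence'[symmetric]) simp_all
qed

lemma uq_class_self: "f \<in> uq_class q f"
proof -
  interpret ideal "uq_ideal q" class_ring by (rule uq_ideal)
  show ?thesis using a_rcos_self[of f] by (simp add: uq_class_def)
qed

definition act :: "complex \<Rightarrow> uq_rep \<Rightarrow> uq_gen free_alg \<Rightarrow> complex mat" where
  "act q V f = snd V (uq_class q f)"

context
  fixes q V assumes V: "is_rep q V"
begin

lemma rep_ring_hom: "snd V \<in> Ring.ring_hom (Uq q) (ring_mat TYPE(complex) (fst V) ())"
  and act_scal: "act q V (scal c) = c \<cdot>\<^sub>m 1\<^sub>m (fst V)"
  using V by (simp_all add: is_rep_def act_def case_prod_beta)

lemma act_carrier: "act q V f \<in> carrier_mat (fst V) (fst V)"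
  using ring_hom_closed[OF rep_ring_hom, of "uq_class q f"]
  by (simp add: act_def carrier_Uq ring_mat_simps)

lemma act_add: "act q V (f + g) = act q V f + act q V g"
  using ring_hom_add[OF rep_ring_hom, of "uq_class q f" "uq_class q g"]
  by (simp add: act_def carrier_Uq ring_mat_simps uq_class_add)

lemma act_mult: "act q V (f * g) = act q V f * act q V g"
  using ring_hom_mult[OF rep_ring_hom, of "uq_class q f" "uq_class q g"]
  by (simp add: act_def carrier_Uq ring_mat_simps uq_class_mult)

lemma act_ideal:
  assumes "f \<in> uq_ideal q"
  shows "act q V f = 0\<^sub>m (fst V) (fst V)"
proof -
  have "uq_class q f = uq_class q (scal 0)"
    by (rule uq_class_eqI) (simp add: mem_uq_class assms)
  then have "act q V f = act q V (scal 0)" by (simp add: act_def)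
  also have "\<dots> = 0\<^sub>m (fst V) (fst V)" by (subst act_scal) (auto intro!: eq_matI)
  finally show ?thesis .
qed

end

text \<open>A matrix representation of the free algebra. Whether it descends to \<open>Uq\<close> is
  settled separately, by the lemma \<open>rep\<close> of this locale.\<close>

locale mat_hom =
  fixes N :: nat and T :: "uq_gen free_alg \<Rightarrow> complex mat"
  assumes T_carrier: "T f \<in> carrier_mat N N"
    and T_add: "T (f + g) = T f + T g" and T_mult: "T (f * g) = T f * T g"
    and T_scal: "T (scal c) = c \<cdot>\<^sub>m 1\<^sub>m N"
begin

lemma T_one: "T 1 = 1\<^sub>m N"
proof -
  have "1 \<cdot>\<^sub>m 1\<^sub>m N = (1\<^sub>m N :: complex mat)" by (rule eq_matI) simp_all
  then have "T (scal 1) = 1\<^sub>m N" by (simp only: T_scal)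
  then show ?thesis by (simp only: single_one)
qed

lemma op_of_T:
  assumes "N > 0"
  shows "op_of N (T f) = free_lift (\<lambda>c. c *\<^sub>C 1) (\<lambda>x. op_of N (T (gen x))) f"
proof (induction f rule: free_alg_induct)
  case (scal c)
  then show ?case by (subst T_scal) (simp add: op_of_smult op_of_one assms)
qed (simp_all add: T_add T_mult T_carrier op_of_add op_of_mult scaleC_embedding.free_lift_add)

end

lemma mat_hom_act: "is_rep q V \<Longrightarrow> mat_hom (fst V) (act q V)"
  by unfold_locales (simp_all add: act_carrier act_add act_mult act_scal)

section \<open>The relations at level zero\<close>

text \<open>The Serre relations are derived from these relations and bounded weights, in
  \<open>relators_vanish\<close>. A dual or a tensor product therefore only has to satisfy the
  relations listed here, which are linear or quadratic in the X.\<close>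

locale level_zero =
  fixes q :: complex and G :: "uq_gen \<Rightarrow> 'a::complex_algebra"
  assumes K_KInv [simp]: "G (K i) * G (KInv i) = 1" and KInv_K [simp]: "G (KInv i) * G (K i) = 1"
    and K0_K1: "G (K N0) * G (K N1) = 1" and CSqrt: "G CSqrt = 1" and CSqrtInv: "G CSqrtInv = 1"
    and K_XPlus: "G (K i) * G (XPlus j) = (q powi cartan i j) *\<^sub>C (G (XPlus j) * G (K i))"
    and K_XMinus: "G (K i) * G (XMinus j) = (q powi (- cartan i j)) *\<^sub>C (G (XMinus j) * G (K i))"
    and bracket: "G (XPlus i) * G (XMinus j) - G (XMinus j) * G (XPlus i)
      = (if i = j then (1 / (q - inverse q)) *\<^sub>C (G (K i) - G (KInv i)) else 0)"
begin

lemma KInv_N0: "G (KInv N0) = G (K N1)"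
proof -
  have "G (KInv N0) * (G (K N0) * G (K N1)) = G (K N1)" by (simp flip: mult.assoc)
  then show ?thesis by (simp add: K0_K1)
qed

lemma KInv_N1: "G (KInv N1) = G (K N0)"
proof -
  have "G (K N0) * (G (K N1) * G (KInv N1)) = G (KInv N1)" by (simp add: K0_K1 del: K_KInv flip: mult.assoc)
  then show ?thesis by simp
qed

lemma K1_K0: "G (K N1) * G (K N0) = 1"
  using KInv_K[of N0] by (simp add: KInv_N0)

end

lemma (in mat_hom) level_zero:
  assumes N: "N > 0" and rel: "\<And>r. r \<in> uq_relators q \<Longrightarrow> T r = 0\<^sub>m N N"
    and CS: "T (gen CSqrt) = 1\<^sub>m N"
  shows "level_zero q (\<lambda>x. op_of N (T (gen x)))"
proof -
  let ?G = "\<lambda>x. op_of N (T (gen x))"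
  have CS: "?G CSqrt = 1" by (simp only: CS op_of_one[OF N])
  have rel: "free_lift (\<lambda>c. c *\<^sub>C 1) ?G r = 0" if "r \<in> uq_relators q" for r
    using op_of_T[OF N, of r] rel[OF that] by (simp add: op_of_zero)
  note [simp] = scaleC_embedding.free_lift_add
  have inv: "?G (K i) * ?G (KInv i) = 1" "?G (KInv i) * ?G (K i) = 1" for i
    using rel[OF K_KInv[of i]] rel[OF KInv_K[of i]] by simp_all
  show ?thesis
  proof
    show "?G (K N0) * ?G (K N1) = 1" using rel[OF CSqrt_square] CS by simp
    show "?G CSqrtInv = 1" using rel[OF CSqrt_CSqrtInv] CS by simp
    have *: "a * x = c *\<^sub>C (x * a)" if "a * x * b - (c *\<^sub>C 1) * x = 0" "b * a = 1" for a b x :: op and c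
    proof -
      have "a * x = a * x * b * a" using that(2) by (simp add: mult.assoc)
      then show ?thesis using that(1) by simp
    qed
    show "?G (K i) * ?G (XPlus j) = (q powi cartan i j) *\<^sub>C (?G (XPlus j) * ?G (K i))" for i j
      by (rule *[OF _ inv(2)[of i]]) (use rel[OF K_XPlus[of i j]] in simp)
    show "?G (K i) * ?G (XMinus j) = (q powi (- cartan i j)) *\<^sub>C (?G (XMinus j) * ?G (K i))" for i j
      by (rule *[OF _ inv(2)[of i]]) (use rel[OF K_XMinus[of i j]] in simp)
    show "?G (XPlus i) * ?G (XMinus j) - ?G (XMinus j) * ?G (XPlus i)
      = (if i = j then (1 / (q - inverse q)) *\<^sub>C (?G (K i) - ?G (KInv i)) else 0)" for i j
      using rel[OF XPlus_XMinus[of i j]] by (auto split: if_splits)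
  qed (use CS inv in auto)
qed

section \<open>The Serre relations at level zero\<close>

primrec swap_node :: "node \<Rightarrow> node" where
  "swap_node N0 = N1" | "swap_node N1 = N0"

text \<open>Together with \<open>sign_swap\<close> this is a symmetry of \<open>level_zero\<close>;
  the two reduce the four Serre relations to a single one.\<close>

primrec node_swap :: "uq_gen \<Rightarrow> uq_gen" where
  "node_swap (K i) = K (swap_node i)"
| "node_swap (KInv i) = KInv (swap_node i)"
| "node_swap (XPlus i) = XPlus (swap_node i)"
| "node_swap (XMinus i) = XMinus (swap_node i)"
| "node_swap CSqrt = CSqrt"
| "node_swap CSqrtInv = CSqrtInv"

primrec sign_swap :: "uq_gen \<Rightarrow> uq_gen" where
  "sign_swap (K i) = KInv i"
| "sign_swap (KInv i) = K i"
| "sign_swap (XPlus i) = XMinus i"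
| "sign_swap (XMinus i) = XPlus i"
| "sign_swap CSqrt = CSqrt"
| "sign_swap CSqrtInv = CSqrtInv"

lemma cartan_swap [simp]: "cartan (swap_node i) (swap_node j) = cartan i j"
  by (cases i; cases j) (simp_all add: cartan_def)

lemma swap_node_eq [simp]: "swap_node i = swap_node j \<longleftrightarrow> i = j"
  by (cases i; cases j) simp_all

context level_zero
begin

lemma level_zero_node_swap: "level_zero q (\<lambda>x. G (node_swap x))"
  by unfold_locales (simp_all add: K1_K0 CSqrt CSqrtInv K_XPlus K_XMinus bracket)

lemma KInv_conj:
  assumes "G (K i) * x = c *\<^sub>C (x * G (K i))" "c \<noteq> 0"
  shows "G (KInv i) * x = (1 / c) *\<^sub>C (x * G (KInv i))"
proof -
  have "x * G (KInv i) = G (KInv i) * (G (K i) * x) * G (KInv i)" by (simp flip: mult.assoc)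
  also have "\<dots> = c *\<^sub>C (G (KInv i) * x * (G (K i) * G (KInv i)))" using assms(1) by (simp add: mult.assoc)
  finally have "x * G (KInv i) = c *\<^sub>C (G (KInv i) * x)" by simp
  then show ?thesis using assms(2) by simp
qed

lemma level_zero_sign_swap:
  assumes "q \<noteq> 0"
  shows "level_zero q (\<lambda>x. G (sign_swap x))"
proof
  show "G (sign_swap (K i)) * G (sign_swap (XPlus j))
      = (q powi cartan i j) *\<^sub>C (G (sign_swap (XPlus j)) * G (sign_swap (K i)))" for i j
    using KInv_conj[OF K_XMinus[of i j]] assms by (simp add: power_int_minus field_simps)
  show "G (sign_swap (K i)) * G (sign_swap (XMinus j))
      = (q powi (- cartan i j)) *\<^sub>C (G (sign_swap (XMinus j)) * G (sign_swap (K i)))" for i j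
    using KInv_conj[OF K_XPlus[of i j]] assms by (simp add: power_int_minus field_simps)
  show "G (sign_swap (XPlus i)) * G (sign_swap (XMinus j)) - G (sign_swap (XMinus j)) * G (sign_swap (XPlus i))
      = (if i = j then (1 / (q - inverse q)) *\<^sub>C (G (sign_swap (K i)) - G (sign_swap (KInv i))) else 0)" for i j
    using bracket[of j i] by (auto simp: scaleC_diff_right algebra_simps)
qed (simp_all add: KInv_N0 KInv_N1 K1_K0 CSqrt CSqrtInv)

text \<open>The factors K_0 and K_1 turn the commuting of X_1^+ with X_0^- into the q^2-commutation
  of \<open>x0\<close> with \<open>xm\<close>, likewise for the y, and they cancel in the bracket of
  \<open>xm\<close> with \<open>y1\<close>.\<close>

lemma loop_datum:
  assumes "generic_parameter q"
    and "\<exists>M. \<forall>m\<ge>M. \<forall>u. G (K N1) * u = q ^ m *\<^sub>C (u * G (K N1)) \<longrightarrow> u = 0"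
    and "\<exists>M. \<forall>m\<ge>M. \<forall>u. G (K N0) * u = q ^ m *\<^sub>C (u * G (K N0)) \<longrightarrow> u = 0"
  shows "loop_datum q (G (K N1)) (G (K N0)) (G (XPlus N1)) (G (K N0) * G (XMinus N0))
    (G (XMinus N1)) (G (XPlus N0) * G (K N1))"
proof -
  interpret generic_parameter q by fact
  define k ki e f e' f' where "k = G (K N1)" and "ki = G (K N0)" and "e = G (XPlus N1)"
    and "f = G (XMinus N1)" and "e' = G (XMinus N0)" and "f' = G (XPlus N0)"
  have kk: "k * ki = 1" "ki * k = 1" by (simp_all add: k_def ki_def K0_K1 K1_K0)
  have kk': "k * (ki * u) = u" "ki * (k * u) = u" for u by (simp_all add: kk flip: mult.assoc)
  have p: "q powi (- 2) = 1 / q\<^sup>2" "q powi 2 = q\<^sup>2" by (simp_all add: power_int_minus field_simps)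
  have k: "k * e = q\<^sup>2 *\<^sub>C (e * k)" "k * f = (1 / q\<^sup>2) *\<^sub>C (f * k)"
    "k * e' = q\<^sup>2 *\<^sub>C (e' * k)" "k * f' = (1 / q\<^sup>2) *\<^sub>C (f' * k)"
    using K_XPlus[of N1 N1] K_XMinus[of N1 N1] K_XPlus[of N1 N0] K_XMinus[of N1 N0]
    by (simp_all add: k_def e_def f_def e'_def f'_def cartan_def p)
  have k': "k * (e * u) = q\<^sup>2 *\<^sub>C (e * (k * u))" "k * (f * u) = (1 / q\<^sup>2) *\<^sub>C (f * (k * u))"
    "k * (e' * u) = q\<^sup>2 *\<^sub>C (e' * (k * u))" "k * (f' * u) = (1 / q\<^sup>2) *\<^sub>C (f' * (k * u))" for u
    using k by (simp_all flip: mult.assoc)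
  have ki: "ki * e = (1 / q\<^sup>2) *\<^sub>C (e * ki)" "ki * f = q\<^sup>2 *\<^sub>C (f * ki)"
    "ki * e' = (1 / q\<^sup>2) *\<^sub>C (e' * ki)" "ki * f' = q\<^sup>2 *\<^sub>C (f' * ki)"
    using K_XPlus[of N0 N1] K_XMinus[of N0 N1] K_XPlus[of N0 N0] K_XMinus[of N0 N0]
    by (simp_all add: ki_def e_def f_def e'_def f'_def cartan_def p)
  have ki': "ki * (e * u) = (1 / q\<^sup>2) *\<^sub>C (e * (ki * u))" "ki * (f * u) = q\<^sup>2 *\<^sub>C (f * (ki * u))"
    "ki * (e' * u) = (1 / q\<^sup>2) *\<^sub>C (e' * (ki * u))" "ki * (f' * u) = q\<^sup>2 *\<^sub>C (f' * (ki * u))" for u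
    using ki by (simp_all flip: mult.assoc)
  have c: "e * e' = e' * e" "f' * f = f * f'"
    using bracket[of N1 N0] bracket[of N0 N1] by (simp_all add: e_def e'_def f_def f'_def)
  have c': "e * (e' * u) = e' * (e * u)" "f' * (f * u) = f * (f' * u)" for u
    using c by (simp_all flip: mult.assoc)
  have d: "e * f - f * e = (1 / (q - 1 / q)) *\<^sub>C (k - ki)"
    "f' * e' - e' * f' = (1 / (q - 1 / q)) *\<^sub>C (ki - k)"
    using bracket[of N1 N1] bracket[of N0 N0]
    by (simp_all add: e_def e'_def f_def f'_def k_def ki_def KInv_N0 KInv_N1 inverse_eq_divide)
  have "loop_datum q k ki e (ki * e') f (f' * k)"
  proof (intro loop_datum.intro loop_datum_axioms.intro)
    show "generic_parameter q" by fact
    show "k * ki = 1" "ki * k = 1" by (fact kk)+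
    show "k * e = q\<^sup>2 *\<^sub>C (e * k)" "k * f = (1 / q\<^sup>2) *\<^sub>C (f * k)" by (fact k)+
    show "k * (ki * e') = q\<^sup>2 *\<^sub>C (ki * e' * k)" by (simp add: kk kk' ki' ki k k' mult.assoc)
    show "k * (f' * k) = (1 / q\<^sup>2) *\<^sub>C (f' * k * k)" by (simp add: k' mult.assoc)
    show "e * (ki * e') = q\<^sup>2 *\<^sub>C (ki * e' * e)" by (simp add: ki ki' c c' mult.assoc eval_nat_numeral)
    show "f' * k * f = (1 / q\<^sup>2) *\<^sub>C (f * (f' * k))" by (simp add: k c' mult.assoc)
    show "e * f - f * e = (1 / (q - 1 / q)) *\<^sub>C (k - ki)" by (fact d)
    have "ki * e' * (f' * k) - f' * k * (ki * e') = e' * f' - f' * e'"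
      by (simp add: ki' ki k k' kk' kk mult.assoc)
    also have "\<dots> = (1 / (q - 1 / q)) *\<^sub>C (k - ki)"
      using d(2) by (metis minus_diff_eq scaleC_minus_right)
    finally show "ki * e' * (f' * k) - f' * k * (ki * e') = (1 / (q - 1 / q)) *\<^sub>C (k - ki)" .
  qed (use assms in \<open>simp_all add: k_def ki_def\<close>)
  then show ?thesis by (simp add: k_def ki_def e_def f_def e'_def f'_def)
qed

text \<open>For x = X_1^+ and y = X_0^+, the element [2]_q \<open>h1\<close> is the q-commutator x y
  - q^2 y x, and its commutator with x is [2]_q x_1. Expanding x_1 x_0 = q^2 x_0 x_1 accordingly
  gives q^2 times the Serre expression.\<close>

lemma Serre_XPlus_N1:
  assumes "generic_parameter q"
    and "\<exists>M. \<forall>m\<ge>M. \<forall>u. G (K N1) * u = q ^ m *\<^sub>C (u * G (K N1)) \<longrightarrow> u = 0"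
    and "\<exists>M. \<forall>m\<ge>M. \<forall>u. G (K N0) * u = q ^ m *\<^sub>C (u * G (K N0)) \<longrightarrow> u = 0"
  defines "x \<equiv> G (XPlus N1)" and "y \<equiv> G (XPlus N0)"
  shows "x ^ 3 * y - qint q 3 *\<^sub>C (x\<^sup>2 * y * x) + qint q 3 *\<^sub>C (x * y * x\<^sup>2) - y * x ^ 3 = 0"
proof -
  interpret loop_datum q "G (K N1)" "G (K N0)" x "G (K N0) * G (XMinus N0)" "G (XMinus N1)" "y * G (K N1)"
    unfolding x_def y_def by (rule loop_datum[OF assms(1-3)])
  define k where "k = G (K N1)"
  define c where "c = q + 1 / q"
  have kx: "k * x = q\<^sup>2 *\<^sub>C (x * k)" using k_x0 by (simp add: k_def)
  have ky: "G (K N0) * (y * u) = q\<^sup>2 *\<^sub>C (y * (G (K N0) * u))"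
    "G (K N0) * (x * u) = (1 / q\<^sup>2) *\<^sub>C (x * (G (K N0) * u))" for u
  proof -
    have "G (K N0) * y = q\<^sup>2 *\<^sub>C (y * G (K N0))" "G (K N0) * x = (1 / q\<^sup>2) *\<^sub>C (x * G (K N0))"
      using K_XPlus[of N0 N0] K_XPlus[of N0 N1]
      by (simp_all add: x_def y_def cartan_def power_int_minus field_simps)
    then show "G (K N0) * (y * u) = q\<^sup>2 *\<^sub>C (y * (G (K N0) * u))"
      "G (K N0) * (x * u) = (1 / q\<^sup>2) *\<^sub>C (x * (G (K N0) * u))"
      by (simp_all flip: mult.assoc)
  qed
  have h: "c *\<^sub>C h1 = x * y - q\<^sup>2 *\<^sub>C (y * x)"
    unfolding h1_def c_def
    by (simp add: right_diff_distrib mult.assoc ky kx[unfolded k_def])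
  have x1: "c *\<^sub>C xp 1 = x * y * x - q\<^sup>2 *\<^sub>C (y * x * x) - x * x * y + q\<^sup>2 *\<^sub>C (x * y * x)"
  proof -
    have "c *\<^sub>C xp 1 = (c *\<^sub>C h1) * x - x * (c *\<^sub>C h1)"
      using xp_h1[of 0] by (simp flip: scaleC_diff_right)
    then show ?thesis unfolding h by (simp add: algebra_simps)
  qed
  have "(c *\<^sub>C xp 1) * x - q\<^sup>2 *\<^sub>C (x * (c *\<^sub>C xp 1)) = 0"
    using xp_quadratic[of 0] by (simp add: mult.commute)
  moreover have "(c *\<^sub>C xp 1) * x - q\<^sup>2 *\<^sub>C (x * (c *\<^sub>C xp 1))
    = q\<^sup>2 *\<^sub>C (x ^ 3 * y - qint q 3 *\<^sub>C (x\<^sup>2 * y * x) + qint q 3 *\<^sub>C (x * y * x\<^sup>2) - y * x ^ 3)"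
  proof -
    have "qint q 3 = (q ^ 3 - 1 / q ^ 3) / (q - 1 / q)" by (simp add: qint_def inverse_eq_divide power_divide)
    moreover have "q ^ 3 - 1 / q ^ 3 = (q\<^sup>2 + 1 + 1 / q\<^sup>2) * (q - 1 / q)"
      by (simp add: field_simps eval_nat_numeral)
    ultimately have "qint q 3 = q\<^sup>2 + 1 + 1 / q\<^sup>2" using q_minus_inverse by (simp del: q_minus_inverse)
    moreover define u where "u = q\<^sup>2"
    ultimately have u: "u * qint q 3 = u * u + u + 1" by (simp add: distrib_left)
    show ?thesis unfolding x1 u_def[symmetric]
      by (simp add: power2_eq_square power3_eq_cube mult.assoc scaleC_diff_right scaleC_add_right u
          right_diff_distrib left_diff_distrib distrib_left distrib_right)
        (simp add: scaleC_add_left algebra_simps)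
  qed
  ultimately show ?thesis by simp
qed

end

lemma Serre_free_lift:
  "free_lift (\<lambda>c. c *\<^sub>C 1) G (serre q (gen x) (gen y))
    = G x ^ 3 * G y - qint q 3 *\<^sub>C ((G x)\<^sup>2 * G y * G x) + qint q 3 *\<^sub>C (G x * G y * (G x)\<^sup>2) - G y * G x ^ 3"
  by (simp add: serre_def scaleC_embedding.free_lift_add mult.assoc)

lemma (in level_zero) relators_vanish:
  assumes q: "generic_parameter q"
    and b: "\<exists>M. \<forall>m\<ge>M. \<forall>u. G (K N1) * u = q ^ m *\<^sub>C (u * G (K N1)) \<longrightarrow> u = 0"
      "\<exists>M. \<forall>m\<ge>M. \<forall>u. G (K N0) * u = q ^ m *\<^sub>C (u * G (K N0)) \<longrightarrow> u = 0"
    and r: "r \<in> uq_relators q"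
  shows "free_lift (\<lambda>c. c *\<^sub>C 1) G r = 0"
proof -
  have q0: "q \<noteq> 0" using q by (rule generic_parameter.q_nonzero)
  have plus: "free_lift (\<lambda>c. c *\<^sub>C 1) H (serre q (gen (XPlus i)) (gen (XPlus j))) = 0"
    if "level_zero q H" "i \<noteq> j"
      "\<exists>M. \<forall>m\<ge>M. \<forall>u. H (K N1) * u = q ^ m *\<^sub>C (u * H (K N1)) \<longrightarrow> u = 0"
      "\<exists>M. \<forall>m\<ge>M. \<forall>u. H (K N0) * u = q ^ m *\<^sub>C (u * H (K N0)) \<longrightarrow> u = 0" for H :: "uq_gen \<Rightarrow> 'a" and i j
  proof (cases i)
    case N1
    then have "j = N0" using that(2) by (cases j) simp_all
    with N1 show ?thesis
      unfolding Serre_free_lift using level_zero.Serre_XPlus_N1[OF that(1) q that(3,4)] by simp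
  next
    case N0
    then have "j = N1" using that(2) by (cases j) simp_all
    with N0 show ?thesis
      unfolding Serre_free_lift
      using level_zero.Serre_XPlus_N1[OF level_zero.level_zero_node_swap[OF that(1)] q] that(3,4) by simp
  qed
  have minus: "free_lift (\<lambda>c. c *\<^sub>C 1) G (serre q (gen (XMinus i)) (gen (XMinus j))) = 0"
    if "i \<noteq> j" for i j
    using plus[OF level_zero_sign_swap[OF q0] that] b by (simp add: Serre_free_lift KInv_N0 KInv_N1)
  note [simp] = scaleC_embedding.free_lift_add
  show ?thesis using r
  proof cases
    case (K_comm)
    then show ?thesis by (simp add: K0_K1 K1_K0)
  next
    case (K_XPlus i j)
    then show ?thesis
      using level_zero.K_XPlus[OF level_zero_axioms, of i j] by simp (simp add: mult.assoc)
  next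
    case (K_XMinus i j)
    then show ?thesis
      using level_zero.K_XMinus[OF level_zero_axioms, of i j] by simp (simp add: mult.assoc)
  next
    case (XPlus_XMinus i j)
    then show ?thesis using bracket[of i j] by simp
  next
    case (serre_plus i j)
    then show ?thesis using plus[OF level_zero_axioms _ b] by simp
  next
    case (serre_minus i j)
    then show ?thesis using minus by simp
  qed (simp_all add: CSqrt CSqrtInv K0_K1)
qed

text \<open>Conditions on the images of the generators alone that characterise type 1
  representations. In dimension 0 the embedding \<open>op_of\<close> is not unital, which explains
  the case distinction.\<close>

definition uq_matrices :: "complex \<Rightarrow> nat \<Rightarrow> (uq_gen \<Rightarrow> complex mat) \<Rightarrow> bool" where
  "uq_matrices q n g \<longleftrightarrow> (\<forall>x. g x \<in> carrier_mat n n) \<and> g CSqrt = 1\<^sub>m n \<and> (\<forall>i. type_one_mat q (g (K i)))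
     \<and> (n > 0 \<longrightarrow> level_zero q (\<lambda>x. op_of n (g x)))"

lemma uq_matrices_act:
  assumes V: "V \<in> uq_reps q"
  shows "uq_matrices q (fst V) (\<lambda>x. act q V (gen x))"
proof -
  have rep: "is_rep q V" using V by (simp add: uq_reps_def)
  then interpret mat_hom "fst V" "act q V" by (rule mat_hom_act)
  have t: "type_one q V" using V by (simp add: uq_reps_def)
  have CS: "act q V (gen CSqrt) = 1\<^sub>m (fst V)"
    using t unfolding type_one_def case_prod_beta act_def by blast
  have "level_zero q (\<lambda>x. op_of (fst V) (act q V (gen x)))" if "fst V > 0"
    using level_zero[OF that _ CS] act_ideal[OF rep uq_relators_in_ideal] by blast
  moreover have "type_one_mat q (act q V (gen (K i)))" for i
    using t unfolding type_one_def case_prod_beta act_def type_one_mat_def by blast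
  ultimately show ?thesis using CS T_carrier by (simp add: uq_matrices_def)
qed

text \<open>The kernel of \<open>T\<close> is a two-sided ideal. It contains the relators, by
  \<open>relators_vanish\<close> or trivially in dimension 0, hence all of \<open>uq_ideal\<close>;
  so \<open>T\<close> is constant on classes and \<open>the_elem\<close> returns its value.\<close>

lemma (in mat_hom) rep:
  assumes q: "generic_parameter q" and mats: "uq_matrices q N (\<lambda>x. T (gen x))"
  defines "V \<equiv> (N, \<lambda>a. the_elem (T ` a))"
  shows "V \<in> uq_reps q" "act q V f = T f"
proof -
  have zero_mat: "A = 0\<^sub>m N N" if "N = 0" "A \<in> carrier_mat N N" for A :: "complex mat"
    using that by (intro eq_matI) auto
  have rel: "T r = 0\<^sub>m N N" if r: "r \<in> uq_relators q" for r
  proof (cases "N = 0")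
    case False
    then interpret level_zero q "\<lambda>x. op_of N (T (gen x))" using mats by (simp add: uq_matrices_def)
    interpret generic_parameter q by fact
    have b: "\<exists>M. \<forall>m\<ge>M. \<forall>u. op_of N (T (gen (K i))) * u = q ^ m *\<^sub>C (u * op_of N (T (gen (K i)))) \<longrightarrow> u = 0" for i
      using mats False by (intro type_one_bounded) (simp_all add: uq_matrices_def)
    have "op_of N (T r) = op_of N (0\<^sub>m N N)"
      using relators_vanish[OF q b b r] op_of_T[of r] False by (simp add: op_of_zero)
    then show ?thesis by (rule op_of_inject[OF _ T_carrier zero_carrier_mat])
  qed (use zero_mat T_carrier in blast)
  have T_uminus: "T (- f) = - T f" for f
  proof -
    have "- f = scal (- 1) * f" by (simp add: single_uminus)
    then have "T (- f) = (- 1) \<cdot>\<^sub>m 1\<^sub>m N * T f" by (simp only: T_mult T_scal)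
    also have "\<dots> = - T f" using T_carrier[of f] by (intro eq_matI) (auto simp: mult_smult_assoc_mat[of _ N N])
    finally show ?thesis .
  qed
  have T_zero: "T 0 = 0\<^sub>m N N"
    using T_add[of 0 0] T_carrier[of 0] by (metis add.right_neutral add_uminus_minus_mat minus_r_inv_mat T_add T_uminus add.right_inverse)
  have [simp]: "- 0\<^sub>m N N = (0\<^sub>m N N :: complex mat)" by (rule eq_matI) auto
  have kernel: "ideal {f. T f = 0\<^sub>m N N} class_ring"
  proof (rule idealI)
    show "ring (class_ring :: uq_gen free_alg ring)" by (rule class_ring.ring_axioms)
    show "subgroup {f. T f = 0\<^sub>m N N} (add_monoid class_ring)"
    proof (rule group.subgroupI)
      show "group (add_monoid (class_ring :: uq_gen free_alg ring))"
        using class_ring.a_group by simp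
      show "{f. T f = 0\<^sub>m N N} \<noteq> {}" using T_zero by blast
      fix f assume f: "f \<in> {f. T f = 0\<^sub>m N N}"
      have "inv\<^bsub>add_monoid class_ring\<^esub> f = - f"
        using class_ring_simps(8)[where ?'a = "uq_gen free_alg"] unfolding a_inv_def by metis
      then show "inv\<^bsub>add_monoid class_ring\<^esub> f \<in> {f. T f = 0\<^sub>m N N}"
        using f by (simp add: T_uminus)
    qed (auto simp: T_add)
  qed (auto simp: T_mult left_mult_zero_mat[OF T_carrier] right_mult_zero_mat[OF T_carrier])
  have "uq_ideal q \<subseteq> {f. T f = 0\<^sub>m N N}"
    unfolding uq_ideal_def
    by (rule ring.genideal_minimal[OF class_ring.ring_axioms kernel]) (use rel in auto)
  then have T_eq: "T g = T f" if "g \<in> uq_class q f" for f g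
  proof -
    have "T (g - f) = 0\<^sub>m N N" using that \<open>uq_ideal q \<subseteq> _\<close> by (auto simp: mem_uq_class)
    moreover have "T g = T (g - f) + T f" by (simp flip: T_add)
    ultimately show ?thesis using T_carrier[of f] by simp
  qed
  have act: "act q V f = T f" for f
  proof -
    have "T ` uq_class q f = {T f}" using T_eq uq_class_self by blast
    then show ?thesis by (simp add: act_def V_def)
  qed
  show "act q V f = T f" by (rule act)
  have hom: "snd V \<in> Ring.ring_hom (Uq q) (ring_mat TYPE(complex) N ())"
    by (rule ring_hom_memI)
      (auto simp: carrier_Uq ring_mat_simps uq_class_mult uq_class_add uq_class_one T_carrier T_add T_mult T_one
        act[unfolded act_def])
  then have "is_rep q V"
    using act by (simp add: is_rep_def V_def T_scal act_def)
  moreover have "type_one q V"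
    using mats act by (simp add: type_one_def V_def uq_matrices_def type_one_mat_def act_def)
  ultimately show "V \<in> uq_reps q" by (simp add: uq_reps_def)
qed

section \<open>Kronecker products\<close>

lemma kron_carrier [simp]:
  "A \<in> carrier_mat m m' \<Longrightarrow> B \<in> carrier_mat n n' \<Longrightarrow> kron A B \<in> carrier_mat (m * n) (m' * n')"
  by (auto simp: kron_def)

lemma kron_index:
  assumes "A \<in> carrier_mat m m'" "B \<in> carrier_mat n n'" "i < m * n" "j < m' * n'"
  shows "kron A B $$ (i, j) = A $$ (i div n, j div n') * B $$ (i mod n, j mod n')"
  using assms by (auto simp: kron_def)

lemma div_mod_bounds:
  assumes "i < m * (n::nat)"
  shows "i div n < m" "i mod n < n"
proof -
  have "n > 0" using assms by (cases n) auto
  then show "i mod n < n" by simp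
  show "i div n < m" using assms by (simp add: less_mult_imp_div_less)
qed

lemma sum_div_mod:
  fixes f :: "nat \<Rightarrow> nat \<Rightarrow> 'b::comm_monoid_add"
  shows "(\<Sum>k = 0..<m * n. f (k div n) (k mod n)) = (\<Sum>a = 0..<m. \<Sum>b = 0..<n. f a b)"
proof (cases "n = 0")
  case False
  have "(\<Sum>a = 0..<m. \<Sum>b = 0..<n. f a b) = (\<Sum>(a, b)\<in>{0..<m} \<times> {0..<n}. f a b)"
    by (rule sum.cartesian_product)
  also have "\<dots> = (\<Sum>k = 0..<m * n. f (k div n) (k mod n))"
  proof (rule sum.reindex_bij_witness[of _ "\<lambda>k. (k div n, k mod n)" "\<lambda>(a, b). a * n + b"])
    fix p assume p: "p \<in> {0..<m} \<times> {0..<n}"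
    have "fst p * n + snd p < Suc (fst p) * n" using p by auto
    also have "\<dots> \<le> m * n" using p by (intro mult_le_mono1) auto
    finally show "(case p of (a, b) \<Rightarrow> a * n + b) \<in> {0..<m * n}" by (simp add: case_prod_beta)
  qed (auto simp: div_mod_bounds)
  finally show ?thesis by simp
qed simp

lemma kron_mult:
  assumes "A \<in> carrier_mat m m'" "C \<in> carrier_mat m' m''" "B \<in> carrier_mat n n'" "D \<in> carrier_mat n' n''"
  shows "kron A B * kron C D = kron (A * C) (B * D)"
proof (rule eq_matI)
  fix i j assume "i < dim_row (kron (A * C) (B * D))" "j < dim_col (kron (A * C) (B * D))"
  then have ij: "i < m * n" "j < m'' * n''" using assms by (auto simp: kron_def)
  note b = div_mod_bounds[OF ij(1)] div_mod_bounds[OF ij(2)]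
  have "(kron A B * kron C D) $$ (i, j) = (\<Sum>k = 0..<m' * n'. kron A B $$ (i, k) * kron C D $$ (k, j))"
    using assms ij by (simp add: scalar_prod_def kron_def)
  also have "\<dots> = (\<Sum>k = 0..<m' * n'. (A $$ (i div n, k div n') * C $$ (k div n', j div n''))
      * (B $$ (i mod n, k mod n') * D $$ (k mod n', j mod n'')))"
    using assms ij by (intro sum.cong) (simp_all add: kron_index)
  also have "\<dots> = (\<Sum>a = 0..<m'. \<Sum>b = 0..<n'. (A $$ (i div n, a) * C $$ (a, j div n''))
      * (B $$ (i mod n, b) * D $$ (b, j mod n'')))"
    by (rule sum_div_mod)
  also have "\<dots> = (A * C) $$ (i div n, j div n'') * (B * D) $$ (i mod n, j mod n'')"
    using assms b by (simp add: scalar_prod_def sum_product)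
  also have "\<dots> = kron (A * C) (B * D) $$ (i, j)"
    using assms ij by (subst kron_index[of _ m m'' _ n n'']) auto
  finally show "(kron A B * kron C D) $$ (i, j) = kron (A * C) (B * D) $$ (i, j)" .
qed (use assms in \<open>auto simp: kron_def\<close>)

lemma kron_add_left:
  assumes "A \<in> carrier_mat m m'" "A' \<in> carrier_mat m m'" "B \<in> carrier_mat n n'"
  shows "kron (A + A') B = kron A B + kron A' B"
  using assms by (intro eq_matI) (auto simp: kron_def div_mod_bounds distrib_right)

lemma kron_add_right:
  assumes "A \<in> carrier_mat m m'" "B \<in> carrier_mat n n'" "B' \<in> carrier_mat n n'"
  shows "kron A (B + B') = kron A B + kron A B'"
  using assms by (intro eq_matI) (auto simp: kron_def div_mod_bounds distrib_left)

lemma kron_smult_left: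
  "A \<in> carrier_mat m m' \<Longrightarrow> B \<in> carrier_mat n n' \<Longrightarrow> kron (c \<cdot>\<^sub>m A) B = c \<cdot>\<^sub>m kron A B"
  by (intro eq_matI) (auto simp: kron_def div_mod_bounds)

lemma kron_smult_right:
  "A \<in> carrier_mat m m' \<Longrightarrow> B \<in> carrier_mat n n' \<Longrightarrow> kron A (c \<cdot>\<^sub>m B) = c \<cdot>\<^sub>m kron A B"
  by (intro eq_matI) (auto simp: kron_def div_mod_bounds)

lemma kron_zero_left: "B \<in> carrier_mat n n' \<Longrightarrow> kron (0\<^sub>m m m') B = 0\<^sub>m (m * n) (m' * n')"
  by (intro eq_matI) (auto simp: kron_def div_mod_bounds)

lemma kron_zero_right: "A \<in> carrier_mat m m' \<Longrightarrow> kron A (0\<^sub>m n n') = 0\<^sub>m (m * n) (m' * n')"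
  by (intro eq_matI) (auto simp: kron_def div_mod_bounds)

lemma kron_one: "kron (1\<^sub>m m) (1\<^sub>m n) = 1\<^sub>m (m * n)"
proof (rule eq_matI)
  fix i j assume "i < dim_row (1\<^sub>m (m * n) :: complex mat)" "j < dim_col (1\<^sub>m (m * n) :: complex mat)"
  then have ij: "i < m * n" "j < m * n" by auto
  moreover have "i = j \<longleftrightarrow> i div n = j div n \<and> i mod n = j mod n" by (metis div_mult_mod_eq)
  ultimately show "kron (1\<^sub>m m) (1\<^sub>m n) $$ (i, j) = 1\<^sub>m (m * n) $$ (i, j)"
    using div_mod_bounds[OF ij(1)] div_mod_bounds[OF ij(2)] by (auto simp: kron_def)
qed (auto simp: kron_def)

lemma kron_assoc: "kron (kron A B) C = kron A (kron B C)"
proof (rule eq_matI)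
  fix i j assume "i < dim_row (kron A (kron B C))" "j < dim_col (kron A (kron B C))"
  then have ij: "i < dim_row A * (dim_row B * dim_row C)" "j < dim_col A * (dim_col B * dim_col C)"
    by (auto simp: kron_def)
  have ij': "i < dim_row A * dim_row B * dim_row C" "j < dim_col A * dim_col B * dim_col C"
    using ij by (simp_all add: mult.assoc)
  note b = div_mod_bounds[OF ij(1)] div_mod_bounds[OF ij(2)] div_mod_bounds[OF ij'(1)] div_mod_bounds[OF ij'(2)]
  have d: "k mod (n * p) div p = k div p mod n" "k mod (n * p) mod p = k mod p" "k div (n * p) = k div p div n"
    for k n p :: nat
    by (cases "p = 0"; simp add: mod_mult2_eq div_mult2_eq mult.commute[of n])+
  show "kron (kron A B) C $$ (i, j) = kron A (kron B C) $$ (i, j)"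
    using ij ij' b by (simp add: kron_def d mult.assoc)
qed (auto simp: kron_def mult.assoc)

lemma kron_transpose: "transpose_mat (kron A B) = kron (transpose_mat A) (transpose_mat B)"
  by (intro eq_matI) (auto simp: kron_def div_mod_bounds)

lemma type_one_mat_kron:
  assumes "type_one_mat q A" "A \<in> carrier_mat m m" "type_one_mat q B" "B \<in> carrier_mat n n" "q \<noteq> 0"
  shows "type_one_mat q (kron A B)"
proof -
  obtain v P P' where P: "P \<in> carrier_mat m m" "P' \<in> carrier_mat m m" "P * P' = 1\<^sub>m m" "P' * P = 1\<^sub>m m"
    "A = P * qdiag q m v * P'"
    using type_one_matE[OF assms(1,2)] by metis
  obtain w R R' where R: "R \<in> carrier_mat n n" "R' \<in> carrier_mat n n" "R * R' = 1\<^sub>m n" "R' * R = 1\<^sub>m n"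
    "B = R * qdiag q n w * R'"
    using type_one_matE[OF assms(3,4)] by metis
  have "kron (qdiag q m v) (qdiag q n w) = qdiag q (m * n) (\<lambda>i. v (i div n) + w (i mod n))"
  proof (rule eq_matI)
    fix i j
    assume "i < dim_row (qdiag q (m * n) (\<lambda>i. v (i div n) + w (i mod n)))"
      "j < dim_col (qdiag q (m * n) (\<lambda>i. v (i div n) + w (i mod n)))"
    then have ij: "i < m * n" "j < m * n" by (auto simp: qdiag_def)
    moreover have "i = j \<longleftrightarrow> i div n = j div n \<and> i mod n = j mod n" by (metis div_mult_mod_eq)
    ultimately show "kron (qdiag q m v) (qdiag q n w) $$ (i, j) = qdiag q (m * n) (\<lambda>i. v (i div n) + w (i mod n)) $$ (i, j)"
      using div_mod_bounds[OF ij(1)] div_mod_bounds[OF ij(2)] assms(5)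
      by (auto simp: kron_def qdiag_def power_int_add)
  qed (auto simp: kron_def qdiag_def)
  moreover have "kron A B = kron P R * kron (qdiag q m v) (qdiag q n w) * kron P' R'"
    unfolding P(5) R(5) using P(1,2) R(1,2)
    by (subst kron_mult[of _ m m _ m _ n n _ n], simp_all)
      (subst kron_mult[of _ m m _ m _ n n _ n], auto)
  moreover have "kron P R * kron P' R' = 1\<^sub>m (m * n)" "kron P' R' * kron P R = 1\<^sub>m (m * n)"
    using P R by (subst kron_mult[of _ m m _ m _ n n _ n]; simp add: kron_one)+
  ultimately show ?thesis
    using P(1,2) R(1,2)
    by (intro type_one_matI[of "kron P R" "m * n" "kron P' R'" _ q "\<lambda>i. v (i div n) + w (i mod n)"]) simp_all
qed

section \<open>Tensor products of representations\<close>

text \<open>\<open>comult_gen\<close> with the tensor factors replaced by two families in one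
  algebra: \<open>A\<close> stands for a \<otimes> 1 and \<open>B\<close> for 1 \<otimes> b.\<close>

primrec tens_op :: "(uq_gen \<Rightarrow> 'a::complex_algebra) \<Rightarrow> (uq_gen \<Rightarrow> 'a) \<Rightarrow> uq_gen \<Rightarrow> 'a" where
  "tens_op A B (K i) = A (K i) * B (K i)"
| "tens_op A B (KInv i) = A (KInv i) * B (KInv i)"
| "tens_op A B (XPlus i) = A (XPlus i) * B (K i) + B (XPlus i)"
| "tens_op A B (XMinus i) = A (XMinus i) + A (KInv i) * B (XMinus i)"
| "tens_op A B CSqrt = A CSqrt * B CSqrt"
| "tens_op A B CSqrtInv = A CSqrtInv * B CSqrtInv"

lemma cartan_sym: "cartan i j = cartan j i"
  by (simp add: cartan_def)

lemma level_zero_tensor: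
  fixes A B :: "uq_gen \<Rightarrow> 'a::complex_algebra"
  assumes A: "level_zero q A" and B: "level_zero q B" and AB: "\<And>x y. B y * A x = A x * B y" and q: "q \<noteq> 0"
  shows "level_zero q (tens_op A B)"
proof -
  interpret A: level_zero q A by fact
  interpret B: level_zero q B by fact
  have AB': "B y * (A x * u) = A x * (B y * u)" for x y u using AB by (simp flip: mult.assoc)
  have inv: "A (K i) * (A (KInv i) * u) = u" "A (KInv i) * (A (K i) * u) = u"
    "A (K N0) * (A (K N1) * u) = u" for i u
    by (simp_all add: A.K0_K1 flip: mult.assoc)
  show ?thesis
  proof
    fix i j
    have kA: "A (K i) * (A (XPlus j) * u) = (q powi cartan i j) *\<^sub>C (A (XPlus j) * (A (K i) * u))"
      "A (K i) * (A (XMinus j) * u) = (q powi (- cartan i j)) *\<^sub>C (A (XMinus j) * (A (K i) * u))" for u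
      using A.K_XPlus[of i j] A.K_XMinus[of i j] by (simp_all flip: mult.assoc)
    show "tens_op A B (K i) * tens_op A B (XPlus j) = (q powi cartan i j) *\<^sub>C (tens_op A B (XPlus j) * tens_op A B (K i))"
    proof -
      have "B (K i) * B (K j) = B (K j) * B (K i)"
        by (cases i; cases j) (simp_all add: B.K0_K1 B.K1_K0)
      then show ?thesis
        by (simp add: distrib_left distrib_right mult.assoc AB AB' kA A.K_XPlus B.K_XPlus scaleC_add_right)
    qed
    show "tens_op A B (K i) * tens_op A B (XMinus j) = (q powi (- cartan i j)) *\<^sub>C (tens_op A B (XMinus j) * tens_op A B (K i))"
    proof -
      have "A (K i) * (A (KInv j) * u) = A (KInv j) * (A (K i) * u)" for u
        by (cases i; cases j)
          (simp_all add: inv A.KInv_N0 A.KInv_N1 A.K0_K1 A.K1_K0 flip: mult.assoc)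
      then show ?thesis
        by (simp add: distrib_left distrib_right mult.assoc AB AB' kA A.K_XMinus B.K_XMinus scaleC_add_right)
    qed
    define a b b' c d e where "a = A (XPlus i)" and "b = B (K i)" and "b' = B (XPlus i)"
      and "c = A (XMinus j)" and "d = A (KInv j)" and "e = B (XMinus j)"
    define p where "p = q powi (- cartan i j)"
    have be: "b * e = p *\<^sub>C (e * b)"
      using B.K_XMinus[of i j] by (simp add: b_def e_def p_def)
    have da: "d * a = p *\<^sub>C (a * d)"
      using A.KInv_conj[OF A.K_XPlus[of j i]] q
      by (simp add: d_def a_def p_def cartan_sym[of j i] power_int_minus field_simps)
    have com: "b * c = c * b" "b * d = d * b" "b' * c = c * b'" "b' * d = d * b'" "e * a = a * e" "e * d = d * e"
      "b * a = a * b" "b * (c * u) = c * (b * u)" "b * (d * u) = d * (b * u)" "b' * (d * u) = d * (b' * u)"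
      "e * (a * u) = a * (e * u)" "b' * (c * u) = c * (b' * u)"  for u
      by (simp_all add: a_def b_def b'_def c_def d_def e_def AB AB')
    have "tens_op A B (XPlus i) * tens_op A B (XMinus j) - tens_op A B (XMinus j) * tens_op A B (XPlus i)
      = (a * b + b') * (c + d * e) - (c + d * e) * (a * b + b')"
      by (simp add: a_def b_def b'_def c_def d_def e_def)
    \<comment> \<open>Moving \<open>b\<close> past \<open>e\<close> and moving \<open>d\<close> past
      \<open>a\<close> produce the same power of q, so the mixed products a b d e and d e a b
      cancel.\<close>
    also have "\<dots> = (a * c - c * a) * b + d * (b' * e - e * b')"
    proof -
      have "a * b * (d * e) = p *\<^sub>C (a * d * (e * b))" by (simp add: mult.assoc com be)
      moreover have "d * e * (a * b) = p *\<^sub>C (a * d * (e * b))"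
      proof -
        have "d * e * (a * b) = (d * a) * (e * b)" by (simp add: mult.assoc com)
        then show ?thesis by (simp add: da mult.assoc)
      qed
      ultimately show ?thesis
        by (simp add: distrib_left distrib_right left_diff_distrib right_diff_distrib)
          (simp add: mult.assoc com algebra_simps)
    qed
    also have "\<dots> = (if i = j then (1 / (q - inverse q)) *\<^sub>C (tens_op A B (K i) - tens_op A B (KInv i)) else 0)"
      using A.bracket[of i j] B.bracket[of i j]
      by (auto simp: a_def b_def b'_def c_def d_def e_def left_diff_distrib right_diff_distrib scaleC_diff_right)
    finally show "tens_op A B (XPlus i) * tens_op A B (XMinus j) - tens_op A B (XMinus j) * tens_op A B (XPlus i)
      = (if i = j then (1 / (q - inverse q)) *\<^sub>C (tens_op A B (K i) - tens_op A B (KInv i)) else 0)" .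
  qed (simp_all add: mult.assoc AB AB' inv A.K0_K1 B.K0_K1 A.CSqrt A.CSqrtInv B.CSqrt B.CSqrtInv)
qed

primrec tensor_gens :: "nat \<Rightarrow> nat \<Rightarrow> (uq_gen \<Rightarrow> complex mat) \<Rightarrow> (uq_gen \<Rightarrow> complex mat) \<Rightarrow> uq_gen \<Rightarrow> complex mat" where
  "tensor_gens m n g h (K i) = kron (g (K i)) (h (K i))"
| "tensor_gens m n g h (KInv i) = kron (g (KInv i)) (h (KInv i))"
| "tensor_gens m n g h (XPlus i) = kron (g (XPlus i)) (h (K i)) + kron (1\<^sub>m m) (h (XPlus i))"
| "tensor_gens m n g h (XMinus i) = kron (g (XMinus i)) (1\<^sub>m n) + kron (g (KInv i)) (h (XMinus i))"
| "tensor_gens m n g h CSqrt = kron (g CSqrt) (h CSqrt)"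
| "tensor_gens m n g h CSqrtInv = kron (g CSqrtInv) (h CSqrtInv)"

lemma smult_smult_mat: "a \<cdot>\<^sub>m (b \<cdot>\<^sub>m A) = (a * b :: complex) \<cdot>\<^sub>m A"
  by (intro eq_matI) auto

lemma finsum_mat:
  assumes "finite A" "\<And>x. x \<in> A \<Longrightarrow> f x \<in> carrier_mat N N"
  shows "finsum (ring_mat TYPE(complex) N ()) f A = mat N N (\<lambda>(i, j). \<Sum>x\<in>A. f x $$ (i, j))"
proof -
  interpret ring "ring_mat TYPE(complex) N ()" by (rule ring_mat)
  show ?thesis using assms
  proof (induction A)
    case empty
    then show ?case by (auto simp: ring_mat_simps intro!: eq_matI)
  next
    case (insert x A)
    then have "finsum (ring_mat TYPE(complex) N ()) f (insert x A)
        = f x + mat N N (\<lambda>(i, j). \<Sum>x\<in>A. f x $$ (i, j))"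
      by (subst finsum_insert) (auto simp: ring_mat_simps)
    then show ?case using insert by (auto intro!: eq_matI)
  qed
qed

lemma tens_add_left: "(f + f') \<otimes>\<^sub>F g = f \<otimes>\<^sub>F g + f' \<otimes>\<^sub>F g"
  unfolding tens_def by (rule keys_sum_add) (simp_all add: distrib_right single_add sum.distrib)

lemma tens_add_right: "f \<otimes>\<^sub>F (g + g') = f \<otimes>\<^sub>F g + f \<otimes>\<^sub>F g'"
  unfolding tens_def sum.distrib[symmetric]
  by (intro sum.cong refl keys_sum_add) (simp_all add: distrib_left single_add)

lemma tens_single:
  "Poly_Mapping.single u a \<otimes>\<^sub>F Poly_Mapping.single v b = Poly_Mapping.single (u, v) (a * b)"
  unfolding tens_def by (cases "a = 0"; cases "b = 0") simp_all

lemma comult_hom [simp]: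
  "comult (f + g) = comult f + comult g" "comult (f * g) = comult f * comult g"
  "comult (scal c) = scal c" "comult (gen x) = comult_gen x"
  by (simp_all add: comult_def scal_embedding.free_lift_add)

context
  fixes q V W
  assumes V: "V \<in> uq_reps q" and W: "W \<in> uq_reps q" and q: "generic_parameter q"
begin

interpretation V: mat_hom "fst V" "act q V" using V by (intro mat_hom_act) (simp add: uq_reps_def)
interpretation W: mat_hom "fst W" "act q W" using W by (intro mat_hom_act) (simp add: uq_reps_def)

lemma act_single: "U \<in> uq_reps q \<Longrightarrow> act q U (Poly_Mapping.single u a) = a \<cdot>\<^sub>m act q U (Poly_Mapping.single u 1)"
proof -
  assume "U \<in> uq_reps q"
  then interpret U: mat_hom "fst U" "act q U" by (intro mat_hom_act) (simp add: uq_reps_def)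
  have "Poly_Mapping.single u a = scal a * Poly_Mapping.single u 1" by (simp add: mult_single)
  then have "act q U (Poly_Mapping.single u a) = (a \<cdot>\<^sub>m 1\<^sub>m (fst U)) * act q U (Poly_Mapping.single u 1)"
    by (simp only: U.T_mult U.T_scal)
  then show ?thesis using U.T_carrier by (simp add: mult_smult_assoc_mat[of _ "fst U" "fst U" _ "fst U"] left_mult_one_mat[of _ "fst U" "fst U"])
qed

text \<open>Rewrites \<open>finsum\<close> as entrywise sums over keys, to which
  \<open>keys_sum_add\<close> and \<open>keys_sum_single\<close> apply.\<close>

lemma tens_action_eq:
  "tens_action q V W t = mat (fst V * fst W) (fst V * fst W) (\<lambda>(i, j).
     \<Sum>p\<in>Poly_Mapping.keys t. Poly_Mapping.lookup t p
       * kron (act q V (Poly_Mapping.single (fst p) 1)) (act q W (Poly_Mapping.single (snd p) 1)) $$ (i, j))"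
proof -
  let ?k = "\<lambda>p. kron (act q V (Poly_Mapping.single (fst p) 1)) (act q W (Poly_Mapping.single (snd p) 1))"
  have "tens_action q V W t = finsum (ring_mat TYPE(complex) (fst V * fst W) ())
      (\<lambda>p. Poly_Mapping.lookup t p \<cdot>\<^sub>m ?k p) (Poly_Mapping.keys t)"
    unfolding tens_action_def act_def by (simp add: case_prod_beta case_prod_beta')
  also have "\<dots> = mat (fst V * fst W) (fst V * fst W) (\<lambda>(i, j).
     \<Sum>p\<in>Poly_Mapping.keys t. (Poly_Mapping.lookup t p \<cdot>\<^sub>m ?k p) $$ (i, j))"
    by (rule finsum_mat) (simp_all add: V.T_carrier W.T_carrier)
  also have "\<dots> = mat (fst V * fst W) (fst V * fst W) (\<lambda>(i, j).
     \<Sum>p\<in>Poly_Mapping.keys t. Poly_Mapping.lookup t p * ?k p $$ (i, j))"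
  proof -
    have k: "?k p \<in> carrier_mat (fst V * fst W) (fst V * fst W)" for p by (simp add: V.T_carrier W.T_carrier)
    have "dim_row (?k p) = fst V * fst W" "dim_col (?k p) = fst V * fst W" for p
      using k[of p] by (blast dest: carrier_matD)+
    then show ?thesis by (intro cong_mat refl) (auto intro!: sum.cong)
  qed
  finally show ?thesis .
qed

lemma tens_action_carrier: "tens_action q V W t \<in> carrier_mat (fst V * fst W) (fst V * fst W)"
  by (simp add: tens_action_eq)

lemma tens_action_add: "tens_action q V W (s + t) = tens_action q V W s + tens_action q V W t"
proof (rule eq_matI)
  fix i j assume "i < dim_row (tens_action q V W s + tens_action q V W t)"
    "j < dim_col (tens_action q V W s + tens_action q V W t)"
  then have ij: "i < fst V * fst W" "j < fst V * fst W" by (auto simp: tens_action_eq)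
  show "tens_action q V W (s + t) $$ (i, j) = (tens_action q V W s + tens_action q V W t) $$ (i, j)"
    using ij keys_sum_add[of "\<lambda>p c. c * kron (act q V (Poly_Mapping.single (fst p) 1)) (act q W (Poly_Mapping.single (snd p) 1)) $$ (i, j)" s t]
    by (simp add: tens_action_eq distrib_right)
qed (simp_all add: tens_action_eq)

lemma tens_action_single:
  "tens_action q V W (Poly_Mapping.single (u, v) c)
    = c \<cdot>\<^sub>m kron (act q V (Poly_Mapping.single u 1)) (act q W (Poly_Mapping.single v 1))"
proof -
  have k: "kron (act q V (Poly_Mapping.single u 1)) (act q W (Poly_Mapping.single v 1)) \<in> carrier_mat (fst V * fst W) (fst V * fst W)"
    by (simp add: V.T_carrier W.T_carrier)
  then show ?thesis
    by (intro eq_matI) (auto simp: tens_action_eq keys_sum_single[of "\<lambda>p c. c * kron (act q V (Poly_Mapping.single (fst p) 1)) (act q W (Poly_Mapping.single (snd p) 1)) $$ (_, _)"])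
qed

lemma tens_action_tens: "tens_action q V W (f \<otimes>\<^sub>F g) = kron (act q V f) (act q W g)"
proof (induction f rule: poly_mapping_induct_add)
  case (single u a)
  show ?case
  proof (induction g rule: poly_mapping_induct_add)
    case (single v b)
    show ?case
      unfolding tens_single tens_action_single act_single[OF V, of u a] act_single[OF W, of v b]
      by (simp add: kron_smult_left[OF V.T_carrier smult_carrier_mat[OF W.T_carrier]]
          kron_smult_right[OF V.T_carrier W.T_carrier] smult_smult_mat)
  next
    case (add g g')
    then show ?case
      by (simp add: tens_add_right tens_action_add W.T_add kron_add_right[OF V.T_carrier W.T_carrier W.T_carrier])
  qed
next
  case (add f f')
  then show ?case
    by (simp add: tens_add_left tens_action_add V.T_add kron_add_left[OF V.T_carrier V.T_carrier W.T_carrier])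
qed

lemma tens_action_mult: "tens_action q V W (s * t) = tens_action q V W s * tens_action q V W t"
proof (induction s rule: poly_mapping_induct_add)
  case (single p a)
  show ?case
  proof (induction t rule: poly_mapping_induct_add)
    case (single r b)
    obtain u v u' v' where p: "p = (u, v)" and r: "r = (u', v')" by (metis surj_pair)
    have "Poly_Mapping.single p a = Poly_Mapping.single u a \<otimes>\<^sub>F Poly_Mapping.single v 1"
      "Poly_Mapping.single r b = Poly_Mapping.single u' b \<otimes>\<^sub>F Poly_Mapping.single v' 1"
      "Poly_Mapping.single p a * Poly_Mapping.single r b
        = (Poly_Mapping.single u a * Poly_Mapping.single u' b) \<otimes>\<^sub>F (Poly_Mapping.single v 1 * Poly_Mapping.single v' 1)"
      by (simp_all add: tens_single p r mult_single)
    then show ?case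
      by (simp only: tens_action_tens V.T_mult W.T_mult
          kron_mult[OF V.T_carrier V.T_carrier W.T_carrier W.T_carrier])
  next
    case (add t t')
    then show ?case
      by (simp add: distrib_left tens_action_add mult_add_distrib_mat[OF tens_action_carrier tens_action_carrier tens_action_carrier])
  qed
next
  case (add s s')
  then show ?case
    by (simp add: distrib_right tens_action_add add_mult_distrib_mat[OF tens_action_carrier tens_action_carrier tens_action_carrier])
qed

lemma mat_hom_tensor: "mat_hom (fst V * fst W) (\<lambda>f. tens_action q V W (comult f))"
proof
  fix c
  have "scal c = (scal c :: uq_gen free_alg) \<otimes>\<^sub>F (1 :: uq_gen free_alg)"
    using tens_single[of 0 c 0 1, symmetric] by (simp add: zero_prod_def)
  then show "tens_action q V W (comult (scal c)) = c \<cdot>\<^sub>m 1\<^sub>m (fst V * fst W)"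
    by (simp add: tens_action_tens V.T_scal W.T_one kron_smult_left[of _ "fst V" "fst V" _ "fst W" "fst W"] kron_one)
qed (simp_all add: tens_action_carrier tens_action_add tens_action_mult)

abbreviation "tgens \<equiv> tensor_gens (fst V) (fst W) (\<lambda>x. act q V (gen x)) (\<lambda>x. act q W (gen x))"

lemma tens_action_comult_gen: "tens_action q V W (comult (gen x)) = tgens x"
  by (cases x) (simp_all add: tens_action_tens tens_action_add V.T_one W.T_one)

lemma uq_matrices_tensor: "uq_matrices q (fst V * fst W) tgens"
proof -
  have q0: "q \<noteq> 0" using q by (rule generic_parameter.q_nonzero)
  note uV = uq_matrices_act[OF V] and uW = uq_matrices_act[OF W]
  let ?N = "fst V * fst W"
  have "level_zero q (\<lambda>x. op_of ?N (tgens x))" if N: "?N > 0"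
  proof -
    have rV: "is_rep q V" "is_rep q W" using V W by (simp_all add: uq_reps_def)
    interpret L: mat_hom ?N "\<lambda>f. kron (act q V f) (1\<^sub>m (fst W))"
      by unfold_locales
       (simp_all add: V.T_carrier V.T_add V.T_mult V.T_scal kron_one
          kron_add_left[OF V.T_carrier V.T_carrier one_carrier_mat]
          kron_mult[OF V.T_carrier V.T_carrier one_carrier_mat one_carrier_mat]
          kron_smult_left[OF one_carrier_mat one_carrier_mat])
    interpret R: mat_hom ?N "\<lambda>f. kron (1\<^sub>m (fst V)) (act q W f)"
      by unfold_locales
       (simp_all add: W.T_carrier W.T_add W.T_mult W.T_scal kron_one
          kron_add_right[OF one_carrier_mat W.T_carrier W.T_carrier]
          kron_mult[OF one_carrier_mat one_carrier_mat W.T_carrier W.T_carrier]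
          kron_smult_right[OF one_carrier_mat one_carrier_mat])
    \<comment> \<open>The actions of the two factors on the tensor product; they commute, as
      \<open>level_zero_tensor\<close> demands.\<close>
    define A B where "A x = op_of ?N (kron (act q V (gen x)) (1\<^sub>m (fst W)))"
      and "B x = op_of ?N (kron (1\<^sub>m (fst V)) (act q W (gen x)))" for x
    have A: "level_zero q A" unfolding A_def
      using act_ideal[OF rV(1) uq_relators_in_ideal] uV
      by (intro L.level_zero N) (simp_all add: kron_zero_left[OF one_carrier_mat] uq_matrices_def kron_one)
    have B: "level_zero q B" unfolding B_def
      using act_ideal[OF rV(2) uq_relators_in_ideal] uW
      by (intro R.level_zero N) (simp_all add: kron_zero_right[OF one_carrier_mat] uq_matrices_def kron_one)
    have kron_split: "op_of ?N (kron (act q V f) (act q W g))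
        = op_of ?N (kron (act q V f) (1\<^sub>m (fst W))) * op_of ?N (kron (1\<^sub>m (fst V)) (act q W g))"
      "op_of ?N (kron (act q V f) (act q W g))
        = op_of ?N (kron (1\<^sub>m (fst V)) (act q W g)) * op_of ?N (kron (act q V f) (1\<^sub>m (fst W)))" for f g
      using V.T_carrier[of f] W.T_carrier[of g]
      by (simp_all add: kron_mult[of _ "fst V" "fst V" _ "fst V" _ "fst W" "fst W" _ "fst W"] flip: op_of_mult)
    have AB: "B y * A x = A x * B y" for x y
      using kron_split[of "gen x" "gen y"] by (simp add: A_def B_def)
    have "tens_op A B x = op_of ?N (tgens x)" for x
      by (cases x) (simp_all add: op_of_add V.T_carrier W.T_carrier kron_split(1), simp_all add: A_def B_def)
    then have "tens_op A B = (\<lambda>x. op_of ?N (tgens x))" by (rule ext)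
    then show ?thesis using level_zero_tensor[OF A B AB q0] by simp
  qed
  moreover have "tgens x \<in> carrier_mat ?N ?N" for x
    by (cases x) (simp_all add: V.T_carrier W.T_carrier)
  moreover have "type_one_mat q (tgens (K i))" for i
    using uV uW q0 by (auto simp: uq_matrices_def intro!: type_one_mat_kron[OF _ V.T_carrier _ W.T_carrier])
  ultimately show ?thesis using uV uW
    by (simp add: uq_matrices_def kron_one)
qed

lemma rep_tensor_in_reps: "rep_tensor q V W \<in> uq_reps q"
  and act_rep_tensor: "act q (rep_tensor q V W) (gen x) = tgens x"
proof -
  interpret mat_hom "fst V * fst W" "\<lambda>f. tens_action q V W (comult f)" by (rule mat_hom_tensor)
  have u: "uq_matrices q (fst V * fst W) (\<lambda>x. tens_action q V W (comult (gen x)))"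
    unfolding tens_action_comult_gen by (rule uq_matrices_tensor)
  show "rep_tensor q V W \<in> uq_reps q" "act q (rep_tensor q V W) (gen x) = tgens x"
    unfolding rep_tensor_def using rep[OF q u] tens_action_comult_gen by simp_all
qed

end

lemma fst_rep_tensor [simp]: "fst (rep_tensor q V W) = fst V * fst W"
  by (simp add: rep_tensor_def)

lemma act_gen_carrier: "V \<in> uq_reps q \<Longrightarrow> act q V f \<in> carrier_mat (fst V) (fst V)"
  by (simp add: uq_reps_def act_carrier)

lemma counit_hom [simp]:
  "counit (f + g) = counit f + counit g" "counit (f * g) = counit f * counit g"
  "counit (scal c) = c" "counit (gen x) = counit_gen x"
  by (simp_all add: counit_def id_embedding.free_lift_add)

lemma rep_unit:
  assumes q: "generic_parameter q"
  shows "rep_unit \<in> uq_reps q" "act q rep_unit (gen x) = counit_gen x \<cdot>\<^sub>m 1\<^sub>m 1" "fst rep_unit = 1"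
proof -
  interpret mat_hom 1 "\<lambda>f. counit f \<cdot>\<^sub>m 1\<^sub>m 1"
    by unfold_locales (auto intro!: eq_matI simp: algebra_simps scalar_prod_def)
  have one: "1 \<cdot>\<^sub>m 1\<^sub>m n = (1\<^sub>m n :: complex mat)" and zero: "0 \<cdot>\<^sub>m 1\<^sub>m n = (0\<^sub>m n n :: complex mat)" for n
    by (rule eq_matI; simp)+
  have "1\<^sub>m 1 = 1\<^sub>m 1 * qdiag q 1 (\<lambda>_. 0) * 1\<^sub>m 1"
    by (rule eq_matI) (auto simp: qdiag_def scalar_prod_def)
  then have "type_one_mat q (1\<^sub>m 1)"
    by (intro type_one_matI[where P = "1\<^sub>m 1" and P' = "1\<^sub>m 1" and w = "\<lambda>_. 0" and n = 1]) simp_all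
  moreover have "level_zero q (\<lambda>x. op_of 1 (counit (gen x) \<cdot>\<^sub>m 1\<^sub>m 1))"
    by unfold_locales (simp_all add: one zero op_of_one op_of_zero)
  ultimately have "uq_matrices q 1 (\<lambda>x. counit (gen x) \<cdot>\<^sub>m 1\<^sub>m 1)"
    by (simp add: uq_matrices_def one)
  from rep[OF q this] show "rep_unit \<in> uq_reps q" "act q rep_unit (gen x) = counit_gen x \<cdot>\<^sub>m 1\<^sub>m 1" "fst rep_unit = 1"
    by (simp_all add: rep_unit_def)
qed

text \<open>Matrices of one fixed size form no type, so the free algebra is evaluated in
  \<open>op\<close> and the matrix is recovered from the images of the unit sequences. An induction
  over the free algebra shows that every value does come from a matrix.\<close>

lemma uq_matrices_rep:
  assumes q: "generic_parameter q" and g: "uq_matrices q n g"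
  obtains V where "V \<in> uq_reps q" "fst V = n" "\<And>x. act q V (gen x) = g x"
proof -
  define h where "h = free_lift (\<lambda>c. c *\<^sub>C (1::op)) (\<lambda>x. op_of n (g x))"
  define T where "T f = mat n n (\<lambda>(i, j). app (h f) (\<lambda>l. if l = j then 1 else 0) i)" for f
  have gc: "g x \<in> carrier_mat n n" for x using g by (simp add: uq_matrices_def)
  have T_op: "T f = A" if "h f = op_of n A" "A \<in> carrier_mat n n" for f A
    using that by (intro eq_matI) (auto simp: T_def app_op_of if_distrib cong: if_cong)
  have 0: "A = B" if "n = 0" "A \<in> carrier_mat n n" "B \<in> carrier_mat n n" for A B :: "complex mat"
    using that by (intro eq_matI) auto
  have Tc: "T f \<in> carrier_mat n n" for f by (simp add: T_def)
  have op_T: "op_of n (T f) = h f" if n: "n > 0" for f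
  proof -
    have "\<exists>A\<in>carrier_mat n n. h f = op_of n A"
    proof (induction f rule: free_alg_induct)
      case (scal c)
      then show ?case
        by (intro bexI[of _ "c \<cdot>\<^sub>m 1\<^sub>m n"]) (simp_all add: h_def op_of_smult op_of_one n)
    next
      case (gen x)
      then show ?case using gc by (auto simp: h_def)
    next
      case (add f g)
      then obtain A B where "A \<in> carrier_mat n n" "h f = op_of n A" "B \<in> carrier_mat n n" "h g = op_of n B" by blast
      then show ?case
        by (intro bexI[of _ "A + B"]) (simp_all add: h_def scaleC_embedding.free_lift_add op_of_add)
    next
      case (mult f g)
      then obtain A B where "A \<in> carrier_mat n n" "h f = op_of n A" "B \<in> carrier_mat n n" "h g = op_of n B" by blast
      then show ?case
        by (intro bexI[of _ "A * B"]) (simp_all add: h_def op_of_mult mult_carrier_mat[of _ n n _ n])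
    qed
    then show ?thesis using T_op by metis
  qed
  have inj: "T f = A" if "n > 0 \<Longrightarrow> h f = op_of n A" "A \<in> carrier_mat n n" for f A
    using that T_op 0[OF _ Tc] by (cases "n = 0") auto
  interpret mat_hom n T
  proof
    fix f f' c
    show "T f \<in> carrier_mat n n" by (rule Tc)
    show "T (f + f') = T f + T f'"
      by (rule inj) (simp_all add: Tc op_of_add op_T, simp add: h_def scaleC_embedding.free_lift_add)
    show "T (f * f') = T f * T f'"
      by (rule inj) (simp_all add: Tc op_of_mult op_T mult_carrier_mat[of _ n n _ n], simp add: h_def)
    show "T (scal c) = c \<cdot>\<^sub>m 1\<^sub>m n"
      by (rule inj) (simp_all add: op_of_smult op_of_one h_def)
  qed
  have gen: "T (gen x) = g x" for x by (rule inj) (simp_all add: gc h_def)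
  have "uq_matrices q n (\<lambda>x. T (gen x))" using g by (simp add: gen)
  from rep[OF q this] show thesis using that[of "(n, \<lambda>a. the_elem (T ` a))"] gen by simp
qed

section \<open>Intertwiners in terms of generators\<close>

lemma rep_hom_iff:
  assumes V: "V \<in> uq_reps q" and W: "W \<in> uq_reps q"
  shows "T \<in> rep_hom q V W \<longleftrightarrow> T \<in> carrier_mat (fst W) (fst V)
    \<and> (\<forall>x. T * act q V (gen x) = act q W (gen x) * T)" (is "?l \<longleftrightarrow> ?r")
proof
  assume ?l
  then show ?r by (auto simp: rep_hom_def act_def carrier_Uq split: prod.splits)
next
  assume r: ?r
  then have T: "T \<in> carrier_mat (fst W) (fst V)" by blast
  interpret V: mat_hom "fst V" "act q V" using V by (intro mat_hom_act) (simp add: uq_reps_def)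
  interpret W: mat_hom "fst W" "act q W" using W by (intro mat_hom_act) (simp add: uq_reps_def)
  have "T * act q V f = act q W f * T" for f
  proof (induction f rule: free_alg_induct)
    case (scal c)
    show ?case using T
      by (simp add: V.T_scal W.T_scal mult_smult_distrib[of _ "fst W" "fst V" _ "fst V"]
          mult_smult_assoc_mat[of _ "fst W" "fst W" _ "fst V"])
  next
    case (add f g)
    then show ?case using T V.T_carrier W.T_carrier
      by (simp add: V.T_add W.T_add mult_add_distrib_mat[of _ "fst W" "fst V" _ "fst V"]
          add_mult_distrib_mat[of _ "fst W" "fst W" _ _ "fst V"])
  next
    case (mult f g)
    have "T * (act q V f * act q V g) = T * act q V f * act q V g"
      using T V.T_carrier by (simp add: assoc_mult_mat[of _ "fst W" "fst V" _ "fst V" _ "fst V"])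
    also have "\<dots> = act q W f * (T * act q V g)"
      using T V.T_carrier[of g] W.T_carrier[of f] mult(1)
      by (simp add: assoc_mult_mat[of _ "fst W" "fst W" _ "fst V" _ "fst V"])
    also have "\<dots> = act q W f * act q W g * T"
      using T W.T_carrier[of f] W.T_carrier[of g] mult(2)
      by (simp add: assoc_mult_mat[of _ "fst W" "fst W" _ "fst W" _ "fst V"])
    finally show ?case by (simp add: V.T_mult W.T_mult)
  qed (use r in blast)
  then show ?l using T by (auto simp: rep_hom_def act_def carrier_Uq split: prod.splits)
qed

lemma rep_isoI:
  assumes VW: "V \<in> uq_reps q" "W \<in> uq_reps q"
    and T: "T \<in> carrier_mat (fst W) (fst V)" "S \<in> carrier_mat (fst V) (fst W)"
      "S * T = 1\<^sub>m (fst V)" "T * S = 1\<^sub>m (fst W)"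
    and TV: "\<And>x. T * act q V (gen x) = act q W (gen x) * T"
  shows "rep_iso q V W"
proof -
  let ?m = "fst V" and ?n = "fst W"
  have "S * act q W (gen x) = act q V (gen x) * S" for x
  proof -
    note c = act_gen_carrier[OF VW(1), of "gen x"] act_gen_carrier[OF VW(2), of "gen x"] T(1,2)
    have "S * act q W (gen x) = S * (act q W (gen x) * T) * S"
      using c T(4) by (simp add: assoc_mult_mat[of _ ?m ?n _ ?m _ ?n] assoc_mult_mat[of _ ?n ?n _ ?m _ ?n] right_mult_one_mat[of _ ?n ?n])
    also have "\<dots> = S * T * act q V (gen x) * S"
      using c by (simp add: TV[symmetric] assoc_mult_mat[of _ ?m ?n _ ?m _ ?m])
    also have "\<dots> = act q V (gen x) * S"
      using c T(3) by (simp add: left_mult_one_mat[of _ ?m ?m])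
    finally show ?thesis .
  qed
  then show ?thesis unfolding rep_iso_def using T TV rep_hom_iff[OF VW] rep_hom_iff[OF VW(2,1)] by blast
qed

lemma rep_isoE:
  assumes "V \<in> uq_reps q" "W \<in> uq_reps q" "rep_iso q V W"
  obtains T S where "T \<in> carrier_mat (fst W) (fst V)" "S \<in> carrier_mat (fst V) (fst W)"
    "S * T = 1\<^sub>m (fst V)" "T * S = 1\<^sub>m (fst W)"
    "\<And>x. T * act q V (gen x) = act q W (gen x) * T" "\<And>x. S * act q W (gen x) = act q V (gen x) * S"
  using assms(3) rep_hom_iff[OF assms(1,2)] rep_hom_iff[OF assms(2,1)] unfolding rep_iso_def by blast

lemma rep_iso_same:
  assumes "V \<in> uq_reps q" "W \<in> uq_reps q" "fst V = fst W" "\<And>x. act q V (gen x) = act q W (gen x)"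
  shows "rep_iso q V W"
  using assms act_gen_carrier[OF assms(2)]
  by (intro rep_isoI[where T = "1\<^sub>m (fst W)" and S = "1\<^sub>m (fst W)"])
    (simp_all add: left_mult_one_mat[of _ "fst W" "fst W"] right_mult_one_mat[of _ "fst W" "fst W"])

lemma rep_iso_refl: "V \<in> uq_reps q \<Longrightarrow> rep_iso q V V"
  by (rule rep_iso_same) simp_all

lemma rep_iso_sym: "rep_iso q V W \<Longrightarrow> rep_iso q W V"
  unfolding rep_iso_def by blast

lemma rep_iso_trans:
  assumes U: "U \<in> uq_reps q" and V: "V \<in> uq_reps q" and W: "W \<in> uq_reps q"
    and "rep_iso q U V" "rep_iso q V W"
  shows "rep_iso q U W"
proof -
  let ?l = "fst U" and ?m = "fst V" and ?n = "fst W"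
  obtain T S where T: "T \<in> carrier_mat ?m ?l" "S \<in> carrier_mat ?l ?m" "S * T = 1\<^sub>m ?l" "T * S = 1\<^sub>m ?m"
    "\<And>x. T * act q U (gen x) = act q V (gen x) * T" using rep_isoE[OF U V assms(4)] by metis
  obtain T' S' where T': "T' \<in> carrier_mat ?n ?m" "S' \<in> carrier_mat ?m ?n" "S' * T' = 1\<^sub>m ?m" "T' * S' = 1\<^sub>m ?n"
    "\<And>x. T' * act q V (gen x) = act q W (gen x) * T'" using rep_isoE[OF V W assms(5)] by metis
  show ?thesis
  proof (rule rep_isoI[OF U W, where T = "T' * T" and S = "S * S'"])
    have "S * S' * (T' * T) = S * (S' * T') * T"
      using T(1,2) T'(1,2) by (simp add: assoc_mult_mat[of _ ?l ?m _ ?n _ ?l] assoc_mult_mat[of _ ?m ?n _ ?m _ ?l] assoc_mult_mat[of _ ?l ?m _ ?m _ ?l])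
    then show "S * S' * (T' * T) = 1\<^sub>m ?l" using T T' by (simp add: right_mult_one_mat[of _ ?l ?m])
    have "T' * T * (S * S') = T' * (T * S) * S'"
      using T(1,2) T'(1,2) by (simp add: assoc_mult_mat[of _ ?n ?m _ ?l _ ?n] assoc_mult_mat[of _ ?m ?l _ ?m _ ?n] assoc_mult_mat[of _ ?n ?m _ ?m _ ?n])
    then show "T' * T * (S * S') = 1\<^sub>m ?n" using T T' by (simp add: right_mult_one_mat[of _ ?n ?m])
    fix x
    note c = act_gen_carrier[OF U, of "gen x"] act_gen_carrier[OF V, of "gen x"] act_gen_carrier[OF W, of "gen x"]
    have "T' * T * act q U (gen x) = T' * (act q V (gen x) * T)"
      using c T(1) T'(1) by (simp add: assoc_mult_mat[of _ ?n ?m _ ?l _ ?l] T(5))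
    also have "\<dots> = act q W (gen x) * T' * T"
      using c T(1) T'(1) by (simp add: T'(5)[symmetric] assoc_mult_mat[of _ ?n ?m _ ?m _ ?l])
    also have "\<dots> = act q W (gen x) * (T' * T)"
      using c T(1) T'(1) by (simp add: assoc_mult_mat[of _ ?n ?n _ ?m _ ?l])
    finally show "T' * T * act q U (gen x) = act q W (gen x) * (T' * T)" .
  qed (use T T' in auto)
qed

text \<open>Short exact sequences of vector spaces split, so that exactness becomes a set of matrix
  identities.\<close>

definition split_exact :: "nat \<Rightarrow> nat \<Rightarrow> nat \<Rightarrow> complex mat \<Rightarrow> complex mat \<Rightarrow> complex mat \<Rightarrow> complex mat \<Rightarrow> bool" where
  "split_exact k n m f g r s \<longleftrightarrow> f \<in> carrier_mat n k \<and> g \<in> carrier_mat m n \<and> r \<in> carrier_mat k n \<and> s \<in> carrier_mat n m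
    \<and> r * f = 1\<^sub>m k \<and> g * s = 1\<^sub>m m \<and> g * f = 0\<^sub>m m k \<and> f * r + s * g = 1\<^sub>m n"

lemma mult_mat_unit_vec:
  assumes "A \<in> carrier_mat m n" "j < n"
  shows "A *\<^sub>v unit_vec n j = (col A j :: complex vec)"
proof (rule eq_vecI)
  fix i assume "i < dim_vec (col A j)"
  moreover from this have "row A i \<in> carrier_vec n" using assms by auto
  ultimately show "(A *\<^sub>v unit_vec n j) $ i = col A j $ i" using assms by auto
qed (use assms in auto)

lemma mat_eqI_vec:
  assumes "A \<in> carrier_mat m n" "B \<in> carrier_mat m n" "\<And>v. v \<in> carrier_vec n \<Longrightarrow> A *\<^sub>v v = (B *\<^sub>v v :: complex vec)"
  shows "A = B"
proof (rule mat_col_eqI)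
  fix j assume "j < dim_col B"
  then have j: "j < n" using assms(2) by auto
  then show "col A j = col B j"
    using assms(3)[of "unit_vec n j"] mult_mat_unit_vec[OF assms(1) j] mult_mat_unit_vec[OF assms(2) j] by simp
qed (use assms in auto)

lemma solve_columns:
  assumes A: "A \<in> carrier_mat p k" and B: "B \<in> carrier_mat p n"
    and sol: "\<And>j. j < n \<Longrightarrow> \<exists>u\<in>carrier_vec k. A *\<^sub>v u = col B j"
  obtains X :: "complex mat" where "X \<in> carrier_mat k n" "A * X = B"
proof -
  obtain u where u: "\<And>j. j < n \<Longrightarrow> u j \<in> carrier_vec k" "\<And>j. j < n \<Longrightarrow> A *\<^sub>v u j = col B j"
    using sol by metis
  define X where "X = mat k n (\<lambda>(i, j). u j $ i)"
  have X: "X \<in> carrier_mat k n" by (simp add: X_def)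
  have "A * X = B"
  proof (rule mat_col_eqI)
    fix j assume "j < dim_col B"
    then have j: "j < n" using B by auto
    have "col X j = u j" using u(1)[OF j] j by (intro eq_vecI) (auto simp: X_def)
    then show "col (A * X) j = col B j" using u(2)[OF j] by (simp only: col_mult2[OF A X j])
  qed (use A B X in auto)
  with X show thesis by (rule that)
qed

lemma zero_mat_mult_vec [simp]: "v \<in> carrier_vec k \<Longrightarrow> 0\<^sub>m m k *\<^sub>v v = (0\<^sub>v m :: complex vec)"
  by (intro eq_vecI) auto

lemma split_exact_vectors:
  assumes "split_exact k n m f g r s"
  shows "inj_on ((*\<^sub>v) f) (carrier_vec k)" "(*\<^sub>v) f ` carrier_vec k = mat_kernel g"
    "(*\<^sub>v) g ` carrier_vec n = carrier_vec m"
proof -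
  have c: "f \<in> carrier_mat n k" "g \<in> carrier_mat m n" "r \<in> carrier_mat k n" "s \<in> carrier_mat n m"
    and e: "r * f = 1\<^sub>m k" "g * s = 1\<^sub>m m" "g * f = 0\<^sub>m m k" "f * r + s * g = 1\<^sub>m n"
    using assms by (auto simp: split_exact_def)
  have rf: "r *\<^sub>v (f *\<^sub>v v) = v" if "v \<in> carrier_vec k" for v
    using that c e(1) by (simp flip: assoc_mult_mat_vec)
  show "inj_on ((*\<^sub>v) f) (carrier_vec k)" by (rule inj_on_inverseI[of _ "\<lambda>v. r *\<^sub>v v"]) (simp add: rf)
  show "(*\<^sub>v) f ` carrier_vec k = mat_kernel g"
  proof (intro equalityI subsetI)
    fix w assume "w \<in> (*\<^sub>v) f ` carrier_vec k"
    then obtain v where v: "v \<in> carrier_vec k" "w = f *\<^sub>v v" by auto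
    then have "g *\<^sub>v w = 0\<^sub>v m" using c e(3) by (simp flip: assoc_mult_mat_vec)
    then show "w \<in> mat_kernel g" using v c by (intro mat_kernelI[OF c(2)]) auto
  next
    fix w assume "w \<in> mat_kernel g"
    then have w: "w \<in> carrier_vec n" "g *\<^sub>v w = 0\<^sub>v m" using mat_kernelD[OF c(2)] by auto
    have "w = (f * r + s * g) *\<^sub>v w" using w e(4) by simp
    also have "\<dots> = f *\<^sub>v (r *\<^sub>v w) + s *\<^sub>v (g *\<^sub>v w)"
      using c w by (simp add: add_mult_distrib_mat_vec[of _ n n] assoc_mult_mat_vec[of _ n _ _ n])
    also have "s *\<^sub>v (g *\<^sub>v w) = 0\<^sub>v n" using w(2) c(4) by auto
    finally have "w = f *\<^sub>v (r *\<^sub>v w)" using c w by simp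
    then show "w \<in> (*\<^sub>v) f ` carrier_vec k" using c w by auto
  qed
  have "v = g *\<^sub>v (s *\<^sub>v v)" if "v \<in> carrier_vec m" for v
    using that c e(2) by (simp flip: assoc_mult_mat_vec)
  then have "v \<in> (*\<^sub>v) g ` carrier_vec n" if "v \<in> carrier_vec m" for v
    using that c by (intro image_eqI[of _ _ "s *\<^sub>v v"]) auto
  then show "(*\<^sub>v) g ` carrier_vec n = carrier_vec m" using c by auto
qed

lemma exact_splits:
  assumes c: "f \<in> carrier_mat n k" "g \<in> carrier_mat m n"
    and inj: "inj_on ((*\<^sub>v) f) (carrier_vec k)" and ker: "(*\<^sub>v) f ` carrier_vec k = mat_kernel g"
    and surj: "(*\<^sub>v) g ` carrier_vec n = carrier_vec m"
  obtains r s where "split_exact k n m f g r s"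
proof -
  have "\<exists>u\<in>carrier_vec n. g *\<^sub>v u = col (1\<^sub>m m) j" if "j < m" for j
  proof -
    have "col (1\<^sub>m m) j \<in> (*\<^sub>v) g ` carrier_vec n" using surj that by simp
    then show ?thesis by auto
  qed
  then obtain s where s: "s \<in> carrier_mat n m" "g * s = 1\<^sub>m m"
    using solve_columns[OF c(2) one_carrier_mat] by blast
  \<comment> \<open>The projection onto the kernel of \<open>g\<close> along the image of
    \<open>s\<close>. Its columns lie in the image of \<open>f\<close>, and lifting them through
    \<open>f\<close> gives the retraction \<open>r\<close>.\<close>
  define D where "D = 1\<^sub>m n - s * g"
  have D: "D \<in> carrier_mat n n" using s c by (simp add: D_def minus_carrier_mat)
  have gD: "g * D = 0\<^sub>m m n"
  proof -
    have "g * D = g * 1\<^sub>m n - g * (s * g)"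
      unfolding D_def using c s by (intro mult_minus_distrib_mat) auto
    also have "g * (s * g) = g" using c s by (simp flip: assoc_mult_mat[of _ m n _ m _ n])
    finally show ?thesis using c by simp
  qed
  have "\<exists>u\<in>carrier_vec k. f *\<^sub>v u = col D j" if j: "j < n" for j
  proof -
    have "g *\<^sub>v col D j = col (g * D) j" by (rule col_mult2[OF c(2) D j, symmetric])
    also have "\<dots> = 0\<^sub>v m" using gD j by simp
    finally have "col D j \<in> mat_kernel g" using D j by (intro mat_kernelI[OF c(2)]) auto
    then show ?thesis using ker by (metis imageE)
  qed
  then obtain r where r: "r \<in> carrier_mat k n" "f * r = D" using solve_columns[OF c(1) D] by blast
  have gf: "g * f = 0\<^sub>m m k"
  proof (rule mat_eqI_vec[of _ m k])
    fix v :: "complex vec" assume v: "v \<in> carrier_vec k"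
    then have "f *\<^sub>v v \<in> mat_kernel g" using ker by blast
    then have "g *\<^sub>v (f *\<^sub>v v) = 0\<^sub>v m" using mat_kernelD[OF c(2)] by blast
    then show "g * f *\<^sub>v v = 0\<^sub>m m k *\<^sub>v v" using c v by auto
  qed (use c in auto)
  have fr: "f * r + s * g = 1\<^sub>m n" unfolding r(2) D_def using s c by (intro eq_matI) auto
  have "r * f = 1\<^sub>m k"
  proof (rule mat_eqI_vec[of _ k k])
    fix v :: "complex vec" assume v: "v \<in> carrier_vec k"
    have "f *\<^sub>v (r *\<^sub>v (f *\<^sub>v v)) = (f * r + s * g) *\<^sub>v (f *\<^sub>v v) - s *\<^sub>v (g *\<^sub>v (f *\<^sub>v v))"
      using c r(1) s(1) v
      by (auto simp: add_mult_distrib_mat_vec[of _ n n] assoc_mult_mat_vec[of _ n _ _ n])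
    also have "g *\<^sub>v (f *\<^sub>v v) = 0\<^sub>v m" using gf c v by (simp flip: assoc_mult_mat_vec)
    also have "s *\<^sub>v 0\<^sub>v m = 0\<^sub>v n" using s(1) by auto
    finally have "f *\<^sub>v (r *\<^sub>v (f *\<^sub>v v)) = f *\<^sub>v v" using fr c v by simp
    then have "r *\<^sub>v (f *\<^sub>v v) = v" using inj r(1) c(1) v by (auto dest!: inj_onD)
    then show "r * f *\<^sub>v v = 1\<^sub>m k *\<^sub>v v" using c r v by (simp add: assoc_mult_mat_vec[of _ k n _ k])
  qed (use r c in auto)
  then show thesis using that[of r s] c r(1) s gf fr by (simp add: split_exact_def)
qed

lemma rep_sesI:
  assumes "split_exact (fst U) (fst W) (fst V) f g r s" "f \<in> rep_hom q U W" "g \<in> rep_hom q W V"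
  shows "rep_ses q U W V"
  unfolding rep_ses_def using assms(2,3) split_exact_vectors[OF assms(1)] by blast

lemma rep_sesE:
  assumes "U \<in> uq_reps q" "W \<in> uq_reps q" "V \<in> uq_reps q" "rep_ses q U W V"
  obtains f g r s where "split_exact (fst U) (fst W) (fst V) f g r s" "f \<in> rep_hom q U W" "g \<in> rep_hom q W V"
proof -
  obtain f g where fg: "f \<in> rep_hom q U W" "g \<in> rep_hom q W V"
    "inj_on ((*\<^sub>v) f) (carrier_vec (fst U))" "(*\<^sub>v) f ` carrier_vec (fst U) = mat_kernel g"
    "(*\<^sub>v) g ` carrier_vec (fst W) = carrier_vec (fst V)"
    using assms(4) unfolding rep_ses_def by blast
  have "f \<in> carrier_mat (fst W) (fst U)" "g \<in> carrier_mat (fst V) (fst W)"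
    using fg(1,2) rep_hom_iff assms(1-3) by blast+
  then obtain r s where "split_exact (fst U) (fst W) (fst V) f g r s"
    using exact_splits fg(3-5) by blast
  then show thesis using that fg by blast
qed

section \<open>Functoriality of the tensor product\<close>

lemma tensor_gens_kron:
  assumes "A \<in> carrier_mat m' m" "B \<in> carrier_mat n' n"
    and "\<And>x. g x \<in> carrier_mat m m" "\<And>x. g' x \<in> carrier_mat m' m'"
    and "\<And>x. h x \<in> carrier_mat n n" "\<And>x. h' x \<in> carrier_mat n' n'"
    and A: "\<And>x. A * g x = g' x * A" and B: "\<And>x. B * h x = h' x * B"
  shows "kron A B * tensor_gens m n g h x = tensor_gens m' n' g' h' x * kron A B"
  using assms(1-6)
  by (cases x)
    (simp_all add: A B kron_mult[of _ m' m _ m _ n' n _ n] kron_mult[of _ m' m' _ m _ n' n' _ n]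
      mult_add_distrib_mat[of _ "m' * n'" "m * n" _ "m * n"]
      add_mult_distrib_mat[of _ "m' * n'" "m' * n'" _ _ "m * n"]
      left_mult_one_mat[of _ m' m] right_mult_one_mat[of _ m' m]
      left_mult_one_mat[of _ n' n] right_mult_one_mat[of _ n' n])

context
  fixes q assumes q: "generic_parameter q"
begin

lemma rep_hom_tensor:
  assumes reps: "V \<in> uq_reps q" "V' \<in> uq_reps q" "W \<in> uq_reps q" "W' \<in> uq_reps q"
    and A: "A \<in> rep_hom q V V'" and B: "B \<in> rep_hom q W W'"
  shows "kron A B \<in> rep_hom q (rep_tensor q V W) (rep_tensor q V' W')"
proof -
  have A': "A \<in> carrier_mat (fst V') (fst V)" "\<And>x. A * act q V (gen x) = act q V' (gen x) * A"
    and B': "B \<in> carrier_mat (fst W') (fst W)" "\<And>x. B * act q W (gen x) = act q W' (gen x) * B"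
    using A B by (auto simp: rep_hom_iff reps)
  show ?thesis
    unfolding rep_hom_iff[OF rep_tensor_in_reps[OF reps(1,3) q] rep_tensor_in_reps[OF reps(2,4) q]]
      act_rep_tensor[OF reps(1,3) q] act_rep_tensor[OF reps(2,4) q]
    using A' B' reps by (auto intro!: tensor_gens_kron act_gen_carrier)
qed

lemma rep_iso_tensor:
  assumes reps: "V \<in> uq_reps q" "V' \<in> uq_reps q" "W \<in> uq_reps q" "W' \<in> uq_reps q"
    and V: "rep_iso q V V'" and W: "rep_iso q W W'"
  shows "rep_iso q (rep_tensor q V W) (rep_tensor q V' W')"
proof -
  obtain A A' where A: "A \<in> rep_hom q V V'" "A' \<in> rep_hom q V' V" "A' * A = 1\<^sub>m (fst V)" "A * A' = 1\<^sub>m (fst V')"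
    using V unfolding rep_iso_def by blast
  obtain B B' where B: "B \<in> rep_hom q W W'" "B' \<in> rep_hom q W' W" "B' * B = 1\<^sub>m (fst W)" "B * B' = 1\<^sub>m (fst W')"
    using W unfolding rep_iso_def by blast
  have c: "A \<in> carrier_mat (fst V') (fst V)" "A' \<in> carrier_mat (fst V) (fst V')"
    "B \<in> carrier_mat (fst W') (fst W)" "B' \<in> carrier_mat (fst W) (fst W')"
    using A(1,2) B(1,2) by (auto simp: rep_hom_iff reps)
  have "kron A' B' * kron A B = 1\<^sub>m (fst V * fst W)" "kron A B * kron A' B' = 1\<^sub>m (fst V' * fst W')"
    using c A B by (simp_all add: kron_mult[of _ _ "fst V'"] kron_mult[of _ _ "fst V"] kron_mult[OF c(2,1,4,3)] kron_mult[OF c(1,2,3,4)] kron_one)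
  then show ?thesis
    unfolding rep_iso_def using rep_hom_tensor[OF reps A(1) B(1)] rep_hom_tensor[OF reps(2,1,4,3) A(2) B(2)]
    by auto
qed

text \<open>Here the matrix form of exactness pays off: \<open>kron\<close> respects products, sums,
  zero and identity matrices, hence all identities of \<open>split_exact\<close>.\<close>

lemma kron_split_exact_left:
  assumes "split_exact k n m f g r s"
  shows "split_exact (k * p) (n * p) (m * p) (kron f (1\<^sub>m p)) (kron g (1\<^sub>m p)) (kron r (1\<^sub>m p)) (kron s (1\<^sub>m p))"
  using assms unfolding split_exact_def
  by (auto simp: kron_mult[of _ _ _ _ _ _ p p _ p] kron_one kron_zero_left[OF one_carrier_mat]
      simp flip: kron_add_left[of _ n n _ _ p p])

lemma kron_split_exact_right:
  assumes "split_exact k n m f g r s"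
  shows "split_exact (p * k) (p * n) (p * m) (kron (1\<^sub>m p) f) (kron (1\<^sub>m p) g) (kron (1\<^sub>m p) r) (kron (1\<^sub>m p) s)"
  using assms unfolding split_exact_def
  by (auto simp: kron_mult[of _ p p _ p] kron_one kron_zero_right[OF one_carrier_mat]
      simp flip: kron_add_right[of _ p p _ n n])

lemma one_rep_hom: "V \<in> uq_reps q \<Longrightarrow> 1\<^sub>m (fst V) \<in> rep_hom q V V"
  using act_gen_carrier[of V q]
  by (simp add: rep_hom_iff left_mult_one_mat[of _ "fst V" "fst V"] right_mult_one_mat[of _ "fst V" "fst V"])

lemma rep_ses_tensor_left:
  assumes reps: "U \<in> uq_reps q" "W \<in> uq_reps q" "V \<in> uq_reps q" "X \<in> uq_reps q" and "rep_ses q U W V"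
  shows "rep_ses q (rep_tensor q U X) (rep_tensor q W X) (rep_tensor q V X)"
proof -
  obtain f g r s where *: "split_exact (fst U) (fst W) (fst V) f g r s" "f \<in> rep_hom q U W" "g \<in> rep_hom q W V"
    using rep_sesE[OF reps(1-3) assms(5)] by blast
  show ?thesis
    using kron_split_exact_left[OF *(1), of "fst X"]
    by (intro rep_sesI[OF _ rep_hom_tensor[OF reps(1,2,4,4) *(2) one_rep_hom[OF reps(4)]]
          rep_hom_tensor[OF reps(2,3,4,4) *(3) one_rep_hom[OF reps(4)]]]) simp
qed

lemma rep_ses_tensor_right:
  assumes reps: "U \<in> uq_reps q" "W \<in> uq_reps q" "V \<in> uq_reps q" "X \<in> uq_reps q" and "rep_ses q U W V"
  shows "rep_ses q (rep_tensor q X U) (rep_tensor q X W) (rep_tensor q X V)"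
proof -
  obtain f g r s where *: "split_exact (fst U) (fst W) (fst V) f g r s" "f \<in> rep_hom q U W" "g \<in> rep_hom q W V"
    using rep_sesE[OF reps(1-3) assms(5)] by blast
  show ?thesis
    using kron_split_exact_right[OF *(1), of "fst X"]
    by (intro rep_sesI[OF _ rep_hom_tensor[OF reps(4,4,1,2) one_rep_hom[OF reps(4)] *(2)]
          rep_hom_tensor[OF reps(4,4,2,3) one_rep_hom[OF reps(4)] *(3)]]) simp
qed

text \<open>\<open>kron\<close> is strictly associative in the flattened basis, so the identity
  matrix is the isomorphism.\<close>

lemma rep_tensor_assoc:
  assumes reps: "U \<in> uq_reps q" "V \<in> uq_reps q" "W \<in> uq_reps q"
  shows "rep_iso q (rep_tensor q (rep_tensor q U V) W) (rep_tensor q U (rep_tensor q V W))"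
proof -
  note UV = rep_tensor_in_reps[OF reps(1,2) q] and VW = rep_tensor_in_reps[OF reps(2,3) q]
  note c = act_gen_carrier[OF reps(1)] act_gen_carrier[OF reps(2)] act_gen_carrier[OF reps(3)]
  show ?thesis
  proof (rule rep_iso_same)
    fix x
    show "act q (rep_tensor q (rep_tensor q U V) W) (gen x) = act q (rep_tensor q U (rep_tensor q V W)) (gen x)"
      unfolding act_rep_tensor[OF UV reps(3) q] act_rep_tensor[OF reps(1) VW q]
        act_rep_tensor[OF reps(1,2) q] act_rep_tensor[OF reps(2,3) q] fst_rep_tensor
      by (cases x)
        (simp_all add: c kron_assoc kron_add_left[of _ "fst U * fst V" "fst U * fst V" _ _ "fst W" "fst W"]
          kron_add_right[of _ "fst U" "fst U" _ "fst V * fst W" "fst V * fst W"]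
          assoc_add_mat[of _ "fst U * (fst V * fst W)" "fst U * (fst V * fst W)"]
          flip: kron_one)
  qed (use reps UV VW q in \<open>simp_all add: rep_tensor_in_reps mult.assoc\<close>)
qed

lemma kron_unit:
  assumes "A \<in> carrier_mat n n"
  shows "kron (c \<cdot>\<^sub>m 1\<^sub>m 1) A = c \<cdot>\<^sub>m A" "kron A (c \<cdot>\<^sub>m 1\<^sub>m 1) = c \<cdot>\<^sub>m A"
  using assms by (auto intro!: eq_matI simp: kron_def)

lemma rep_tensor_unit:
  assumes V: "V \<in> uq_reps q"
  shows "rep_iso q (rep_tensor q rep_unit V) V" "rep_iso q (rep_tensor q V rep_unit) V"
proof -
  note u = rep_unit[OF q]
  have one: "1\<^sub>m (Suc 0) = (1 :: complex) \<cdot>\<^sub>m 1\<^sub>m (Suc 0)" by (rule eq_matI) auto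
  have s: "1 \<cdot>\<^sub>m A = A" "0 \<cdot>\<^sub>m B + A = A" "A + 0 \<cdot>\<^sub>m B = A"
    if "A \<in> carrier_mat (fst V) (fst V)" "B \<in> carrier_mat (fst V) (fst V)" for A B :: "complex mat"
    using that by (auto intro!: eq_matI)
  note c = act_gen_carrier[OF V]
  note k = kron_unit[OF c, simplified] kron_unit[OF one_carrier_mat, simplified]
  show "rep_iso q (rep_tensor q rep_unit V) V"
  proof (rule rep_iso_same)
    fix x
    have "kron (1\<^sub>m (Suc 0)) (act q V f) = act q V f" for f
      using k(1)[where c = 1] by (simp add: s(1)[OF c c] flip: one)
    then show "act q (rep_tensor q rep_unit V) (gen x) = act q V (gen x)"
      unfolding act_rep_tensor[OF u(1) V q]
      by (cases x) (simp_all add: u k s[OF c c] s[OF c one_carrier_mat])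
  qed (use u V q in \<open>simp_all add: rep_tensor_in_reps\<close>)
  show "rep_iso q (rep_tensor q V rep_unit) V"
  proof (rule rep_iso_same)
    fix x
    have "kron (act q V f) (1\<^sub>m (Suc 0)) = act q V f" for f
      using k(2)[where c = 1] by (simp add: s(1)[OF c c] flip: one)
    then show "act q (rep_tensor q V rep_unit) (gen x) = act q V (gen x)"
      unfolding act_rep_tensor[OF V u(1) q]
      by (cases x) (simp_all add: u k s[OF c c] s[OF c one_carrier_mat])
  qed (use u V q in \<open>simp_all add: rep_tensor_in_reps\<close>)
qed

end

section \<open>Duality\<close>

text \<open>The map below is an antiautomorphism both of the algebra and of the coalgebra. Up to
  rescaling the generators it is the antipode followed by the exchange of the two nodes.\<close>

primrec anti :: "(uq_gen \<Rightarrow> 'a::times) \<Rightarrow> uq_gen \<Rightarrow> 'a" where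
  "anti G (K i) = G (K i)"
| "anti G (KInv i) = G (KInv i)"
| "anti G (XPlus i) = (case i of N0 \<Rightarrow> G (K N0) * G (XPlus N1) | N1 \<Rightarrow> G (XPlus N0) * G (K N1))"
| "anti G (XMinus i) = (case i of N0 \<Rightarrow> G (XMinus N1) * G (K N1) | N1 \<Rightarrow> G (K N0) * G (XMinus N0))"
| "anti G CSqrt = G CSqrt"
| "anti G CSqrtInv = G CSqrtInv"

context level_zero
begin

lemma K_mult_assoc:
  "G (K i) * (G (KInv i) * u) = u" "G (KInv i) * (G (K i) * u) = u"
  "G (K N0) * (G (K N1) * u) = u" "G (K N1) * (G (K N0) * u) = u"
  by (simp_all add: K0_K1 K1_K0 flip: mult.assoc)

text \<open>The defining relations read backwards; transposing matrices restores their
  order.\<close>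

lemma anti_relations:
  assumes q: "q \<noteq> 0"
  shows "anti G (XPlus j) * anti G (K i) = (q powi cartan i j) *\<^sub>C (anti G (K i) * anti G (XPlus j))"
    and "anti G (XMinus j) * anti G (K i) = (q powi (- cartan i j)) *\<^sub>C (anti G (K i) * anti G (XMinus j))"
    and "anti G (XMinus j) * anti G (XPlus i) - anti G (XPlus i) * anti G (XMinus j)
      = (if i = j then (1 / (q - inverse q)) *\<^sub>C (anti G (K i) - anti G (KInv i)) else 0)"
proof -
  define k ki where "k = G (K N1)" and "ki = G (K N0)"
  have kk: "k * ki = 1" "ki * k = 1" "k * (ki * u) = u" "ki * (k * u) = u" for u
    by (simp_all add: k_def ki_def K0_K1 K1_K0 K_mult_assoc)
  have p: "q powi (- 2) = 1 / q\<^sup>2" "q powi 2 = q\<^sup>2" by (simp_all add: power_int_minus field_simps)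
  have w: "G (XPlus N1) * k = (1 / q\<^sup>2) *\<^sub>C (k * G (XPlus N1))" "G (XMinus N1) * k = q\<^sup>2 *\<^sub>C (k * G (XMinus N1))"
    "G (XPlus N0) * k = q\<^sup>2 *\<^sub>C (k * G (XPlus N0))" "G (XMinus N0) * k = (1 / q\<^sup>2) *\<^sub>C (k * G (XMinus N0))"
    using K_XPlus[of N1 N1] K_XMinus[of N1 N1] K_XPlus[of N1 N0] K_XMinus[of N1 N0] q
    by (simp_all add: k_def cartan_def p)
  have wi: "G (XPlus N1) * ki = q\<^sup>2 *\<^sub>C (ki * G (XPlus N1))" "G (XMinus N1) * ki = (1 / q\<^sup>2) *\<^sub>C (ki * G (XMinus N1))"
    "G (XPlus N0) * ki = (1 / q\<^sup>2) *\<^sub>C (ki * G (XPlus N0))" "G (XMinus N0) * ki = q\<^sup>2 *\<^sub>C (ki * G (XMinus N0))"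
    using K_XPlus[of N0 N1] K_XMinus[of N0 N1] K_XPlus[of N0 N0] K_XMinus[of N0 N0] q
    by (simp_all add: ki_def cartan_def p)
  have w': "G (XPlus N1) * (k * u) = (1 / q\<^sup>2) *\<^sub>C (k * (G (XPlus N1) * u))" "G (XMinus N1) * (k * u) = q\<^sup>2 *\<^sub>C (k * (G (XMinus N1) * u))"
    "G (XPlus N0) * (k * u) = q\<^sup>2 *\<^sub>C (k * (G (XPlus N0) * u))" "G (XMinus N0) * (k * u) = (1 / q\<^sup>2) *\<^sub>C (k * (G (XMinus N0) * u))"
    "G (XPlus N1) * (ki * u) = q\<^sup>2 *\<^sub>C (ki * (G (XPlus N1) * u))" "G (XMinus N1) * (ki * u) = (1 / q\<^sup>2) *\<^sub>C (ki * (G (XMinus N1) * u))"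
    "G (XPlus N0) * (ki * u) = (1 / q\<^sup>2) *\<^sub>C (ki * (G (XPlus N0) * u))" "G (XMinus N0) * (ki * u) = q\<^sup>2 *\<^sub>C (ki * (G (XMinus N0) * u))" for u
    using w wi by (simp_all flip: mult.assoc)
  have b: "G (XPlus N1) * G (XMinus N0) = G (XMinus N0) * G (XPlus N1)"
    "G (XPlus N0) * G (XMinus N1) = G (XMinus N1) * G (XPlus N0)"
    using bracket[of N1 N0] bracket[of N0 N1] by simp_all
  have d: "G (XMinus N1) * G (XPlus N1) - G (XPlus N1) * G (XMinus N1) = (1 / (q - inverse q)) *\<^sub>C (ki - k)"
    "G (XMinus N0) * G (XPlus N0) - G (XPlus N0) * G (XMinus N0) = (1 / (q - inverse q)) *\<^sub>C (k - ki)"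
    using bracket[of N1 N1] bracket[of N0 N0]
    by (simp_all add: k_def ki_def KInv_N0 KInv_N1)
      (metis minus_diff_eq scaleC_minus_right)+
  note defs = k_def[symmetric] ki_def[symmetric]
  show "anti G (XPlus j) * anti G (K i) = (q powi cartan i j) *\<^sub>C (anti G (K i) * anti G (XPlus j))"
    by (cases i; cases j) (simp_all add: defs cartan_def p w wi w' kk mult.assoc q)
  show "anti G (XMinus j) * anti G (K i) = (q powi (- cartan i j)) *\<^sub>C (anti G (K i) * anti G (XMinus j))"
    by (cases i; cases j) (simp_all add: defs cartan_def p w wi w' kk mult.assoc q)
  show "anti G (XMinus j) * anti G (XPlus i) - anti G (XPlus i) * anti G (XMinus j)
      = (if i = j then (1 / (q - inverse q)) *\<^sub>C (anti G (K i) - anti G (KInv i)) else 0)"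
    by (cases i; cases j) (simp_all add: defs KInv_N0 KInv_N1 w wi w' kk mult.assoc q b d)
qed

end

text \<open>A relation and not a function, because an operator on sequences need not come from a
  matrix. Being single-valued in the second argument, it transports identities: compute the
  transposes of both sides and compare.\<close>

definition op_transpose :: "nat \<Rightarrow> op \<Rightarrow> op \<Rightarrow> bool" where
  "op_transpose n X Y \<longleftrightarrow> (\<exists>A\<in>carrier_mat n n. X = op_of n A \<and> Y = op_of n (transpose_mat A))"

lemma op_transposeI: "A \<in> carrier_mat n n \<Longrightarrow> op_transpose n (op_of n A) (op_of n (transpose_mat A))"
  by (auto simp: op_transpose_def)

lemma op_transpose_unique: "op_transpose n X Y \<Longrightarrow> op_transpose n X Y' \<Longrightarrow> Y = Y'"
  unfolding op_transpose_def using op_of_inject by metis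

lemma op_transpose_mult:
  assumes "op_transpose n X Y" "op_transpose n X' Y'"
  shows "op_transpose n (X * X') (Y' * Y)"
proof -
  obtain A B where "A \<in> carrier_mat n n" "B \<in> carrier_mat n n"
    "X = op_of n A" "X' = op_of n B" "Y = op_of n (transpose_mat A)" "Y' = op_of n (transpose_mat B)"
    using assms by (auto simp: op_transpose_def)
  then show ?thesis unfolding op_transpose_def
    by (intro bexI[of _ "A * B"]) (auto simp: op_of_mult transpose_mult[of A n n B n])
qed

lemma op_transpose_scale:
  assumes "op_transpose n X Y"
  shows "op_transpose n (c *\<^sub>C X) (c *\<^sub>C Y)"
proof -
  obtain A where "A \<in> carrier_mat n n" "X = op_of n A" "Y = op_of n (transpose_mat A)"
    using assms by (auto simp: op_transpose_def)
  moreover have "transpose_mat (c \<cdot>\<^sub>m A) = c \<cdot>\<^sub>m transpose_mat A" by (intro eq_matI) auto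
  ultimately show ?thesis unfolding op_transpose_def
    by (intro bexI[of _ "c \<cdot>\<^sub>m A"]) (auto simp: op_of_smult)
qed

lemma op_transpose_add:
  assumes "op_transpose n X Y" "op_transpose n X' Y'"
  shows "op_transpose n (X + X') (Y + Y')"
proof -
  obtain A B where "A \<in> carrier_mat n n" "B \<in> carrier_mat n n"
    "X = op_of n A" "X' = op_of n B" "Y = op_of n (transpose_mat A)" "Y' = op_of n (transpose_mat B)"
    using assms by (auto simp: op_transpose_def)
  then show ?thesis unfolding op_transpose_def
    by (intro bexI[of _ "A + B"]) (auto simp: op_of_add transpose_add)
qed

lemma op_transpose_diff:
  assumes "op_transpose n X Y" "op_transpose n X' Y'"
  shows "op_transpose n (X - X') (Y - Y')"
  using op_transpose_add[OF assms(1) op_transpose_scale[OF assms(2), of "- 1"]] by simp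

lemma op_transpose_one: "n > 0 \<Longrightarrow> op_transpose n 1 1"
  using op_transposeI[of "1\<^sub>m n" n] by (simp add: op_of_one)

lemma op_transpose_zero: "op_transpose n 0 0"
  using op_transposeI[of "0\<^sub>m n n" n] by (simp add: op_of_zero)

text \<open>Products are reversed twice, once by \<open>anti\<close> and once by
  transposition.\<close>

lemma level_zero_dual:
  assumes g: "\<And>x. g x \<in> carrier_mat n n" and lz: "level_zero q (\<lambda>x. op_of n (g x))" and n: "n > 0" and q: "q \<noteq> 0"
  shows "level_zero q (\<lambda>x. op_of n (transpose_mat (anti g x)))"
proof -
  interpret level_zero q "\<lambda>x. op_of n (g x)" by fact
  let ?G = "\<lambda>x. op_of n (g x)" and ?H = "\<lambda>x. op_of n (transpose_mat (anti g x))"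
  have c: "anti g x \<in> carrier_mat n n" for x
    using g by (cases x) (auto split: node.splits intro!: mult_carrier_mat[of _ n n _ n])
  have "op_of n (anti g x) = anti ?G x" for x
    using g by (cases x) (auto split: node.splits simp: op_of_mult)
  then have tr: "op_transpose n (anti ?G x) (?H x)" for x
    using op_transposeI[OF c, of x] by simp
  have eqI: "Y = Y'" if "op_transpose n X Y" "op_transpose n X' Y'" "X = X'" for X X' Y Y'
    using that op_transpose_unique by blast
  show ?thesis
  proof
    fix i j
    show "?H (K i) * ?H (KInv i) = 1"
      by (rule eqI[OF op_transpose_mult[OF tr tr] op_transpose_one[OF n]]) simp
    show "?H (KInv i) * ?H (K i) = 1"
      by (rule eqI[OF op_transpose_mult[OF tr tr] op_transpose_one[OF n]]) simp
    show "?H (K N0) * ?H (K N1) = 1"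
      by (rule eqI[OF op_transpose_mult[OF tr tr] op_transpose_one[OF n]]) (simp add: K1_K0)
    show "?H CSqrt = 1" by (rule eqI[OF tr op_transpose_one[OF n]]) (simp add: CSqrt)
    show "?H CSqrtInv = 1" by (rule eqI[OF tr op_transpose_one[OF n]]) (simp add: CSqrtInv)
    show "?H (K i) * ?H (XPlus j) = (q powi cartan i j) *\<^sub>C (?H (XPlus j) * ?H (K i))"
      by (rule eqI[OF op_transpose_mult[OF tr tr] op_transpose_scale[OF op_transpose_mult[OF tr tr]] anti_relations(1)[OF q]])
    show "?H (K i) * ?H (XMinus j) = (q powi (- cartan i j)) *\<^sub>C (?H (XMinus j) * ?H (K i))"
      by (rule eqI[OF op_transpose_mult[OF tr tr] op_transpose_scale[OF op_transpose_mult[OF tr tr]] anti_relations(2)[OF q]])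
    have "op_transpose n (if i = j then (1 / (q - inverse q)) *\<^sub>C (anti ?G (K i) - anti ?G (KInv i)) else 0)
      (if i = j then (1 / (q - inverse q)) *\<^sub>C (?H (K i) - ?H (KInv i)) else 0)"
      using op_transpose_scale[OF op_transpose_diff[OF tr tr]] op_transpose_zero by (simp del: anti.simps)
    from eqI[OF op_transpose_diff[OF op_transpose_mult[OF tr tr] op_transpose_mult[OF tr tr]] this anti_relations(3)[OF q]]
    show "?H (XPlus i) * ?H (XMinus j) - ?H (XMinus j) * ?H (XPlus i)
      = (if i = j then (1 / (q - inverse q)) *\<^sub>C (?H (K i) - ?H (KInv i)) else 0)" .
  qed
qed

lemma type_one_mat_transpose:
  assumes "type_one_mat q A" "A \<in> carrier_mat n n"
  shows "type_one_mat q (transpose_mat A)"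
proof -
  obtain w P P' where P: "P \<in> carrier_mat n n" "P' \<in> carrier_mat n n" "P * P' = 1\<^sub>m n" "P' * P = 1\<^sub>m n"
    "A = P * qdiag q n w * P'"
    using type_one_matE[OF assms] by metis
  have d: "transpose_mat (qdiag q n w) = qdiag q n w" by (rule eq_matI) (auto simp: qdiag_def)
  show ?thesis
  proof (rule type_one_matI)
    show "transpose_mat P' * transpose_mat P = 1\<^sub>m n" "transpose_mat P * transpose_mat P' = 1\<^sub>m n"
      using P(1-4) by (simp_all flip: transpose_mult[of _ n n _ n])
    have "transpose_mat (P * qdiag q n w * P') = transpose_mat P' * (transpose_mat (qdiag q n w) * transpose_mat P)"
      using P(1,2) by (simp add: transpose_mult[of _ n n _ n] mult_carrier_mat[of _ n n _ n])
    then show "transpose_mat A = transpose_mat P' * qdiag q n w * transpose_mat P"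
      using P(1,2) by (simp add: P(5) d assoc_mult_mat[of _ n n _ n _ n])
  qed (use P in auto)
qed

text \<open>Fixed by its generators through \<open>uq_matrices_rep\<close>. The choice is harmless,
  since the generators determine the action of the whole algebra.\<close>

definition dual :: "complex \<Rightarrow> uq_rep \<Rightarrow> uq_rep" where
  "dual q V = (SOME D. D \<in> uq_reps q \<and> fst D = fst V
     \<and> (\<forall>x. act q D (gen x) = transpose_mat (anti (\<lambda>y. act q V (gen y)) x)))"

lemma mat_0_eq: "A \<in> carrier_mat 0 0 \<Longrightarrow> B \<in> carrier_mat 0 0 \<Longrightarrow> A = (B :: complex mat)"
  by (intro eq_matI) auto

lemma rep_K_inverse:
  assumes V: "V \<in> uq_reps q"
  shows "act q V (gen (K N0)) * act q V (gen (K N1)) = 1\<^sub>m (fst V)"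
    and "act q V (gen (K N1)) * act q V (gen (K N0)) = 1\<^sub>m (fst V)"
    and "act q V (gen (KInv N0)) = act q V (gen (K N1))" "act q V (gen (KInv N1)) = act q V (gen (K N0))"
    and "act q V (gen CSqrt) = 1\<^sub>m (fst V)" and "act q V (gen CSqrtInv) = 1\<^sub>m (fst V)"
proof -
  note c = act_gen_carrier[OF V]
  have c': "act q V f * act q V g \<in> carrier_mat (fst V) (fst V)" for f g
    using c by (auto intro!: mult_carrier_mat[of _ "fst V" "fst V" _ "fst V"])
  have eqI: "A = B" if "fst V > 0 \<Longrightarrow> op_of (fst V) A = op_of (fst V) B"
    "A \<in> carrier_mat (fst V) (fst V)" "B \<in> carrier_mat (fst V) (fst V)" for A B :: "complex mat"
    using that op_of_inject mat_0_eq by (cases "fst V = 0") auto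
  have lz: "level_zero q (\<lambda>x. op_of (fst V) (act q V (gen x)))" if "fst V > 0"
    using uq_matrices_act[OF V] that by (simp add: uq_matrices_def)
  show "act q V (gen (K N0)) * act q V (gen (K N1)) = 1\<^sub>m (fst V)"
    "act q V (gen (K N1)) * act q V (gen (K N0)) = 1\<^sub>m (fst V)"
    "act q V (gen (KInv N0)) = act q V (gen (K N1))" "act q V (gen (KInv N1)) = act q V (gen (K N0))"
    "act q V (gen CSqrt) = 1\<^sub>m (fst V)" "act q V (gen CSqrtInv) = 1\<^sub>m (fst V)"
    using level_zero.K0_K1[OF lz] level_zero.K1_K0[OF lz] level_zero.KInv_N0[OF lz] level_zero.KInv_N1[OF lz]
      level_zero.CSqrt[OF lz] level_zero.CSqrtInv[OF lz]
    by (auto intro!: eqI c c' simp: op_of_mult[OF c c] op_of_one)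
qed

context
  fixes q assumes q: "generic_parameter q"
begin

lemma dual:
  assumes V: "V \<in> uq_reps q"
  shows "dual q V \<in> uq_reps q" "fst (dual q V) = fst V"
    "act q (dual q V) (gen x) = transpose_mat (anti (\<lambda>y. act q V (gen y)) x)"
proof -
  let ?g = "\<lambda>y. act q V (gen y)"
  have q0: "q \<noteq> 0" using q by (rule generic_parameter.q_nonzero)
  note c = act_gen_carrier[OF V] and u = uq_matrices_act[OF V]
  have "uq_matrices q (fst V) (\<lambda>x. transpose_mat (anti ?g x))"
  proof -
    have "anti ?g x \<in> carrier_mat (fst V) (fst V)" for x
      using c by (cases x) (auto split: node.splits intro!: mult_carrier_mat[of _ "fst V" "fst V" _ "fst V"])
    moreover have "level_zero q (\<lambda>x. op_of (fst V) (transpose_mat (anti ?g x)))" if "fst V > 0"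
      using level_zero_dual[of ?g "fst V" q] c u q0 that by (simp add: uq_matrices_def)
    ultimately show ?thesis
      using u c by (auto simp: uq_matrices_def intro!: type_one_mat_transpose)
  qed
  then obtain D where "D \<in> uq_reps q" "fst D = fst V" "\<And>x. act q D (gen x) = transpose_mat (anti ?g x)"
    using uq_matrices_rep[OF q] by blast
  then have "\<exists>D. D \<in> uq_reps q \<and> fst D = fst V \<and> (\<forall>x. act q D (gen x) = transpose_mat (anti ?g x))"
    by blast
  from someI_ex[OF this] show "dual q V \<in> uq_reps q" "fst (dual q V) = fst V"
    "act q (dual q V) (gen x) = transpose_mat (anti ?g x)"
    unfolding dual_def by blast+
qed

lemma rep_hom_dual:
  assumes V: "V \<in> uq_reps q" and W: "W \<in> uq_reps q" and T: "T \<in> rep_hom q V W"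
  shows "transpose_mat T \<in> rep_hom q (dual q W) (dual q V)"
proof -
  let ?m = "fst V" and ?n = "fst W"
  note cV = act_gen_carrier[OF V] and cW = act_gen_carrier[OF W]
  have T': "T \<in> carrier_mat ?n ?m" "\<And>x. T * act q V (gen x) = act q W (gen x) * T"
    using T by (auto simp: rep_hom_iff V W)
  have prod: "T * (act q V (gen x) * act q V (gen y)) = act q W (gen x) * act q W (gen y) * T" for x y
  proof -
    have "T * (act q V (gen x) * act q V (gen y)) = act q W (gen x) * T * act q V (gen y)"
      using T' cV by (simp flip: assoc_mult_mat[of _ ?n ?m _ ?m _ ?m])
    also have "\<dots> = act q W (gen x) * act q W (gen y) * T"
      using T' cV cW by (simp add: assoc_mult_mat[of _ ?n ?n _ ?m _ ?m] assoc_mult_mat[of _ ?n ?n _ ?n _ ?m])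
    finally show ?thesis .
  qed
  have c: "anti (\<lambda>y. act q U (gen y)) x \<in> carrier_mat (fst U) (fst U)" if "U \<in> uq_reps q" for U x
    using act_gen_carrier[OF that]
    by (cases x) (auto split: node.splits intro!: mult_carrier_mat[of _ "fst U" "fst U" _ "fst U"])
  have "T * anti (\<lambda>y. act q V (gen y)) x = anti (\<lambda>y. act q W (gen y)) x * T" for x
    by (cases x) (auto split: node.splits simp: prod T'(2))
  then have "transpose_mat (T * anti (\<lambda>y. act q V (gen y)) x) = transpose_mat (anti (\<lambda>y. act q W (gen y)) x * T)" for x
    by simp
  then show ?thesis
    using T'(1) c[OF V] c[OF W]
    by (simp add: rep_hom_iff dual V W transpose_mult[of _ ?n ?m _ ?m] transpose_mult[of _ ?n ?n _ ?m])
qed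

lemma rep_iso_dual:
  assumes V: "V \<in> uq_reps q" and W: "W \<in> uq_reps q" and "rep_iso q V W"
  shows "rep_iso q (dual q V) (dual q W)"
proof -
  obtain T S where T: "T \<in> rep_hom q V W" "S \<in> rep_hom q W V" "S * T = 1\<^sub>m (fst V)" "T * S = 1\<^sub>m (fst W)"
    using assms(3) unfolding rep_iso_def by blast
  have c: "T \<in> carrier_mat (fst W) (fst V)" "S \<in> carrier_mat (fst V) (fst W)"
    using T(1,2) by (auto simp: rep_hom_iff V W)
  have "transpose_mat T * transpose_mat S = 1\<^sub>m (fst V)" "transpose_mat S * transpose_mat T = 1\<^sub>m (fst W)"
    using c T(3,4) by (simp_all flip: transpose_mult)
  then show ?thesis
    unfolding rep_iso_def using rep_hom_dual[OF V W T(1)] rep_hom_dual[OF W V T(2)] by (auto simp: dual V W)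
qed

lemma rep_ses_dual:
  assumes reps: "U \<in> uq_reps q" "W \<in> uq_reps q" "V \<in> uq_reps q" and ses: "rep_ses q U W V"
  shows "rep_ses q (dual q V) (dual q W) (dual q U)"
proof -
  obtain f g r s where *: "split_exact (fst U) (fst W) (fst V) f g r s" "f \<in> rep_hom q U W" "g \<in> rep_hom q W V"
    using rep_sesE[OF reps ses] by blast
  have c: "f \<in> carrier_mat (fst W) (fst U)" "g \<in> carrier_mat (fst V) (fst W)"
    "r \<in> carrier_mat (fst U) (fst W)" "s \<in> carrier_mat (fst W) (fst V)"
    and e: "r * f = 1\<^sub>m (fst U)" "g * s = 1\<^sub>m (fst V)" "g * f = 0\<^sub>m (fst V) (fst U)" "f * r + s * g = 1\<^sub>m (fst W)"
    using *(1) by (auto simp: split_exact_def)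
  have "transpose_mat f * transpose_mat r = 1\<^sub>m (fst U)" for x :: nat
    using e(1) c by (simp flip: transpose_mult)
  moreover have "transpose_mat s * transpose_mat g = 1\<^sub>m (fst V)" using e(2) c by (simp flip: transpose_mult)
  moreover have "transpose_mat f * transpose_mat g = 0\<^sub>m (fst U) (fst V)"
    using e(3) c by (simp flip: transpose_mult)
  moreover have "transpose_mat g * transpose_mat s + transpose_mat r * transpose_mat f = 1\<^sub>m (fst W)"
  proof -
    have "transpose_mat g * transpose_mat s + transpose_mat r * transpose_mat f
        = transpose_mat (s * g) + transpose_mat (f * r)"
      using c by (simp add: transpose_mult[of s "fst W" "fst V"] transpose_mult[of f "fst W" "fst U"])
    also have "\<dots> = transpose_mat (f * r + s * g)"
      using c by (subst comm_add_mat[of _ "fst W" "fst W"]) (auto simp: transpose_add[of _ "fst W" "fst W"])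
    finally show ?thesis by (simp add: e(4))
  qed
  ultimately have "split_exact (fst V) (fst W) (fst U) (transpose_mat g) (transpose_mat f) (transpose_mat s) (transpose_mat r)"
    using c by (simp add: split_exact_def)
  then show ?thesis
    using rep_hom_dual[OF reps(1,2) *(2)] rep_hom_dual[OF reps(2,3) *(3)]
    by (intro rep_sesI) (simp_all add: dual reps)
qed

end

text \<open>The permutation matrix that sends \<open>e\<^sub>a \<otimes> e\<^sub>c\<close> to
  \<open>e\<^sub>c \<otimes> e\<^sub>a\<close>.\<close>

definition tensor_flip :: "nat \<Rightarrow> nat \<Rightarrow> complex mat" where
  "tensor_flip m n = mat (n * m) (m * n) (\<lambda>(i, j). if i div m = j mod n \<and> i mod m = j div n then 1 else 0)"

lemma tensor_flip_carrier [simp]: "tensor_flip m n \<in> carrier_mat (n * m) (m * n)"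
  by (simp add: tensor_flip_def)

lemma tensor_flip_kron:
  assumes A: "A \<in> carrier_mat m m'" and B: "B \<in> carrier_mat n n'"
  shows "tensor_flip m n * kron A B = kron B A * tensor_flip m' n'"
proof (rule eq_matI)
  fix i l assume "i < dim_row (kron B A * tensor_flip m' n')" "l < dim_col (kron B A * tensor_flip m' n')"
  then have il: "i < n * m" "l < m' * n'" using assms by (auto simp: kron_def tensor_flip_def)
  note b = div_mod_bounds[OF il(1)] div_mod_bounds[OF il(2)]
  have "(tensor_flip m n * kron A B) $$ (i, l) = (\<Sum>j = 0..<m * n. tensor_flip m n $$ (i, j) * kron A B $$ (j, l))"
    using assms il by (simp add: scalar_prod_def kron_def tensor_flip_def)
  also have "\<dots> = (\<Sum>j = 0..<m * n. (if i div m = j mod n \<and> i mod m = j div n then 1 else 0)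
      * (A $$ (j div n, l div n') * B $$ (j mod n, l mod n')))"
    using assms il by (intro sum.cong) (simp_all add: kron_index tensor_flip_def)
  also have "\<dots> = (\<Sum>a = 0..<m. \<Sum>c = 0..<n. (if i div m = c \<and> i mod m = a then 1 else 0)
      * (A $$ (a, l div n') * B $$ (c, l mod n')))"
    by (rule sum_div_mod)
  also have "\<dots> = (\<Sum>a = 0..<m. if i mod m = a then A $$ (a, l div n') * B $$ (i div m, l mod n') else 0)"
    using b by (intro sum.cong refl) (auto simp: if_distrib[of "\<lambda>x. x * _"] cong: if_cong)
  also have "\<dots> = A $$ (i mod m, l div n') * B $$ (i div m, l mod n')"
    using b by simp
  finally have 1: "(tensor_flip m n * kron A B) $$ (i, l) = A $$ (i mod m, l div n') * B $$ (i div m, l mod n')" .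
  have "(kron B A * tensor_flip m' n') $$ (i, l) = (\<Sum>j = 0..<n' * m'. kron B A $$ (i, j) * tensor_flip m' n' $$ (j, l))"
    using assms il by (simp add: scalar_prod_def kron_def tensor_flip_def)
  also have "\<dots> = (\<Sum>j = 0..<n' * m'. (B $$ (i div m, j div m') * A $$ (i mod m, j mod m'))
      * (if j div m' = l mod n' \<and> j mod m' = l div n' then 1 else 0))"
    using assms il by (intro sum.cong) (simp_all add: kron_index tensor_flip_def)
  also have "\<dots> = (\<Sum>c = 0..<n'. \<Sum>a = 0..<m'. (B $$ (i div m, c) * A $$ (i mod m, a))
      * (if c = l mod n' \<and> a = l div n' then 1 else 0))"
    by (rule sum_div_mod)
  also have "\<dots> = (\<Sum>c = 0..<n'. if c = l mod n' then B $$ (i div m, c) * A $$ (i mod m, l div n') else 0)"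
    using b by (intro sum.cong refl) (auto simp: if_distrib[of "\<lambda>x. _ * x"] cong: if_cong)
  also have "\<dots> = B $$ (i div m, l mod n') * A $$ (i mod m, l div n')"
    using b by simp
  finally show "(tensor_flip m n * kron A B) $$ (i, l) = (kron B A * tensor_flip m' n') $$ (i, l)"
    using 1 by (simp add: mult.commute)
qed (use assms in \<open>auto simp: kron_def tensor_flip_def\<close>)

lemma tensor_flip_inverse: "tensor_flip n m * tensor_flip m n = 1\<^sub>m (m * n)"
proof (rule eq_matI)
  fix i l assume "i < dim_row (1\<^sub>m (m * n) :: complex mat)" "l < dim_col (1\<^sub>m (m * n) :: complex mat)"
  then have il: "i < m * n" "l < m * n" by auto
  note b = div_mod_bounds[OF il(1)] div_mod_bounds[OF il(2)]
  have "(tensor_flip n m * tensor_flip m n) $$ (i, l) = (\<Sum>j = 0..<n * m. tensor_flip n m $$ (i, j) * tensor_flip m n $$ (j, l))"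
    using il by (simp add: scalar_prod_def tensor_flip_def)
  also have "\<dots> = (\<Sum>j = 0..<n * m. (if i div n = j mod m \<and> i mod n = j div m then 1 else 0)
      * (if j div m = l mod n \<and> j mod m = l div n then 1 else 0))"
    using il by (intro sum.cong) (simp_all add: tensor_flip_def)
  also have "\<dots> = (\<Sum>c = 0..<n. \<Sum>a = 0..<m. (if i div n = a \<and> i mod n = c then 1 else 0)
      * (if c = l mod n \<and> a = l div n then 1 else 0))"
    by (rule sum_div_mod)
  also have "\<dots> = (\<Sum>c = 0..<n. if c = i mod n then (if i mod n = l mod n \<and> i div n = l div n then 1 else 0) else 0)"
    using b by (intro sum.cong refl) (auto simp: if_distrib[of "\<lambda>x. x * _"] cong: if_cong)
  also have "\<dots> = (if i mod n = l mod n \<and> i div n = l div n then 1 else 0)"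
    using b by simp
  also have "\<dots> = 1\<^sub>m (m * n) $$ (i, l)"
    using il by (metis div_mult_mod_eq index_one_mat(1))
  finally show "(tensor_flip n m * tensor_flip m n) $$ (i, l) = 1\<^sub>m (m * n) $$ (i, l)" .
qed (auto simp: tensor_flip_def)

lemma tensor_flip_transpose_sum:
  assumes c: "A \<in> carrier_mat m m" "A' \<in> carrier_mat m m" "B \<in> carrier_mat n n" "B' \<in> carrier_mat n n"
  shows "tensor_flip m n * transpose_mat (kron A B + kron A' B')
    = (kron (transpose_mat B') (transpose_mat A') + kron (transpose_mat B) (transpose_mat A)) * tensor_flip m n"
proof -
  have k: "kron X Y \<in> carrier_mat (m * n) (m * n)" "kron Y X \<in> carrier_mat (n * m) (n * m)"
    if "X \<in> carrier_mat m m" "Y \<in> carrier_mat n n" for X Y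
    using that by auto
  have t: "transpose_mat X \<in> carrier_mat p p" if "X \<in> carrier_mat p p" for X :: "complex mat" and p
    using that by auto
  have "transpose_mat (kron A B + kron A' B') = kron (transpose_mat A) (transpose_mat B) + kron (transpose_mat A') (transpose_mat B')"
    using transpose_add[OF k(1)[OF c(1,3)] k(1)[OF c(2,4)]] by (simp add: kron_transpose)
  then have "tensor_flip m n * transpose_mat (kron A B + kron A' B')
      = tensor_flip m n * kron (transpose_mat A) (transpose_mat B) + tensor_flip m n * kron (transpose_mat A') (transpose_mat B')"
    using mult_add_distrib_mat[OF tensor_flip_carrier[of m n] k(1)[OF t[OF c(1)] t[OF c(3)]] k(1)[OF t[OF c(2)] t[OF c(4)]]]
    by simp
  also have "\<dots> = kron (transpose_mat B) (transpose_mat A) * tensor_flip m n + kron (transpose_mat B') (transpose_mat A') * tensor_flip m n"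
    using tensor_flip_kron[OF t[OF c(1)] t[OF c(3)]] tensor_flip_kron[OF t[OF c(2)] t[OF c(4)]] by simp
  also have "\<dots> = (kron (transpose_mat B) (transpose_mat A) + kron (transpose_mat B') (transpose_mat A')) * tensor_flip m n"
    by (rule add_mult_distrib_mat[OF k(2)[OF t[OF c(1)] t[OF c(3)]] k(2)[OF t[OF c(2)] t[OF c(4)]] tensor_flip_carrier, symmetric])
  also have "kron (transpose_mat B) (transpose_mat A) + kron (transpose_mat B') (transpose_mat A')
      = kron (transpose_mat B') (transpose_mat A') + kron (transpose_mat B) (transpose_mat A)"
    by (rule comm_add_mat[OF k(2)[OF t[OF c(1)] t[OF c(3)]] k(2)[OF t[OF c(2)] t[OF c(4)]]])
  finally show ?thesis .
qed

text \<open>\<open>anti\<close> reverses the coproduct and the flip exchanges the factors. For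
  instance \<Delta>(X_0^+ K_1) = X_0^+ K_1 \<otimes> K_0 K_1 + K_1 \<otimes> X_0^+ K_1, and K_0 K_1
  = 1 makes this the flip of the image of \<Delta>(X_1^+) under \<open>anti\<close> in both
  factors.\<close>

lemma dual_tensor:
  assumes q: "generic_parameter q" and V: "V \<in> uq_reps q" and W: "W \<in> uq_reps q"
  shows "rep_iso q (dual q (rep_tensor q V W)) (rep_tensor q (dual q W) (dual q V))"
proof -
  let ?m = "fst V" and ?n = "fst W"
  note VW = rep_tensor_in_reps[OF V W q] and DD = rep_tensor_in_reps[OF dual(1)[OF q W] dual(1)[OF q V] q]
  note c = act_gen_carrier[OF V] act_gen_carrier[OF W]
  define g h where "g = (\<lambda>x. act q V (gen x))" and "h = (\<lambda>x. act q W (gen x))"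
  have gc: "g x \<in> carrier_mat ?m ?m" and hc: "h x \<in> carrier_mat ?n ?n" for x
    using c by (simp_all add: g_def h_def)
  have gg: "g x * g y \<in> carrier_mat ?m ?m" and hh: "h x * h y \<in> carrier_mat ?n ?n" for x y
    using gc hc by (auto intro: mult_carrier_mat)
  have inv: "g (K N0) * g (K N1) = 1\<^sub>m ?m" "g (K N1) * g (K N0) = 1\<^sub>m ?m" "g (KInv N0) = g (K N1)" "g (KInv N1) = g (K N0)"
    "h (K N0) * h (K N1) = 1\<^sub>m ?n" "h (K N1) * h (K N0) = 1\<^sub>m ?n" "h (KInv N0) = h (K N1)" "h (KInv N1) = h (K N0)"
    using rep_K_inverse[OF V] rep_K_inverse[OF W] by (simp_all add: g_def h_def)
  have km: "kron A B * kron A' B' = kron (A * A') (B * B')"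
    if "A \<in> carrier_mat ?m ?m" "A' \<in> carrier_mat ?m ?m" "B \<in> carrier_mat ?n ?n" "B' \<in> carrier_mat ?n ?n" for A A' B B'
    using that by (rule kron_mult)
  have dist: "(kron A B + kron A' B') * kron P R = kron (A * P) (B * R) + kron (A' * P) (B' * R)"
    "kron P R * (kron A B + kron A' B') = kron (P * A) (R * B) + kron (P * A') (R * B')"
    if "A \<in> carrier_mat ?m ?m" "A' \<in> carrier_mat ?m ?m" "B \<in> carrier_mat ?n ?n" "B' \<in> carrier_mat ?n ?n"
      "P \<in> carrier_mat ?m ?m" "R \<in> carrier_mat ?n ?n" for A A' B B' P R
    using that
    by (simp_all add: add_mult_distrib_mat[of _ "?m * ?n" "?m * ?n" _ _ "?m * ?n"]
        mult_add_distrib_mat[of _ "?m * ?n" "?m * ?n" _ "?m * ?n"] km)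
  have single: "tensor_flip ?m ?n * transpose_mat (kron A B) = kron (transpose_mat B) (transpose_mat A) * tensor_flip ?m ?n"
    if "A \<in> carrier_mat ?m ?m" "B \<in> carrier_mat ?n ?n" for A B
    using that by (simp add: kron_transpose tensor_flip_kron[of _ ?m ?m _ ?n ?n])
  note one = left_mult_one_mat[of _ ?m ?m] right_mult_one_mat[of _ ?m ?m] left_mult_one_mat[of _ ?n ?n] right_mult_one_mat[of _ ?n ?n]
  show ?thesis
  proof (rule rep_isoI[OF dual(1)[OF q VW] DD, where T = "tensor_flip ?m ?n" and S = "tensor_flip ?n ?m"])
    fix x
    let ?L = "\<lambda>x. transpose_mat (anti (tensor_gens ?m ?n g h) x)"
    let ?R = "tensor_gens ?n ?m (\<lambda>x. transpose_mat (anti h x)) (\<lambda>x. transpose_mat (anti g x))"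
    have "tensor_flip ?m ?n * ?L x = ?R x * tensor_flip ?m ?n"
    proof (cases x)
      case (XPlus i)
      have "?L (XPlus N1) = transpose_mat (kron (g (XPlus N0) * g (K N1)) (1\<^sub>m ?n) + kron (g (K N1)) (h (XPlus N0) * h (K N1)))"
        "?L (XPlus N0) = transpose_mat (kron (g (K N0) * g (XPlus N1)) (1\<^sub>m ?n) + kron (g (K N0)) (h (K N0) * h (XPlus N1)))"
        by (simp_all add: dist gc hc inv one)
      then show ?thesis
        using XPlus by (cases i) (simp_all add: tensor_flip_transpose_sum gc hc gg hh del: transpose_add)
    next
      case (XMinus i)
      have "?L (XMinus N1) = transpose_mat (kron (g (K N0) * g (XMinus N0)) (h (K N0)) + kron (1\<^sub>m ?m) (h (K N0) * h (XMinus N0)))"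
        "?L (XMinus N0) = transpose_mat (kron (g (XMinus N1) * g (K N1)) (h (K N1)) + kron (1\<^sub>m ?m) (h (XMinus N1) * h (K N1)))"
        by (simp_all add: dist gc hc inv one)
      then show ?thesis
        using XMinus by (cases i) (simp_all add: tensor_flip_transpose_sum gc hc gg hh inv del: transpose_add)
    qed (simp_all add: single gc hc)
    then show "tensor_flip ?m ?n * act q (dual q (rep_tensor q V W)) (gen x)
        = act q (rep_tensor q (dual q W) (dual q V)) (gen x) * tensor_flip ?m ?n"
      by (simp add: g_def h_def dual[OF q VW] act_rep_tensor[OF V W q] act_rep_tensor[OF dual(1)[OF q W] dual(1)[OF q V] q] dual[OF q V] dual[OF q W])
  qed (simp_all add: dual[OF q VW] dual[OF q V] dual[OF q W] tensor_flip_inverse)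
qed

section \<open>Cyclic submodules generated by a highest weight vector\<close>

context loop_datum
begin

interpretation flip: loop_datum "1 / q" ki k xm x0 y1 y0 by (rule flip_datum)

text \<open>The analogue of \<open>phi\<close> for the mirrored datum, that is, Drinfeld's series
  psi^- over 1/q - q. In particular psi_0 = \<open>phi 0 + phim 0\<close>.\<close>

definition phim :: "nat \<Rightarrow> 'a" where
  "phim m = (if m = 0 then (1 / (1 / q - q)) *\<^sub>C ki else psi (- int m))"

theorem xp_phim:
  "xp l * phim (Suc m) = q\<^sup>2 *\<^sub>C (phim (Suc m) * xp l + xp (l - 1) * phim m) - phim m * xp (l - 1)"
proof -
  have "flip.phi m = phim m" for m
    using flip_psi[of m] by (cases "m = 0") (simp_all add: flip.phi_def phim_def)
  moreover have "- 1 - (- 1 - l + 1) = l - 1" by simp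
  ultimately show ?thesis
    using flip.xp_phi[of "- 1 - l" m] by (simp add: flip_xp power_divide)
qed

end

lemma app_weight_shift:
  fixes k :: op
  assumes "k * X = c *\<^sub>C (X * k)" "app k u = (\<lambda>i. d * u i)"
  shows "app k (app X u) = (\<lambda>i. (c * d) * app X u i)"
proof -
  have "app (k * X) u = app (c *\<^sub>C (X * k)) u" using assms(1) by simp
  then show ?thesis by (simp add: op_rep_eq assms(2) app_scale mult.assoc)
qed

lemma app_inverse_weight:
  fixes k ki :: op
  assumes "ki * k = 1" "app k u = (\<lambda>i. d * u i)" "d \<noteq> 0"
  shows "app ki u = (\<lambda>i. (1 / d) * u i)"
proof
  fix i
  have "app (ki * k) u i = u i" by (simp add: assms(1) one_op.rep_eq)
  then have "d * app ki u i = u i" by (simp add: times_op.rep_eq assms(2) app_scale)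
  then show "app ki u i = (1 / d) * u i" using assms(3) by (simp add: field_simps)
qed

text \<open>Vectors of the two modules are treated in pairs, since the submodule of the direct sum
  generated by a pair of highest weight vectors will turn out to be the graph of an isomorphism.\<close>

locale loop_pair = V: loop_datum q k ki x0 xm y0 y1 + V': loop_datum q k' ki' x0' xm' y0' y1'
  for q and k ki x0 xm y0 y1 k' ki' x0' xm' y0' y1' :: op +
  fixes N :: int and v v' :: "nat \<Rightarrow> complex"
  assumes v_weight: "app k v = (\<lambda>i. q powi N * v i)" and v'_weight: "app k' v' = (\<lambda>i. q powi N * v' i)"
    and v_highest: "\<And>l. app (V.xp l) v = (\<lambda>i. 0)" and v'_highest: "\<And>l. app (V'.xp l) v' = (\<lambda>i. 0)"
begin

text \<open>Weight-homogeneous elements of the generated submodule. Only lowering operators and the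
  psi_s are built in, so that the top weight space is visible from the construction; stability under
  raising operators is then a theorem, \<open>hom_part_xp\<close>, in the manner of a triangular
  decomposition.\<close>

inductive hom_part :: "int \<Rightarrow> (nat \<Rightarrow> complex) \<Rightarrow> (nat \<Rightarrow> complex) \<Rightarrow> bool" where
  zero: "hom_part m (\<lambda>i. 0) (\<lambda>i. 0)"
| base: "hom_part N v v'"
| add: "hom_part m u u' \<Longrightarrow> hom_part m z z' \<Longrightarrow> hom_part m (\<lambda>i. u i + z i) (\<lambda>i. u' i + z' i)"
| scale: "hom_part m u u' \<Longrightarrow> hom_part m (\<lambda>i. c * u i) (\<lambda>i. c * u' i)"
| lower: "hom_part m u u' \<Longrightarrow> hom_part (m - 2) (app (V.ym j) u) (app (V'.ym j) u')"
| psi: "hom_part m u u' \<Longrightarrow> hom_part m (app (V.psi s) u) (app (V'.psi s) u')"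

lemma hom_part_weight:
  "hom_part m u u' \<Longrightarrow> app k u = (\<lambda>i. q powi m * u i) \<and> app k' u' = (\<lambda>i. q powi m * u' i)"
proof (induction rule: hom_part.induct)
  case (lower m u u' j)
  have p: "(1 / q\<^sup>2) * q powi m = q powi (m - 2)" by (simp add: power_int_diff)
  show ?case
    using app_weight_shift[OF V.k_ym, of u "q powi m" j] app_weight_shift[OF V'.k_ym, of u' "q powi m" j] lower.IH
    by (simp only: p simp_thms)
next
  case (psi m u u' s)
  have "k * V.psi s = 1 *\<^sub>C (V.psi s * k)" "k' * V'.psi s = 1 *\<^sub>C (V'.psi s * k')"
    using V.k_psi V'.k_psi by simp_all
  from app_weight_shift[OF this(1), of u "q powi m"] app_weight_shift[OF this(2), of u' "q powi m"]
  show ?case using psi.IH by simp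
qed (auto simp: v_weight v'_weight app_add app_scale algebra_simps)

lemma hom_part_diff:
  assumes "hom_part m u u'" "hom_part m z z'"
  shows "hom_part m (\<lambda>i. u i - z i) (\<lambda>i. u' i - z' i)"
  using hom_part.add[OF assms(1) hom_part.scale[OF assms(2), of "- 1"]] by simp

lemma hom_part_k:
  assumes "hom_part m u u'"
  shows "hom_part m (app k u) (app k' u')" "hom_part m (app ki u) (app ki' u')"
proof -
  have w: "app k u = (\<lambda>i. q powi m * u i)" "app k' u' = (\<lambda>i. q powi m * u' i)"
    using hom_part_weight[OF assms] by auto
  show "hom_part m (app k u) (app k' u')" unfolding w by (rule hom_part.scale[OF assms])
  have "app ki u = (\<lambda>i. (1 / q powi m) * u i)" "app ki' u' = (\<lambda>i. (1 / q powi m) * u' i)"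
    by (rule app_inverse_weight[OF V.ki_k w(1)] app_inverse_weight[OF V'.ki_k w(2)], simp)+
  then show "hom_part m (app ki u) (app ki' u')" using hom_part.scale[OF assms, of "1 / q powi m"] by simp
qed

lemma hom_part_phi:
  assumes "hom_part m u u'"
  shows "hom_part m (app (V.phi a) u) (app (V'.phi a) u')"
    and "hom_part m (app (V.phim a) u) (app (V'.phim a) u')"
proof -
  show "hom_part m (app (V.phi a) u) (app (V'.phi a) u')"
  proof (cases "a = 0")
    case True
    then show ?thesis
      using hom_part.scale[OF hom_part_k(1)[OF assms], of "1 / (q - 1 / q)"]
      by (simp add: V.phi_def V'.phi_def scaleC_op.rep_eq)
  next
    case False
    then show ?thesis
      using hom_part.psi[OF assms, of "int a"] by (simp add: V.phi_def V'.phi_def)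
  qed
  show "hom_part m (app (V.phim a) u) (app (V'.phim a) u')"
  proof (cases "a = 0")
    case True
    then show ?thesis
      using hom_part.scale[OF hom_part_k(2)[OF assms], of "1 / (1 / q - q)"]
      by (simp add: V.phim_def V'.phim_def scaleC_op.rep_eq)
  next
    case False
    then show ?thesis
      using hom_part.psi[OF assms, of "- int a"] by (simp add: V.phim_def V'.phim_def)
  qed
qed

text \<open>Raising operators move past \<open>psi\<close> by the exchange relations, at the cost of a change of the loop index.\<close>

lemma hom_part_xp:
  "hom_part m u u' \<Longrightarrow> hom_part (m + 2) (app (V.xp l) u) (app (V'.xp l) u')"
proof (induction arbitrary: l rule: hom_part.induct)
  case base
  then show ?case by (simp add: v_highest v'_highest hom_part.zero)
next
  case (lower m u u' j)
  have "app (V.xp l) (app (V.ym j) u) = (\<lambda>i. app (V.ym j) (app (V.xp l) u) i + app (V.psi (l + j)) u i)"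
    "app (V'.xp l) (app (V'.ym j) u') = (\<lambda>i. app (V'.ym j) (app (V'.xp l) u') i + app (V'.psi (l + j)) u' i)"
    using arg_cong[OF V.xp_ym_psi[of l j], of "\<lambda>X. app X u"] arg_cong[OF V'.xp_ym_psi[of l j], of "\<lambda>X. app X u'"]
    by (simp_all add: op_rep_eq)
  moreover have "hom_part m (app (V.ym j) (app (V.xp l) u)) (app (V'.ym j) (app (V'.xp l) u'))"
    using hom_part.lower[OF lower.IH[of l], of j] by simp
  ultimately show ?case using hom_part.add hom_part.psi[OF lower.hyps] by simp
next
  case (psi m u u' s)
  note w = hom_part_weight[OF psi.hyps]
  \<comment> \<open>The index l stays arbitrary in the induction, since each exchange replaces it by
    l + 1 while lowering the index of \<open>phi\<close>.\<close>
  have plus: "hom_part (m + 2) (app (V.xp l) (app (V.phi a) u)) (app (V'.xp l) (app (V'.phi a) u'))" for a l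
  proof (induction a arbitrary: l)
    case 0
    define c where "c = (1 / (q - 1 / q)) * q powi m"
    have "app (V.phi 0) u = (\<lambda>i. c * u i)" "app (V'.phi 0) u' = (\<lambda>i. c * u' i)"
      using w by (simp_all add: V.phi_def V'.phi_def op_rep_eq c_def)
    then show ?case using hom_part.scale[OF psi.IH[of l], of c] by (simp only: app_scale)
  next
    case (Suc a)
    have eq: "app (V.xp l) (app (V.phi (Suc a)) u) = (\<lambda>i. (1 / q\<^sup>2) * (app (V.phi (Suc a)) (app (V.xp l) u) i
          + app (V.xp (l + 1)) (app (V.phi a) u) i) - app (V.phi a) (app (V.xp (l + 1)) u) i)"
      "app (V'.xp l) (app (V'.phi (Suc a)) u') = (\<lambda>i. (1 / q\<^sup>2) * (app (V'.phi (Suc a)) (app (V'.xp l) u') i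
          + app (V'.xp (l + 1)) (app (V'.phi a) u') i) - app (V'.phi a) (app (V'.xp (l + 1)) u') i)"
      using arg_cong[OF V.xp_phi[of l a], of "\<lambda>X. app X u"] arg_cong[OF V'.xp_phi[of l a], of "\<lambda>X. app X u'"]
      by (simp_all add: op_rep_eq)
    show ?case unfolding eq
      by (intro hom_part_diff hom_part.scale hom_part.add hom_part_phi Suc.IH psi.IH)
  qed
  have minus: "hom_part (m + 2) (app (V.xp l) (app (V.phim a) u)) (app (V'.xp l) (app (V'.phim a) u'))" for a l
  proof (induction a arbitrary: l)
    case 0
    define c where "c = (1 / (1 / q - q)) * (1 / q powi m)"
    have "app ki u = (\<lambda>i. (1 / q powi m) * u i)" "app ki' u' = (\<lambda>i. (1 / q powi m) * u' i)"
      by (rule app_inverse_weight[OF V.ki_k conjunct1[OF w]] app_inverse_weight[OF V'.ki_k conjunct2[OF w]], simp)+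
    then have "app (V.phim 0) u = (\<lambda>i. c * u i)" "app (V'.phim 0) u' = (\<lambda>i. c * u' i)"
      by (simp_all add: V.phim_def V'.phim_def op_rep_eq c_def mult.commute)
    then show ?case using hom_part.scale[OF psi.IH[of l], of c] by (simp only: app_scale)
  next
    case (Suc a)
    have eq: "app (V.xp l) (app (V.phim (Suc a)) u) = (\<lambda>i. q\<^sup>2 * (app (V.phim (Suc a)) (app (V.xp l) u) i
          + app (V.xp (l - 1)) (app (V.phim a) u) i) - app (V.phim a) (app (V.xp (l - 1)) u) i)"
      "app (V'.xp l) (app (V'.phim (Suc a)) u') = (\<lambda>i. q\<^sup>2 * (app (V'.phim (Suc a)) (app (V'.xp l) u') i
          + app (V'.xp (l - 1)) (app (V'.phim a) u') i) - app (V'.phim a) (app (V'.xp (l - 1)) u') i)"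
      using arg_cong[OF V.xp_phim[of l a], of "\<lambda>X. app X u"] arg_cong[OF V'.xp_phim[of l a], of "\<lambda>X. app X u'"]
      by (simp_all add: op_rep_eq)
    show ?case unfolding eq
      by (intro hom_part_diff hom_part.scale hom_part.add hom_part_phi Suc.IH psi.IH)
  qed
  show ?case
  proof (cases s rule: int_cases3)
    case (pos a)
    then show ?thesis using plus[of l a]
      by (simp add: V.phi_def V'.phi_def)
  next
    case (neg a)
    then show ?thesis using minus[of l a]
      by (simp add: V.phim_def V'.phim_def)
  next
    case zero
    \<comment> \<open>psi_0 is \<open>phi 0 + phim 0\<close>, so index 0 is the sum of the two base
      cases.\<close>
    define d where "d = 1 / (q - 1 / q)"
    have d': "1 / (1 / q - q) = - d" unfolding d_def by (metis minus_diff_eq minus_divide_right)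
    have "app (V.psi 0) u = (\<lambda>i. app (V.phi 0) u i + app (V.phim 0) u i)"
      "app (V'.psi 0) u' = (\<lambda>i. app (V'.phi 0) u' i + app (V'.phim 0) u' i)"
      by (simp_all add: V.psi_0 V'.psi_0 V.psi0_def V'.psi0_def V.phi_def V'.phi_def V.phim_def V'.phim_def
          op_rep_eq d' flip: d_def) (simp_all add: algebra_simps)
    then show ?thesis using hom_part.add[OF plus[of l 0] minus[of l 0]] zero by (simp add: app_add)
  qed
qed (auto simp: app_add app_scale intro: hom_part.intros)

text \<open>One polynomial in the psi_s, evaluated in both modules at the same time.\<close>

inductive psi_poly :: "op \<Rightarrow> op \<Rightarrow> bool" where
  one: "psi_poly 1 1"
| add: "psi_poly P P' \<Longrightarrow> psi_poly R R' \<Longrightarrow> psi_poly (P + R) (P' + R')"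
| scale: "psi_poly P P' \<Longrightarrow> psi_poly (c *\<^sub>C P) (c *\<^sub>C P')"
| psi: "psi_poly P P' \<Longrightarrow> psi_poly (V.psi s * P) (V'.psi s * P')"

lemma psi_poly_psi: "psi_poly P P' \<Longrightarrow> P * V.psi s = V.psi s * P \<and> P' * V'.psi s = V'.psi s * P'"
proof (induction rule: psi_poly.induct)
  case (psi P P' t)
  have "V.psi t * P * V.psi s = V.psi t * V.psi s * P" "V'.psi t * P' * V'.psi s = V'.psi t * V'.psi s * P'"
    using psi.IH by (simp_all add: mult.assoc)
  moreover have "V.psi t * V.psi s * P = V.psi s * (V.psi t * P)" "V'.psi t * V'.psi s * P' = V'.psi s * (V'.psi t * P')"
    by (simp_all only: V.psi_psi[of t s] V'.psi_psi[of t s] mult.assoc)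
  ultimately show ?case by simp
qed (simp_all add: distrib_left distrib_right)

lemma psi_poly_commute: "psi_poly P P' \<Longrightarrow> psi_poly R R' \<Longrightarrow> P * R = R * P"
proof (induction rule: psi_poly.induct)
  case (psi P P' t)
  then have "V.psi t * P * R = V.psi t * R * P" by (simp add: mult.assoc)
  also have "V.psi t * R = R * V.psi t" using psi_poly_psi[OF psi.prems, of t] by simp
  finally show ?case by (simp add: mult.assoc)
qed (simp_all add: distrib_left distrib_right)

text \<open>Each lowering operator drops the weight by 2, so in weight N only \<open>base\<close>,
  \<open>psi\<close> and linear combinations contribute, and these apply the same polynomial to both
  components.\<close>

lemma hom_part_top:
  "hom_part m u u' \<Longrightarrow> m < N \<or> (m = N \<and> (\<exists>P P'. psi_poly P P' \<and> u = app P v \<and> u' = app P' v'))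
    \<or> (u = (\<lambda>i. 0) \<and> u' = (\<lambda>i. 0))"
proof (induction rule: hom_part.induct)
  case base
  have "v = app 1 v" "v' = app 1 v'" by (simp_all add: op_rep_eq)
  then show ?case using psi_poly.one by blast
next
  case (add m u u' z z')
  show ?case
  proof (cases "m = N")
    case True
    have zero: "\<exists>P P'. psi_poly P P' \<and> (\<lambda>i. 0) = app P v \<and> (\<lambda>i. 0) = app P' v'"
      using psi_poly.scale[OF psi_poly.one, of 0]
      by (intro exI[of _ "0 *\<^sub>C 1"]) (simp add: op_rep_eq)
    have "\<exists>P P'. psi_poly P P' \<and> u = app P v \<and> u' = app P' v'" "\<exists>P P'. psi_poly P P' \<and> z = app P v \<and> z' = app P' v'"
      using add.IH True zero by auto
    then obtain P P' R R' where "psi_poly P P'" "u = app P v" "u' = app P' v'" "psi_poly R R'" "z = app R v" "z' = app R' v'"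
      by blast
    then have "psi_poly (P + R) (P' + R')" "(\<lambda>i. u i + z i) = app (P + R) v" "(\<lambda>i. u' i + z' i) = app (P' + R') v'"
      by (auto intro: psi_poly.add simp: op_rep_eq)
    then show ?thesis using True by blast
  next
    case False
    then show ?thesis using add.IH by auto
  qed
next
  case (scale m u u' c)
  then show ?case
  proof (elim disjE)
    assume "m = N \<and> (\<exists>P P'. psi_poly P P' \<and> u = app P v \<and> u' = app P' v')"
    then obtain P P' where "m = N" "psi_poly P P'" "u = app P v" "u' = app P' v'" by blast
    then have "psi_poly (c *\<^sub>C P) (c *\<^sub>C P')" "(\<lambda>i. c * u i) = app (c *\<^sub>C P) v" "(\<lambda>i. c * u' i) = app (c *\<^sub>C P') v'"
      by (auto intro: psi_poly.scale simp: op_rep_eq)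
    then show ?thesis using \<open>m = N\<close> by blast
  qed auto
next
  case (lower m u u' j)
  then show ?case by auto
next
  case (psi m u u' s)
  then show ?case
  proof (elim disjE)
    assume "m = N \<and> (\<exists>P P'. psi_poly P P' \<and> u = app P v \<and> u' = app P' v')"
    then obtain P P' where "m = N" "psi_poly P P'" "u = app P v" "u' = app P' v'" by blast
    then have "psi_poly (V.psi s * P) (V'.psi s * P')" "app (V.psi s) u = app (V.psi s * P) v" "app (V'.psi s) u' = app (V'.psi s * P') v'"
      by (auto intro: psi_poly.psi simp: op_rep_eq)
    then show ?thesis using \<open>m = N\<close> by blast
  qed auto
qed auto

text \<open>A second layer for inhomogeneous sums: the inductions over \<open>hom_part\<close> need
  the weight as an index.\<close>

inductive gen_sub :: "(nat \<Rightarrow> complex) \<Rightarrow> (nat \<Rightarrow> complex) \<Rightarrow> bool" where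
  hom: "hom_part m u u' \<Longrightarrow> gen_sub u u'"
| add: "gen_sub u u' \<Longrightarrow> gen_sub z z' \<Longrightarrow> gen_sub (\<lambda>i. u i + z i) (\<lambda>i. u' i + z' i)"

lemma gen_sub_zero: "gen_sub (\<lambda>i. 0) (\<lambda>i. 0)"
  by (rule gen_sub.hom[OF hom_part.zero])

lemma gen_sub_scale: "gen_sub u u' \<Longrightarrow> gen_sub (\<lambda>i. c * u i) (\<lambda>i. c * u' i)"
proof (induction rule: gen_sub.induct)
  case (hom m u u')
  then show ?case by (blast intro: gen_sub.hom hom_part.scale)
next
  case (add u u' z z')
  then show ?case using gen_sub.add[OF add.IH] by (simp add: distrib_left)
qed

lemma gen_sub_base: "gen_sub v v'"
  by (rule gen_sub.hom[OF hom_part.base])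

lemma gen_sub_closed:
  assumes "\<And>m u u'. hom_part m u u' \<Longrightarrow> \<exists>l. hom_part l (app X u) (app X' u')"
  shows "gen_sub u u' \<Longrightarrow> gen_sub (app X u) (app X' u')"
proof (induction rule: gen_sub.induct)
  case (hom m u u')
  then show ?case using assms gen_sub.hom by blast
next
  case (add u u' z z')
  then show ?case using gen_sub.add[OF add.IH] by (simp only: app_add)
qed

lemma gen_sub_ops:
  assumes "gen_sub u u'"
  shows "gen_sub (app x0 u) (app x0' u')" "gen_sub (app xm u) (app xm' u')"
    "gen_sub (app y0 u) (app y0' u')" "gen_sub (app y1 u) (app y1' u')"
    "gen_sub (app k u) (app k' u')" "gen_sub (app ki u) (app ki' u')"
proof -
  have *: "gen_sub (app X u) (app X' u')" if "\<And>m u u'. hom_part m u u' \<Longrightarrow> hom_part (m + d) (app X u) (app X' u')" for X X' d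
    using gen_sub_closed[OF _ assms] that by blast
  show "gen_sub (app x0 u) (app x0' u')" "gen_sub (app xm u) (app xm' u')"
    using *[OF hom_part_xp, of 0] *[OF hom_part_xp, of "- 1"] by simp_all
  show "gen_sub (app y0 u) (app y0' u')" "gen_sub (app y1 u) (app y1' u')"
    using *[of "- 2" y0 y0'] *[of "- 2" y1 y1'] hom_part.lower[of _ _ _ 0] hom_part.lower[of _ _ _ 1] by simp_all
  show "gen_sub (app k u) (app k' u')" "gen_sub (app ki u) (app ki' u')"
    using *[of 0 k k'] *[of 0 ki ki'] hom_part_k by simp_all
qed

end

section \<open>Irreducible representations are self-dual\<close>

text \<open>Only the six generators are assumed to be transposed into each other. The shift between
  x_i and y_{i+1} comes from \<open>anti\<close>, which sends X_1^+ to X_0^+ K_1 =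
  \<open>y1\<close>.\<close>

locale dual_loop_pair = V: loop_datum q k ki x0 xm y0 y1 + V': loop_datum q k' ki' x0' xm' y0' y1'
  for q and k ki x0 xm y0 y1 k' ki' x0' xm' y0' y1' :: op +
  fixes n :: nat
  assumes tr_k: "op_transpose n k k'" and tr_ki: "op_transpose n ki ki'"
    and tr_x0: "op_transpose n x0 y1'" and tr_y1: "op_transpose n y1 x0'"
    and tr_xm: "op_transpose n xm y0'" and tr_y0: "op_transpose n y0 xm'"
begin

text \<open>Transposition exchanges the roles of \<open>x0\<close> and \<open>y1\<close> and
  reverses products, which reproduces the bracket with its sign. It moves \<open>ki\<close> to the
  right side, and \<open>k\<close> commutes with \<open>h1\<close>.\<close>

lemma tr_h1: "op_transpose n V.h1 V'.h1"
proof -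
  define P' where "P' = x0' * y1' - y1' * x0'"
  have "op_transpose n V.h1 ((1 / (q + 1 / q)) *\<^sub>C (P' * ki'))"
    unfolding V.h1_def P'_def
    by (intro op_transpose_scale op_transpose_mult op_transpose_diff tr_ki tr_x0 tr_y1)
  also have "(1 / (q + 1 / q)) *\<^sub>C (P' * ki') = V'.h1"
  proof -
    have "(1 / (q + 1 / q)) *\<^sub>C (P' * ki') = (k' * V'.h1) * ki'"
      unfolding V'.kh1 P'_def by simp
    also have "\<dots> = V'.h1" unfolding V'.k_h1 by (simp add: mult.assoc)
    finally show ?thesis .
  qed
  finally show ?thesis .
qed

lemma tr_hm: "op_transpose n V.hm V'.hm"
proof -
  define P' where "P' = xm' * y0' - y0' * xm'"
  have "op_transpose n V.hm ((1 / (q + 1 / q)) *\<^sub>C (P' * k'))"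
    unfolding V.hm_def P'_def
    by (intro op_transpose_scale op_transpose_mult op_transpose_diff tr_k tr_xm tr_y0)
  also have "(1 / (q + 1 / q)) *\<^sub>C (P' * k') = V'.hm"
  proof -
    have "ki' * V'.hm = (1 / (q + 1 / q)) *\<^sub>C P'" by (simp add: V'.hm_def P'_def)
    then have "(1 / (q + 1 / q)) *\<^sub>C (P' * k') = (ki' * V'.hm) * k'" by simp
    also have "\<dots> = V'.hm" unfolding V'.comm_ki[OF V'.k_hm] by (simp add: mult.assoc)
    finally show ?thesis .
  qed
  finally show ?thesis .
qed

lemma tr_xp: "op_transpose n (V.xp i) (V'.ym (i + 1))"
proof (induction i rule: int_induct[where k = 0])
  case (step1 i)
  show ?case
    unfolding V.xp_h1[of i, symmetric] V'.ym_h1[of "i + 1", symmetric]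
    by (intro op_transpose_mult op_transpose_diff tr_h1 step1)
next
  case (step2 i)
  have "op_transpose n (V.xp (i - 1)) (V'.ym (i + 1 - 1))"
    unfolding V.xp_hm[of i, symmetric] V'.ym_hm[of "i + 1", symmetric]
    by (intro op_transpose_mult op_transpose_diff tr_hm step2)
  then show ?case by simp
qed (simp add: tr_x0)

lemma tr_ym: "op_transpose n (V.ym j) (V'.xp (j - 1))"
proof (induction j rule: int_induct[where k = 0])
  case (step1 j)
  have "op_transpose n (V.ym (j + 1)) (V'.xp (j - 1 + 1))"
    unfolding V.ym_h1[of j, symmetric] V'.xp_h1[of "j - 1", symmetric]
    by (intro op_transpose_mult op_transpose_diff tr_h1 step1)
  then show ?case by simp
next
  case (step2 j)
  show ?case
    unfolding V.ym_hm[of j, symmetric] V'.xp_hm[of "j - 1", symmetric]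
    by (intro op_transpose_mult op_transpose_diff tr_hm step2)
qed (simp add: tr_y0)

text \<open>The bracket of x_0 with y_s is transposed into the bracket of x_{s-1} with y_1 in the
  dual. The two have the same total index, so Drinfeld's relation identifies the latter as
  psi_s.\<close>

lemma tr_psi: "op_transpose n (V.psi s) (V'.psi s)"
proof -
  have "op_transpose n (V.psi s) (V'.xp (s - 1) * V'.ym (0 + 1) - V'.ym (0 + 1) * V'.xp (s - 1))"
    unfolding V.psi_def by (intro op_transpose_mult op_transpose_diff tr_xp tr_ym)
  also have "V'.xp (s - 1) * V'.ym (0 + 1) - V'.ym (0 + 1) * V'.xp (s - 1) = V'.psi s"
    using V'.xp_ym_psi[of "s - 1" "0 + 1"] by (simp del: V'.ym_1)
  finally show ?thesis .
qed

end

lemma rep_loop_datum: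
  assumes q: "generic_parameter q" and V: "V \<in> uq_reps q" and n: "fst V > 0"
  defines "G \<equiv> \<lambda>x. op_of (fst V) (act q V (gen x))"
  shows "loop_datum q (G (K N1)) (G (K N0)) (G (XPlus N1)) (G (K N0) * G (XMinus N0)) (G (XMinus N1)) (G (XPlus N0) * G (K N1))"
proof -
  have u: "uq_matrices q (fst V) (\<lambda>x. act q V (gen x))" by (rule uq_matrices_act[OF V])
  interpret generic_parameter q by fact
  have "\<exists>M. \<forall>m\<ge>M. \<forall>u. G (K i) * u = q ^ m *\<^sub>C (u * G (K i)) \<longrightarrow> u = 0" for i
    unfolding G_def using u n by (intro type_one_bounded) (simp_all add: uq_matrices_def)
  moreover have "level_zero q G" using u n by (simp add: uq_matrices_def G_def)
  ultimately show ?thesis using level_zero.loop_datum[OF _ q] by blast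
qed

lemma rep_dual_loop_pair:
  assumes q: "generic_parameter q" and V: "V \<in> uq_reps q" and n: "fst V > 0"
  defines "G \<equiv> \<lambda>x. op_of (fst V) (act q V (gen x))" and "H \<equiv> \<lambda>x. op_of (fst V) (act q (dual q V) (gen x))"
  shows "dual_loop_pair q (G (K N1)) (G (K N0)) (G (XPlus N1)) (G (K N0) * G (XMinus N0)) (G (XMinus N1)) (G (XPlus N0) * G (K N1))
    (H (K N1)) (H (K N0)) (H (XPlus N1)) (H (K N0) * H (XMinus N0)) (H (XMinus N1)) (H (XPlus N0) * H (K N1)) (fst V)"
proof -
  note c = act_gen_carrier[OF V] and D = dual[OF q V]
  interpret level_zero q G
    using uq_matrices_act[OF V] n by (simp add: uq_matrices_def G_def)
  have "anti (\<lambda>y. act q V (gen y)) x \<in> carrier_mat (fst V) (fst V)" for x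
    using c by (cases x) (auto split: node.splits intro!: mult_carrier_mat[of _ "fst V" "fst V" _ "fst V"])
  moreover have "op_of (fst V) (anti (\<lambda>y. act q V (gen y)) x) = anti G x" for x
    using c by (cases x) (auto split: node.splits simp: op_of_mult G_def)
  ultimately have tr: "op_transpose (fst V) (anti G x) (H x)" for x
    using op_transposeI[of "anti (\<lambda>y. act q V (gen y)) x" "fst V"] by (simp add: H_def D)
  have D1: "loop_datum q (G (K N1)) (G (K N0)) (G (XPlus N1)) (G (K N0) * G (XMinus N0)) (G (XMinus N1)) (G (XPlus N0) * G (K N1))"
    unfolding G_def by (rule rep_loop_datum[OF q V n])
  have D2: "loop_datum q (H (K N1)) (H (K N0)) (H (XPlus N1)) (H (K N0) * H (XMinus N0)) (H (XMinus N1)) (H (XPlus N0) * H (K N1))"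
    using rep_loop_datum[OF q D(1)] n unfolding H_def D(2) by blast
  show ?thesis
  proof (intro dual_loop_pair.intro dual_loop_pair_axioms.intro D1 D2)
    show "op_transpose (fst V) (G (K N1)) (H (K N1))" "op_transpose (fst V) (G (K N0)) (H (K N0))"
      "op_transpose (fst V) (G (XPlus N0) * G (K N1)) (H (XPlus N1))"
      "op_transpose (fst V) (G (K N0) * G (XMinus N0)) (H (XMinus N1))"
      using tr[of "K N1"] tr[of "K N0"] tr[of "XPlus N1"] tr[of "XMinus N1"] by simp_all
    show "op_transpose (fst V) (G (XPlus N1)) (H (XPlus N0) * H (K N1))"
      using op_transpose_mult[OF tr[of "K N1"] tr[of "XPlus N0"]] by (simp add: K_mult_assoc)
    show "op_transpose (fst V) (G (XMinus N1)) (H (K N0) * H (XMinus N0))"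
      using op_transpose_mult[OF tr[of "XMinus N0"] tr[of "K N0"]] by (simp add: K1_K0 mult.assoc)
  qed
qed

text \<open>\<open>op_of\<close> repeats a matrix on all blocks of length n; sequences supported in
  the first block recover the representation itself.\<close>

definition supp :: "nat \<Rightarrow> (nat \<Rightarrow> complex) \<Rightarrow> bool" where
  "supp n u \<longleftrightarrow> (\<forall>i\<ge>n. u i = 0)"

lemma supp_app:
  assumes "op_transpose n X Y" "supp n u" "n > 0"
  shows "supp n (app X u)" "supp n (app Y u)"
proof -
  have "supp n (app (op_of n A) u)" for A
    unfolding supp_def
  proof (intro allI impI)
    fix i assume "i \<ge> n"
    then have "i div n \<ge> 1" using assms(3) by (simp add: div_greater_zero_iff Suc_le_eq)
    then have "n * (i div n) + j \<ge> n" for j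
      by (metis mult_le_mono2 nat_mult_1_right trans_le_add1)
    then show "app (op_of n A) u i = 0" using assms(2) by (simp add: op_of.rep_eq supp_def)
  qed
  then show "supp n (app X u)" "supp n (app Y u)" using assms(1) by (auto simp: op_transpose_def)
qed

definition bilin :: "nat \<Rightarrow> (nat \<Rightarrow> complex) \<Rightarrow> (nat \<Rightarrow> complex) \<Rightarrow> complex" where
  "bilin n u z = (\<Sum>i = 0..<n. u i * z i)"

lemma bilin_transpose:
  assumes "op_transpose n X Y"
  shows "bilin n (app X u) z = bilin n u (app Y z)"
proof -
  obtain A where A: "A \<in> carrier_mat n n" "X = op_of n A" "Y = op_of n (transpose_mat A)"
    using assms by (auto simp: op_transpose_def)
  have "bilin n (app X u) z = (\<Sum>i = 0..<n. \<Sum>j = 0..<n. A $$ (i, j) * u j * z i)"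
    using A by (simp add: bilin_def app_op_of sum_distrib_right)
  also have "\<dots> = (\<Sum>j = 0..<n. \<Sum>i = 0..<n. A $$ (i, j) * u j * z i)" by (rule sum.swap)
  also have "\<dots> = bilin n u (app Y z)"
    using A by (simp add: bilin_def app_op_of sum_distrib_left algebra_simps)
  finally show ?thesis .
qed

definition inv_subspace :: "complex \<Rightarrow> uq_rep \<Rightarrow> (nat \<Rightarrow> complex) set \<Rightarrow> bool" where
  "inv_subspace q V Y \<longleftrightarrow> (\<lambda>i. 0) \<in> Y \<and> (\<forall>u\<in>Y. supp (fst V) u) \<and> (\<forall>u\<in>Y. \<forall>z\<in>Y. (\<lambda>i. u i + z i) \<in> Y)
     \<and> (\<forall>u\<in>Y. \<forall>c. (\<lambda>i. c * u i) \<in> Y) \<and> (\<forall>u\<in>Y. \<forall>x. app (op_of (fst V) (act q V (gen x))) u \<in> Y)"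

definition irreducible_rep :: "complex \<Rightarrow> uq_rep \<Rightarrow> bool" where
  "irreducible_rep q V \<longleftrightarrow> (\<forall>Y. inv_subspace q V Y \<longrightarrow> Y = {\<lambda>i. 0} \<or> Y = {u. supp (fst V) u})"

lemma uq_gen_all_cases:
  assumes "P (K N0)" "P (K N1)" "P (KInv N0)" "P (KInv N1)" "P (XPlus N0)" "P (XPlus N1)"
    "P (XMinus N0)" "P (XMinus N1)" "P CSqrt" "P CSqrtInv"
  shows "P x"
proof -
  have "P (f i)" if "P (f N0)" "P (f N1)" for f i using that by (cases i) simp_all
  then show ?thesis using assms by (cases x) simp_all
qed

text \<open>K_1 is diagonal and hence its own transpose, so one coordinate vector of maximal weight
  is a highest weight vector both in V and in its dual, and pairs to 1 with itself. Irreducibility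
  of V alone shows that the submodule generated by the pair is the graph of an injective
  map.\<close>

theorem irreducible_rep_self_dual:
  assumes q: "generic_parameter q" and V: "V \<in> uq_reps q" and n: "fst V > 0"
    and K1: "act q V (gen (K N1)) = qdiag q (fst V) w" and irr: "irreducible_rep q V"
  shows "rep_iso q V (dual q V)"
proof -
  interpret generic_parameter q by fact
  define n where "n = fst V"
  define G H where "G = (\<lambda>x. op_of n (act q V (gen x)))" and "H = (\<lambda>x. op_of n (act q (dual q V) (gen x)))"
  have n0: "n > 0" using n by (simp add: n_def)
  note c = act_gen_carrier[OF V, folded n_def] and D = dual[OF q V, folded n_def]
  note cD = act_gen_carrier[OF D(1), unfolded D(2)]
  define k ki x0 xm y0 y1 where "k = G (K N1)" and "ki = G (K N0)" and "x0 = G (XPlus N1)"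
    and "xm = G (K N0) * G (XMinus N0)" and "y0 = G (XMinus N1)" and "y1 = G (XPlus N0) * G (K N1)"
  define k' ki' x0' xm' y0' y1' where "k' = H (K N1)" and "ki' = H (K N0)" and "x0' = H (XPlus N1)"
    and "xm' = H (K N0) * H (XMinus N0)" and "y0' = H (XMinus N1)" and "y1' = H (XPlus N0) * H (K N1)"
  interpret G: level_zero q G
    using uq_matrices_act[OF V] n by (simp add: uq_matrices_def G_def n_def)
  interpret H: level_zero q H
    using uq_matrices_act[OF D(1)] n0 by (simp add: uq_matrices_def H_def D(2))
  interpret dual_loop_pair q k ki x0 xm y0 y1 k' ki' x0' xm' y0' y1' n
    unfolding k_def ki_def x0_def xm_def y0_def y1_def k'_def ki'_def x0'_def xm'_def y0'_def y1'_def G_def H_def n_def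
    by (rule rep_dual_loop_pair[OF q V n])
  define N where "N = Max (w ` {..<n})"
  have wN: "w i \<le> N" if "i < n" for i unfolding N_def using that by (intro Max_ge) auto
  obtain i0 where i0: "i0 < n" "w i0 = N"
    using Max_in[of "w ` {..<n}"] n0 unfolding N_def by fastforce
  define v :: "nat \<Rightarrow> complex" where "v = (\<lambda>i. if i = i0 then 1 else 0)"
  have k_app: "app k u i = q powi w (i mod n) * u i" "app k' u i = q powi w (i mod n) * u i" for u i
  proof -
    have "transpose_mat (qdiag q n w) = qdiag q n w" by (rule eq_matI) (auto simp: qdiag_def)
    then have "k = op_of n (qdiag q n w)" "k' = op_of n (qdiag q n w)"
      using K1 D(3)[of "K N1"] by (simp_all add: k_def k'_def G_def H_def n_def)
    then show "app k u i = q powi w (i mod n) * u i" "app k' u i = q powi w (i mod n) * u i"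
      using n0 by (simp_all add: app_qdiag)
  qed
  have weight_zero: "u i = 0" if "app k u = (\<lambda>i. q powi m * u i) \<or> app k' u = (\<lambda>i. q powi m * u i)" "w (i mod n) \<noteq> m" for u m i
  proof -
    have "q powi w (i mod n) * u i = q powi m * u i" using that(1) k_app by metis
    then show ?thesis using that(2) by (simp add: q_powi_inject)
  qed
  have modn: "i mod n < n" for i using n0 by simp
  have v_w: "app k v = (\<lambda>i. q powi N * v i)" "app k' v = (\<lambda>i. q powi N * v i)"
    using i0 by (auto simp: k_app v_def fun_eq_iff)
  \<comment> \<open>A raised vector would have weight N + 2, above the maximum.\<close>
  have high: "app (V.xp l) v = (\<lambda>i. 0)" "app (V'.xp l) v = (\<lambda>i. 0)" for l
  proof -
    have "q\<^sup>2 * q powi N = q powi (N + 2)" by (simp add: power_int_add mult.commute)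
    then have "app k (app (V.xp l) v) = (\<lambda>i. q powi (N + 2) * app (V.xp l) v i)"
      "app k' (app (V'.xp l) v) = (\<lambda>i. q powi (N + 2) * app (V'.xp l) v i)"
      using app_weight_shift[OF V.k_xp[of l] v_w(1)] app_weight_shift[OF V'.k_xp[of l] v_w(2)] by simp_all
    moreover have "w (i mod n) \<noteq> N + 2" for i using wN[OF modn, of i] by linarith
    ultimately show "app (V.xp l) v = (\<lambda>i. 0)" "app (V'.xp l) v = (\<lambda>i. 0)"
      by (intro ext; blast intro: weight_zero)+
  qed
  interpret loop_pair q k ki x0 xm y0 y1 k' ki' x0' xm' y0' y1' N v v
    by unfold_locales (simp_all add: v_w high)
  have supp_v: "supp n v" using i0 by (simp add: supp_def v_def)
  have hom_supp: "hom_part m u u' \<Longrightarrow> supp n u \<and> supp n u'" for m u u'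
  proof (induction rule: hom_part.induct)
    case (lower m u u' j)
    have "op_transpose n (V.ym j) (V'.xp (j - 1))" "op_transpose n (V.xp (j - 1)) (V'.ym (j - 1 + 1))"
      by (rule tr_ym tr_xp)+
    then show ?case using lower.IH supp_app(1)[OF _ _ n0] supp_app(2)[OF _ _ n0] by fastforce
  next
    case (psi m u u' s)
    then show ?case using supp_app[OF tr_psi _ n0] by blast
  qed (auto simp: supp_v, auto simp: supp_def)
  have sub_supp: "gen_sub u u' \<Longrightarrow> supp n u \<and> supp n u'" for u u'
    by (induction rule: gen_sub.induct) (use hom_supp in blast, auto simp: supp_def)
  have poly_hom: "psi_poly P P' \<Longrightarrow> hom_part N (app P v) (app P' v)" for P P'
  proof (induction rule: psi_poly.induct)
    case one
    then show ?case using hom_part.base by (simp add: op_rep_eq)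
  next
    case (add P P' R R')
    then show ?case using hom_part.add by (simp add: op_rep_eq)
  next
    case (scale P P' c)
    then show ?case using hom_part.scale by (simp add: op_rep_eq)
  next
    case (psi P P' s)
    then show ?case using hom_part.psi by (simp add: op_rep_eq)
  qed
  have poly_zero: "app P v i = 0 \<and> app P' v i = 0" if "psi_poly P P'" "w (i mod n) \<noteq> N" for P P' i
    using weight_zero[OF _ that(2)] hom_part_weight[OF poly_hom[OF that(1)]] by blast
  have top: "gen_sub u u' \<Longrightarrow> \<exists>P P'. psi_poly P P' \<and> (\<forall>i. w (i mod n) = N \<longrightarrow> u i = app P v i \<and> u' i = app P' v i)" for u u'
  proof (induction rule: gen_sub.induct)
    case (hom m u u')
    have zero: "psi_poly (0 *\<^sub>C 1) (0 *\<^sub>C 1)" by (rule psi_poly.scale[OF psi_poly.one])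
    consider "m < N" | P P' where "psi_poly P P'" "u = app P v" "u' = app P' v" | "u = (\<lambda>i. 0)" "u' = (\<lambda>i. 0)"
      using hom_part_top[OF hom] by blast
    then show ?case
    proof cases
      case 1
      have "u i = 0 \<and> u' i = 0" if "w (i mod n) = N" for i
      proof -
        have "w (i mod n) \<noteq> m" using 1 that by simp
        then show ?thesis using weight_zero hom_part_weight[OF hom] by blast
      qed
      then show ?thesis using zero by (intro exI[of _ "0 *\<^sub>C 1"]) (simp add: op_rep_eq)
    next
      case 3
      then show ?thesis using zero by (intro exI[of _ "0 *\<^sub>C 1"]) (simp add: op_rep_eq)
    qed blast
  next
    case (add u u' z z')
    then obtain P P' R R' where "psi_poly P P'" "psi_poly R R'"
      "\<forall>i. w (i mod n) = N \<longrightarrow> u i = app P v i \<and> u' i = app P' v i"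
      "\<forall>i. w (i mod n) = N \<longrightarrow> z i = app R v i \<and> z' i = app R' v i" by blast
    then show ?case
      by (intro exI[of _ "P + R"] exI[of _ "P' + R'"]) (auto intro: psi_poly.add simp: op_rep_eq)
  qed
  have inv_subspaceI: "inv_subspace q V Y"
    if Y: "(\<lambda>i. 0) \<in> Y" "\<And>u. u \<in> Y \<Longrightarrow> supp n u" "\<And>u z. u \<in> Y \<Longrightarrow> z \<in> Y \<Longrightarrow> (\<lambda>i. u i + z i) \<in> Y"
      "\<And>u d. u \<in> Y \<Longrightarrow> (\<lambda>i. d * u i) \<in> Y"
      "\<And>u X. u \<in> Y \<Longrightarrow> X \<in> {x0, xm, y0, y1, k, ki} \<Longrightarrow> app X u \<in> Y" for Y
  proof -
    have "app (G x) u \<in> Y" if u: "u \<in> Y" for x u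
    proof -
      have "G (XMinus N0) = k * xm" "G (XPlus N0) = y1 * ki" "G (XMinus N1) = y0" "G (XPlus N1) = x0" "G (K N0) = ki" "G (K N1) = k"
        by (simp_all add: k_def xm_def y1_def ki_def y0_def x0_def G.K_mult_assoc mult.assoc G.K1_K0)
      then show ?thesis
        using Y(5) u by (induct x rule: uq_gen_all_cases)
          (simp_all add: G.KInv_N0 G.KInv_N1 G.CSqrt G.CSqrtInv op_rep_eq)
    qed
    then show ?thesis using Y(1-4) unfolding inv_subspace_def n_def[symmetric] G_def by blast
  qed
  \<comment> \<open>The projection of the generated submodule to V: a nonzero submodule, hence
    everything.\<close>
  define Y where "Y = {u. \<exists>u'. gen_sub u u'}"
  have "inv_subspace q V Y"
    by (rule inv_subspaceI)
      (auto simp: Y_def dest: sub_supp intro: gen_sub_zero gen_sub.add gen_sub_scale gen_sub_ops)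
  moreover have "v \<in> Y" "v \<noteq> (\<lambda>i. 0)"
    using gen_sub_base by (auto simp: Y_def v_def fun_eq_iff)
  ultimately have Y_all: "Y = {u. supp n u}" using irr unfolding irreducible_rep_def n_def by blast
  \<comment> \<open>In weight N a pair with first component 0 is (P v, P' v) with P v = 0. The top
    weight space of V consists of vectors R v with R another polynomial in the psi_s, so P
    annihilates all of it by commutativity. As P' is the transpose of P, each top coordinate of P' v
    is a pairing of v with a vector P annihilates.\<close>
  have kernel_top: "u' i = 0" if sub: "gen_sub (\<lambda>i. 0) u'" and wi: "w (i mod n) = N" for u' i
  proof -
    obtain P P' where P: "psi_poly P P'" "\<And>i. w (i mod n) = N \<Longrightarrow> 0 = app P v i \<and> u' i = app P' v i"
      using top[OF sub] by blast
    have Pv: "app P v = (\<lambda>i. 0)" using P(2) poly_zero[OF P(1)] by (metis ext)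
    have P_zero: "app P (\<lambda>i. if i = l then 1 else 0) = (\<lambda>i. 0)" if l: "l < n" "w l = N" for l
    proof -
      let ?e = "\<lambda>i. if i = l then 1 else 0 :: complex"
      have "?e \<in> Y" using l by (simp add: Y_all supp_def)
      then obtain e' where "gen_sub ?e e'" by (auto simp: Y_def)
      then obtain R R' where R: "psi_poly R R'" "\<And>i. w (i mod n) = N \<Longrightarrow> ?e i = app R v i"
        using top by blast
      have "?e i = app R v i" for i
      proof (cases "w (i mod n) = N")
        case False
        then show ?thesis using poly_zero[OF R(1)] l by auto
      qed (rule R(2))
      then have "?e = app R v" by (rule ext)
      then have "app P ?e = app (P * R) v" by (simp add: op_rep_eq)
      also have "\<dots> = app (R * P) v" by (simp only: psi_poly_commute[OF P(1) R(1)])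
      finally show ?thesis by (simp add: op_rep_eq Pv)
    qed
    have P_tr: "psi_poly R R' \<Longrightarrow> op_transpose n R R'" for R R'
    proof (induction rule: psi_poly.induct)
      case (psi R R' s)
      then have "op_transpose n (V.psi s * R) (R' * V'.psi s)" by (intro op_transpose_mult tr_psi)
      then show ?case using psi_poly_psi[OF psi.hyps, of s] by simp
    qed (auto intro: op_transpose_one[OF n0] op_transpose_add op_transpose_scale)
    have "u' l = 0" if l: "l < n" "w l = N" for l
    proof -
      have "bilin n (\<lambda>i. if i = l then 1 else 0) (app P' v) = bilin n (\<lambda>i. 0) v"
        using bilin_transpose[OF P_tr[OF P(1)], of "\<lambda>i. if i = l then 1 else 0" v] P_zero[OF l] by simp
      then have "app P' v l = 0" using l by (simp add: bilin_def if_distrib[of "\<lambda>x. x * _"] cong: if_cong)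
      then show ?thesis using P(2)[of l] l by simp
    qed
    then show ?thesis using wi sub_supp[OF sub] by (cases "i < n") (auto simp: supp_def)
  qed
  have kernel: "u' = (\<lambda>i. 0)" if u': "gen_sub (\<lambda>i. 0) u'" for u'
  proof -
    \<comment> \<open>The annihilator of the kernel under the pairing. Operators of V transpose to
      operators of the dual, so it is a submodule of V; it contains v by \<open>kernel_top\<close>,
      thus it is all of V and the kernel vanishes.\<close>
    define Z where "Z = {u. supp n u \<and> (\<forall>z. gen_sub (\<lambda>i. 0) z \<longrightarrow> bilin n u z = 0)}"
    have ker_ops: "gen_sub (\<lambda>i. 0) (app X z)" if "gen_sub (\<lambda>i. 0) z" "X \<in> {x0', xm', y0', y1', k', ki'}" for X z
      using gen_sub_ops[OF that(1)] that(2) by auto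
    have "inv_subspace q V Z"
    proof (rule inv_subspaceI)
      fix u X assume u: "u \<in> Z" and X: "X \<in> {x0, xm, y0, y1, k, ki}"
      then obtain X' where X': "op_transpose n X X'" "X' \<in> {x0', xm', y0', y1', k', ki'}"
        using tr_x0 tr_xm tr_y0 tr_y1 tr_k tr_ki by blast
      then show "app X u \<in> Z"
        using u ker_ops supp_app(1)[OF X'(1) _ n0] by (auto simp: Z_def bilin_transpose[OF X'(1)])
    qed (auto simp: Z_def supp_def bilin_def distrib_right sum.distrib mult.assoc simp flip: sum_distrib_left)
    moreover have "v \<in> Z"
    proof -
      have "bilin n v z = 0" if "gen_sub (\<lambda>i. 0) z" for z
        using kernel_top[OF that, of i0] i0 by (simp add: bilin_def v_def if_distrib[of "\<lambda>x. x * _"] cong: if_cong)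
      then show ?thesis by (simp add: Z_def supp_v)
    qed
    ultimately have Z_all: "Z = {u. supp n u}"
      using irr \<open>v \<noteq> _\<close> unfolding irreducible_rep_def n_def by blast
    show ?thesis
    proof
      fix i
      show "u' i = 0"
      proof (cases "i < n")
        case True
        then have "(\<lambda>j. if j = i then 1 else 0) \<in> Z" by (simp add: Z_all supp_def)
        then show ?thesis using u' True
          by (auto simp: Z_def bilin_def if_distrib[of "\<lambda>x. x * _"] cong: if_cong)
      next
        case False
        then show ?thesis using sub_supp[OF u'] by (simp add: supp_def)
      qed
    qed
  qed
  have unique: "z = z'" if "gen_sub u z" "gen_sub u z'" for u z z'
  proof -
    have "gen_sub (\<lambda>i. u i + (- 1) * u i) (\<lambda>i. z i + (- 1) * z' i)"
      by (rule gen_sub.add[OF that(1) gen_sub_scale[OF that(2)]])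
    then have "(\<lambda>i. z i - z' i) = (\<lambda>i. 0)" using kernel by simp
    then show ?thesis by (auto simp: fun_eq_iff)
  qed
  define e :: "nat \<Rightarrow> nat \<Rightarrow> complex" where "e j = (\<lambda>i. if i = j then 1 else 0)" for j
  have "\<exists>z. gen_sub (e j) z" if "j < n" for j
  proof -
    have "e j \<in> Y" using that by (simp add: Y_all supp_def e_def)
    then show ?thesis by (simp add: Y_def)
  qed
  then obtain t where t: "\<And>j. j < n \<Longrightarrow> gen_sub (e j) (t j)" by metis
  define T where "T = mat n n (\<lambda>(i, j). t j i)"
  have T: "T \<in> carrier_mat n n" by (simp add: T_def)
  have sum_sub: "gen_sub (\<lambda>i. \<Sum>j\<in>S. a j * e j i) (\<lambda>i. \<Sum>j\<in>S. a j * t j i)" if "finite S" "S \<subseteq> {0..<n}" for a S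
    using that
  proof induction
    case (insert j S)
    then show ?case using gen_sub.add[OF gen_sub_scale[OF t[of j], of "a j"] insert.IH] by simp
  qed (simp add: gen_sub_zero)
  have lin: "gen_sub u (app (op_of n T) u)" if u: "supp n u" for u
  proof -
    have "(\<lambda>i. \<Sum>j = 0..<n. u j * e j i) = u"
      using u by (auto simp: e_def supp_def fun_eq_iff if_distrib[of "\<lambda>x. _ * x"] cong: if_cong)
    moreover have "(\<lambda>i. \<Sum>j = 0..<n. u j * t j i) = app (op_of n T) u"
    proof
      fix i
      show "(\<Sum>j = 0..<n. u j * t j i) = app (op_of n T) u i"
      proof (cases "i < n")
        case True
        then show ?thesis by (simp add: app_op_of T_def mult.commute)
      next
        case False
        moreover have "t j i = 0" if "j < n" for j
          using sub_supp[OF t[OF that]] False by (simp add: supp_def)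
        ultimately show ?thesis
          using supp_app(1)[OF op_transposeI[OF T] u n0] by (simp add: supp_def)
      qed
    qed
    ultimately show ?thesis using sum_sub[of "{0..<n}" u] by simp
  qed
  have sub_G: "gen_sub (app (G x) u) (app (H x) u')" if "gen_sub u u'" for x u u'
  proof -
    have "G (XMinus N0) = k * xm" "G (XPlus N0) = y1 * ki" "G (XMinus N1) = y0" "G (XPlus N1) = x0" "G (K N0) = ki" "G (K N1) = k"
      by (simp_all add: k_def xm_def y1_def ki_def y0_def x0_def G.K_mult_assoc mult.assoc G.K1_K0)
    moreover have "H (XMinus N0) = k' * xm'" "H (XPlus N0) = y1' * ki'" "H (XMinus N1) = y0'" "H (XPlus N1) = x0'" "H (K N0) = ki'" "H (K N1) = k'"
      by (simp_all add: k'_def xm'_def y1'_def ki'_def y0'_def x0'_def H.K_mult_assoc mult.assoc H.K1_K0)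
    ultimately show ?thesis
      using that gen_sub_ops by (induct x rule: uq_gen_all_cases)
        (simp_all add: G.KInv_N0 G.KInv_N1 G.CSqrt G.CSqrtInv H.KInv_N0 H.KInv_N1 H.CSqrt H.CSqrtInv op_rep_eq)
  qed
  have supp_G: "supp n (app (G x) u)" if "supp n u" for x u
    unfolding G_def by (rule supp_app(1)[OF op_transposeI[OF c] that n0])
  have comm: "T * act q V (gen x) = act q (dual q V) (gen x) * T" for x
  proof (rule eq_matI)
    fix i j assume "i < dim_row (act q (dual q V) (gen x) * T)" "j < dim_col (act q (dual q V) (gen x) * T)"
    then have ij: "i < n" "j < n" using cD T by (metis carrier_matD index_mult_mat(2,3))+
    have s: "supp n (e j)" using ij by (simp add: supp_def e_def)
    have col: "app (op_of n A) (e j) i = A $$ (i, j)" if "A \<in> carrier_mat n n" for A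
      using ij by (simp add: app_op_of e_def if_distrib[of "\<lambda>x. _ * x"] cong: if_cong)
    have "app (op_of n T) (app (G x) (e j)) = app (H x) (app (op_of n T) (e j))"
      using unique[OF lin[OF supp_G[OF s]] sub_G[OF lin[OF s]]] .
    then have "app (op_of n (T * act q V (gen x))) (e j) i = app (op_of n (act q (dual q V) (gen x) * T)) (e j) i"
      using T c cD by (simp add: op_of_mult times_op.rep_eq G_def H_def)
    then show "(T * act q V (gen x)) $$ (i, j) = (act q (dual q V) (gen x) * T) $$ (i, j)"
      using T c cD by (simp add: col mult_carrier_mat[of _ n n _ n])
  qed (use T c cD in \<open>auto simp: carrier_matD[OF c] carrier_matD[OF cD]\<close>)
  \<comment> \<open>The vectors related to 0 form a submodule of V that misses v, since v is related
    to v and to nothing else.\<close>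
  have inj: "u = (\<lambda>i. 0)" if "gen_sub u (\<lambda>i. 0)" for u
  proof -
    define Z where "Z = {u. gen_sub u (\<lambda>i. 0)}"
    have "inv_subspace q V Z"
    proof (rule inv_subspaceI)
      fix u X assume "u \<in> Z" "X \<in> {x0, xm, y0, y1, k, ki}"
      then show "app X u \<in> Z" using gen_sub_ops[of u "\<lambda>i. 0"] by (auto simp: Z_def)
    next
      fix u z assume "u \<in> Z" "z \<in> Z"
      then show "(\<lambda>i. u i + z i) \<in> Z" using gen_sub.add[of u "\<lambda>i. 0" z "\<lambda>i. 0"] by (simp add: Z_def)
    next
      fix u d assume "u \<in> Z"
      then show "(\<lambda>i. d * u i) \<in> Z" using gen_sub_scale[of u "\<lambda>i. 0" d] by (simp add: Z_def)
    qed (use sub_supp gen_sub_zero in \<open>auto simp: Z_def\<close>)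
    moreover have "v \<notin> Z"
      using unique[OF gen_sub_base, of "\<lambda>i. 0"] \<open>v \<noteq> _\<close> by (auto simp: Z_def)
    ultimately have "Z = {\<lambda>i. 0}" using irr supp_v unfolding irreducible_rep_def n_def by blast
    then show ?thesis using that by (auto simp: Z_def)
  qed
  have "det T \<noteq> 0"
  proof
    assume "det T = 0"
    then obtain z where z: "z \<in> carrier_vec n" "z \<noteq> 0\<^sub>v n" "T *\<^sub>v z = 0\<^sub>v n"
      using det_0_iff_vec_prod_zero[OF T] by blast
    define u where "u i = (if i < n then z $ i else 0)" for i
    have s: "supp n u" by (simp add: supp_def u_def)
    have "app (op_of n T) u i = 0" for i
    proof (cases "i < n")
      case True
      then have "app (op_of n T) u i = (T *\<^sub>v z) $ i"
        using T z(1) by (simp add: app_op_of u_def scalar_prod_def)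
      then show ?thesis using z(3) True by simp
    next
      case False
      then show ?thesis using supp_app(1)[OF op_transposeI[OF T] s n0] by (simp add: supp_def)
    qed
    then have "u = (\<lambda>i. 0)" using lin[OF s] inj by (metis ext)
    then have "z = 0\<^sub>v n" using z(1) by (intro eq_vecI) (auto simp: u_def fun_eq_iff split: if_splits)
    then show False using z(2) by simp
  qed
  then obtain S where S: "S \<in> carrier_mat n n" "S * T = 1\<^sub>m n" "T * S = 1\<^sub>m n"
    using det_non_zero_imp_unit[OF T, of "()"] unfolding Units_def ring_mat_simps by auto
  show ?thesis
    using T S comm D by (intro rep_isoI[OF V D(1), where T = T and S = S]) (simp_all add: n_def)
qed

section \<open>Subrepresentations and quotients\<close>

text \<open>One construction for three cases: a change of basis, a subrepresentation and a quotient.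
  Type 1 is required of K_1 alone, as K_0 is its inverse.\<close>

lemma compress_rep:
  assumes q: "generic_parameter q" and V: "V \<in> uq_reps q"
    and AB: "A \<in> carrier_mat m (fst V)" "B \<in> carrier_mat (fst V) m" "A * B = 1\<^sub>m m"
    and mult: "\<And>f g. A * act q V f * B * (A * act q V g * B) = A * (act q V f * act q V g) * B"
    and K1: "type_one_mat q (A * act q V (gen (K N1)) * B)"
  obtains U where "U \<in> uq_reps q" "fst U = m" "\<And>f. act q U f = A * act q V f * B"
proof -
  let ?n = "fst V"
  define T where "T f = A * act q V f * B" for f
  have q0: "q \<noteq> 0" using q by (rule generic_parameter.q_nonzero)
  have isrep: "is_rep q V" using V by (simp add: uq_reps_def)
  interpret V: mat_hom ?n "act q V" using isrep by (rule mat_hom_act)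
  note c = V.T_carrier
  interpret mat_hom m T
  proof
    fix f g c
    show "T f \<in> carrier_mat m m" using AB V.T_carrier[of f] by (simp add: T_def mult_carrier_mat[of _ m ?n _ ?n] mult_carrier_mat[of _ m ?n _ m])
    show "T (f + g) = T f + T g"
      using AB V.T_carrier[of f] V.T_carrier[of g]
      by (simp add: T_def V.T_add mult_add_distrib_mat[of _ m ?n _ ?n] add_mult_distrib_mat[of _ m ?n _ _ m] mult_carrier_mat[of _ m ?n _ ?n])
    show "T (f * g) = T f * T g" by (simp add: T_def V.T_mult mult)
    show "T (scal c) = c \<cdot>\<^sub>m 1\<^sub>m m"
      using AB by (simp add: T_def V.T_scal mult_smult_distrib[of _ m ?n _ ?n] right_mult_one_mat[of _ m ?n] mult_smult_assoc_mat[of _ m ?n _ m])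
  qed
  have T1: "T f = 1\<^sub>m m" if "act q V f = 1\<^sub>m ?n" for f
    using AB that by (simp add: T_def right_mult_one_mat[of _ m ?n])
  have CS: "T (gen CSqrt) = 1\<^sub>m m" by (rule T1[OF rep_K_inverse(5)[OF V]])
  have rel: "T r = 0\<^sub>m m m" if "r \<in> uq_relators q" for r
    using AB act_ideal[OF isrep uq_relators_in_ideal[OF that]]
    by (simp add: T_def right_mult_zero_mat[of _ m ?n] left_mult_zero_mat[of _ ?n m])
  have KK: "T (gen (K N1)) * T (gen (K N0)) = 1\<^sub>m m"
    using T1[of "gen (K N1) * gen (K N0)"] rep_K_inverse(2)[OF V] by (simp add: T_mult V.T_mult)
  have "type_one_mat q (T (gen (K i)))" for i
    using K1 type_one_mat_inverse[OF q0 _ T_carrier T_carrier KK] by (cases i) (simp_all add: T_def)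
  then have "uq_matrices q m (\<lambda>x. T (gen x))"
    using level_zero[OF _ rel CS] CS T_carrier by (simp add: uq_matrices_def)
  from rep[OF q this] show thesis using that[of "(m, \<lambda>a. the_elem (T ` a))"] by (simp add: T_def)
qed

lemma type_one_mat_qdiag: "type_one_mat q (qdiag q n w)"
  by (rule type_one_matI[of "1\<^sub>m n" n "1\<^sub>m n" _ q w])
    (simp_all add: left_mult_one_mat[of _ n n] right_mult_one_mat[of _ n n])

text \<open>Makes the coordinate vectors weight vectors, which both the self-duality of irreducibles
  and the splitting of reducibles rely on.\<close>

lemma rep_diagonal_form:
  assumes q: "generic_parameter q" and V: "V \<in> uq_reps q"
  obtains U w where "U \<in> uq_reps q" "fst U = fst V" "act q U (gen (K N1)) = qdiag q (fst U) w" "rep_iso q V U"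
proof -
  let ?n = "fst V"
  note c = act_gen_carrier[OF V]
  have t1: "type_one_mat q (act q V (gen (K N1)))"
    using uq_matrices_act[OF V] by (simp add: uq_matrices_def)
  obtain w P P' where P: "P \<in> carrier_mat ?n ?n" "P' \<in> carrier_mat ?n ?n" "P * P' = 1\<^sub>m ?n" "P' * P = 1\<^sub>m ?n"
    "act q V (gen (K N1)) = P * qdiag q ?n w * P'"
    using type_one_matE[OF t1 c] by metis
  note assoc = assoc_mult_mat[of _ ?n ?n _ ?n _ ?n] mult_carrier_mat[of _ ?n ?n _ ?n]
  have cancel: "P * (P' * X) = X" "P' * (P * X) = X" if "X \<in> carrier_mat ?n ?n" for X
    using P(1-4) that by (simp_all add: left_mult_one_mat[of _ ?n ?n] flip: assoc_mult_mat[of _ ?n ?n _ ?n _ ?n])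
  have mult: "P' * act q V f * P * (P' * act q V g * P) = P' * (act q V f * act q V g) * P" for f g
    using P(1,2) c by (simp add: assoc cancel)
  have K1: "P' * act q V (gen (K N1)) * P = qdiag q ?n w"
    using P(1,2) by (simp add: P(5) assoc cancel P(4) right_mult_one_mat[of _ ?n ?n])
  obtain U where U: "U \<in> uq_reps q" "fst U = ?n" "\<And>f. act q U f = P' * act q V f * P"
    using compress_rep[OF q V P(2,1,4) mult] type_one_mat_qdiag[of q ?n w] unfolding K1 by metis
  have "rep_iso q V U"
    by (rule rep_isoI[OF V U(1), where T = P' and S = P])
      (use P c in \<open>simp_all add: U assoc P(3,4) right_mult_one_mat[of _ ?n ?n]\<close>)
  then show thesis using that[OF U(1,2)] K1 U by simp
qed

text \<open>The subrepresentation lives on the image of \<open>f\<close> and the quotient on the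
  target of \<open>g\<close>, with actions compressed by (\<open>R\<close>, \<open>f\<close>) and
  (\<open>g\<close>, \<open>S\<close>). The hypothesis \<open>inv\<close> is invariance of the image
  of \<open>f\<close>, tested on generators.\<close>

lemma rep_ses_from_split:
  assumes q: "generic_parameter q" and V: "V \<in> uq_reps q" and split: "split_exact r (fst V) m f g R S"
    and inv: "\<And>x. g * act q V (gen x) * f = 0\<^sub>m m r"
    and K: "type_one_mat q (R * act q V (gen (K N1)) * f)" "type_one_mat q (g * act q V (gen (K N1)) * S)"
  obtains U W where "U \<in> uq_reps q" "W \<in> uq_reps q" "fst U = r" "fst W = m" "rep_ses q U V W"
proof -
  let ?n = "fst V"
  have c: "f \<in> carrier_mat ?n r" "g \<in> carrier_mat m ?n" "R \<in> carrier_mat r ?n" "S \<in> carrier_mat ?n m"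
    and e: "R * f = 1\<^sub>m r" "g * S = 1\<^sub>m m" "g * f = 0\<^sub>m m r" "f * R + S * g = 1\<^sub>m ?n"
    using split by (auto simp: split_exact_def)
  interpret V: mat_hom ?n "act q V" using V by (intro mat_hom_act) (simp add: uq_reps_def)
  note a = V.T_carrier
  have comp: "f * (R * X) + S * (g * X) = X" if "X \<in> carrier_mat ?n l" for X l
  proof -
    have "f * (R * X) + S * (g * X) = (f * R + S * g) * X"
      using c that by (simp add: add_mult_distrib_mat[of _ ?n ?n _ _ l] assoc_mult_mat[of _ ?n r _ ?n _ l] assoc_mult_mat[of _ ?n m _ ?n _ l] mult_carrier_mat[of _ ?n r _ ?n] mult_carrier_mat[of _ ?n m _ ?n])
    then show ?thesis using e(4) that by simp
  qed
  \<comment> \<open>Invariance extends from generators to all elements; for products, the second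
    conjunct rewrites a vector of the image of \<open>f\<close> as \<open>f\<close> of its
    coordinates.\<close>
  have key: "g * (act q V y * f) = 0\<^sub>m m r \<and> f * (R * (act q V y * f)) = act q V y * f" for y
  proof -
    have *: "f * (R * (act q V y * f)) = act q V y * f" if "g * (act q V y * f) = 0\<^sub>m m r" for y
    proof -
      have X: "act q V y * f \<in> carrier_mat ?n r" using a[of y] c by (simp add: mult_carrier_mat[of _ ?n ?n _ r])
      have "f * (R * (act q V y * f)) \<in> carrier_mat ?n r"
        using c X by (simp add: mult_carrier_mat[of _ ?n r _ r] mult_carrier_mat[of _ r ?n _ r])
      then show ?thesis using comp[OF X] that c by (simp add: right_mult_zero_mat[of _ ?n m] right_add_zero_mat[of _ ?n r])
    qed
    have "g * (act q V y * f) = 0\<^sub>m m r"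
    proof (induction y rule: free_alg_induct)
      case (scal d)
      have "act q V (scal d) * f = d \<cdot>\<^sub>m f"
        using c by (simp add: V.T_scal mult_smult_assoc_mat[of _ ?n ?n _ r] left_mult_one_mat[of _ ?n r])
      then show ?case using c e(3) by (simp add: mult_smult_distrib[of _ m ?n _ r])
    next
      case (gen x)
      then show ?case using inv[of x] a c by (simp add: assoc_mult_mat[of _ m ?n _ ?n _ r])
    next
      case (add y z)
      have "act q V y * f \<in> carrier_mat ?n r" "act q V z * f \<in> carrier_mat ?n r"
        using a[of y] a[of z] c by (simp_all add: mult_carrier_mat[of _ ?n ?n _ r])
      then show ?case using add a[of y] a[of z] c
        by (simp add: V.T_add add_mult_distrib_mat[of _ ?n ?n _ _ r] mult_add_distrib_mat[of _ m ?n _ r])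
    next
      case (mult y z)
      have Y: "act q V y * f \<in> carrier_mat ?n r" "act q V z * f \<in> carrier_mat ?n r"
        using a[of y] a[of z] c by (simp_all add: mult_carrier_mat[of _ ?n ?n _ r])
      have "g * (act q V (y * z) * f) = g * (act q V y * (act q V z * f))"
        using a[of y] a[of z] c by (simp add: V.T_mult assoc_mult_mat[of _ ?n ?n _ ?n _ r])
      also have "\<dots> = g * (act q V y * (f * (R * (act q V z * f))))" using *[OF mult(2)] by simp
      also have "\<dots> = (g * (act q V y * f)) * (R * (act q V z * f))"
        using a[of y] c Y by (simp add: assoc_mult_mat[of _ m ?n _ r _ r] assoc_mult_mat[of _ ?n ?n _ r _ r] mult_carrier_mat[of _ r ?n _ r])
      also have "\<dots> = 0\<^sub>m m r"
        using mult(1) c Y by (simp add: left_mult_zero_mat[of _ r r] mult_carrier_mat[of _ r ?n _ r])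
      finally show ?case .
    qed
    then show ?thesis using * by blast
  qed
  have key': "g * (act q V y * (S * g)) = g * act q V y" for y
  proof -
    have fR: "f * R \<in> carrier_mat ?n ?n" "S * g \<in> carrier_mat ?n ?n"
      using c by (simp_all add: mult_carrier_mat[of _ ?n r _ ?n] mult_carrier_mat[of _ ?n m _ ?n])
    have "g * act q V y = g * (act q V y * (f * R + S * g))" using a[of y] by (simp add: e(4) right_mult_one_mat[of _ ?n ?n])
    also have "\<dots> = g * (act q V y * (f * R)) + g * (act q V y * (S * g))"
      using a[of y] c fR by (simp add: mult_add_distrib_mat[of _ ?n ?n _ ?n] mult_add_distrib_mat[of _ m ?n _ ?n] mult_carrier_mat[of _ ?n ?n _ ?n])
    also have "g * (act q V y * (f * R)) = (g * (act q V y * f)) * R"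
      using a[of y] c by (simp add: assoc_mult_mat[of _ ?n ?n _ r _ ?n] assoc_mult_mat[of _ m ?n _ r _ ?n] mult_carrier_mat[of _ ?n ?n _ r])
    also have "\<dots> = 0\<^sub>m m ?n" using key[of y] c by (simp add: left_mult_zero_mat[of _ r ?n])
    finally show ?thesis using a[of y] c fR by (simp add: left_add_zero_mat[of _ m ?n] mult_carrier_mat[of _ m ?n _ ?n] mult_carrier_mat[of _ ?n ?n _ ?n])
  qed
  have multU: "R * act q V y * f * (R * act q V z * f) = R * (act q V y * act q V z) * f" for y z
  proof -
    have Y: "act q V z * f \<in> carrier_mat ?n r" "R * act q V y \<in> carrier_mat r ?n"
      using a[of y] a[of z] c by (simp_all add: mult_carrier_mat[of _ ?n ?n _ r] mult_carrier_mat[of _ r ?n _ ?n])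
    have "R * act q V y * f * (R * act q V z * f) = (R * act q V y) * (f * (R * (act q V z * f)))"
      using a[of y] a[of z] c Y by (simp add: assoc_mult_mat[of _ r ?n _ r _ r] assoc_mult_mat[of _ r ?n _ ?n _ r] assoc_mult_mat[of _ ?n ?n _ r _ r]
          mult_carrier_mat[of _ r ?n _ r] mult_carrier_mat[of _ ?n ?n _ r])
    also have "\<dots> = R * (act q V y * act q V z) * f"
      using key[of z] a[of y] a[of z] c Y by (simp add: assoc_mult_mat[of _ r ?n _ ?n _ r] assoc_mult_mat[of _ ?n ?n _ ?n _ r] mult_carrier_mat[of _ ?n ?n _ ?n])
    finally show ?thesis .
  qed
  have multW: "g * act q V y * S * (g * act q V z * S) = g * (act q V y * act q V z) * S" for y z
  proof -
    have Y: "act q V z * S \<in> carrier_mat ?n m" "g * act q V y \<in> carrier_mat m ?n" "S * g \<in> carrier_mat ?n ?n"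
      using a[of y] a[of z] c by (simp_all add: mult_carrier_mat[of _ ?n ?n _ m] mult_carrier_mat[of _ m ?n _ ?n] mult_carrier_mat[of _ ?n m _ ?n])
    have "g * act q V y * S * (g * act q V z * S) = (g * (act q V y * (S * g))) * (act q V z * S)"
      using a[of y] a[of z] c Y by (simp add: assoc_mult_mat[of _ m ?n _ m _ m] assoc_mult_mat[of _ m ?n _ ?n _ m] assoc_mult_mat[of _ ?n m _ ?n _ m] assoc_mult_mat[of _ ?n ?n _ ?n _ m] assoc_mult_mat[of _ ?n ?n _ m _ m]
          mult_carrier_mat[of _ m ?n _ m] mult_carrier_mat[of _ ?n ?n _ m] mult_carrier_mat[of _ ?n ?n _ ?n])
    also have "\<dots> = g * (act q V y * act q V z) * S"
      using key'[of y] a[of y] a[of z] c Y by (simp add: assoc_mult_mat[of _ m ?n _ ?n _ m] assoc_mult_mat[of _ ?n ?n _ ?n _ m] mult_carrier_mat[of _ ?n ?n _ ?n])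
    finally show ?thesis .
  qed
  obtain U where U: "U \<in> uq_reps q" "fst U = r" "\<And>y. act q U y = R * act q V y * f"
    using compress_rep[OF q V c(3,1) e(1) multU K(1)] by blast
  obtain W where W: "W \<in> uq_reps q" "fst W = m" "\<And>y. act q W y = g * act q V y * S"
    using compress_rep[OF q V c(2,4) e(2) multW K(2)] by blast
  have "f \<in> rep_hom q U V"
    using key c a by (simp add: rep_hom_iff[OF U(1) V] U assoc_mult_mat[of _ r ?n _ ?n _ r])
  moreover have "g \<in> rep_hom q V W"
    using key' c a by (simp add: rep_hom_iff[OF V W(1)] W assoc_mult_mat[of _ m ?n _ m _ ?n] assoc_mult_mat[of _ m ?n _ ?n _ ?n] assoc_mult_mat[of _ ?n ?n _ m _ ?n] mult_carrier_mat[of _ m ?n _ ?n] mult_carrier_mat[of _ ?n m _ ?n])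
  ultimately have "rep_ses q U V W" using split by (intro rep_sesI) (simp_all add: U W)
  then show thesis using that U W by blast
qed

text \<open>Bases are adapted to coordinates: pivots parametrise the subspace and the remaining
  coordinates the quotient. Coordinates are eigenvectors of K_1, so K_1 becomes diagonal on both
  pieces with weights taken from \<open>w\<close>, which proves type 1 for them.\<close>

lemma reducible_rep_splits:
  assumes q: "generic_parameter q" and V: "V \<in> uq_reps q"
    and K1: "act q V (gen (K N1)) = qdiag q (fst V) w" and red: "\<not> irreducible_rep q V"
  obtains U W where "U \<in> uq_reps q" "W \<in> uq_reps q" "fst U < fst V" "fst W < fst V" "rep_ses q U V W"
proof -
  define n where "n = fst V"
  note a = act_gen_carrier[OF V, folded n_def]
  obtain Y where Y: "inv_subspace q V Y" "Y \<noteq> {\<lambda>i. 0}" "Y \<noteq> {u. supp n u}"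
    using red unfolding irreducible_rep_def n_def by blast
  have Y0: "(\<lambda>i. 0) \<in> Y" and Ys: "\<And>u. u \<in> Y \<Longrightarrow> supp n u" and Yadd: "\<And>u z. u \<in> Y \<Longrightarrow> z \<in> Y \<Longrightarrow> (\<lambda>i. u i + z i) \<in> Y"
    and Yscale: "\<And>u d. u \<in> Y \<Longrightarrow> (\<lambda>i. d * u i) \<in> Y"
    and Yact: "\<And>u x. u \<in> Y \<Longrightarrow> app (op_of n (act q V (gen x))) u \<in> Y"
    using Y(1) unfolding inv_subspace_def n_def by blast+
  \<comment> \<open>A minimal set of coordinates on which no nonzero element of \<open>Y\<close> vanishes plays the role of
    the pivots of a reduced echelon basis of \<open>Y\<close>.\<close>
  define det where "det J \<longleftrightarrow> J \<subseteq> {..<n} \<and> (\<forall>y\<in>Y. (\<forall>j\<in>J. y j = 0) \<longrightarrow> y = (\<lambda>i. 0))" for J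
  have "det {..<n}"
    unfolding det_def
  proof (intro conjI ballI impI ext)
    fix y i assume "y \<in> Y" "\<forall>j\<in>{..<n}. y j = 0"
    then show "y i = 0" using Ys[of y] by (cases "i < n") (simp_all add: supp_def)
  qed simp
  then obtain J where J: "det J" "\<And>J'. det J' \<Longrightarrow> card J \<le> card J'"
    using ex_has_least_nat[of det "{..<n}" card] by blast
  have Jn: "J \<subseteq> {..<n}" and Jdet: "\<And>y. y \<in> Y \<Longrightarrow> (\<And>j. j \<in> J \<Longrightarrow> y j = 0) \<Longrightarrow> y = (\<lambda>i. 0)"
    using J(1) unfolding det_def by blast+
  have finJ: "finite J" using Jn finite_subset by blast
  \<comment> \<open>By minimality some nonzero element of \<open>Y\<close> vanishes on all of
    \<open>J\<close> except \<open>j\<close>; rescaling it gives a member of the reduced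
    basis.\<close>
  have "\<exists>b\<in>Y. \<forall>i\<in>J. b i = (if i = j then 1 else 0)" if j: "j \<in> J" for j
  proof -
    have "card (J - {j}) < card J" by (rule card_Diff1_less[OF finJ j])
    then have "\<not> det (J - {j})" using J(2) by (meson not_le)
    then obtain y where y: "y \<in> Y" "\<And>i. i \<in> J - {j} \<Longrightarrow> y i = 0" "y \<noteq> (\<lambda>i. 0)"
      using Jn unfolding det_def by blast
    have "y j \<noteq> 0"
    proof
      assume "y j = 0"
      then have "y i = 0" if "i \<in> J" for i using y(2) that by (cases "i = j") auto
      then show False using Jdet[OF y(1)] y(3) by blast
    qed
    then show ?thesis using y(2) by (intro bexI[OF _ Yscale[OF y(1), of "1 / y j"]]) auto
  qed
  then obtain b where bY: "\<And>j. j \<in> J \<Longrightarrow> b j \<in> Y" and bJ: "\<And>i j. j \<in> J \<Longrightarrow> i \<in> J \<Longrightarrow> b j i = (if i = j then 1 else 0)"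
    by metis
  have sumY: "(\<lambda>i. \<Sum>j\<in>S. d j * b j i) \<in> Y" if "finite S" "S \<subseteq> J" for S d
    using that
  proof induction
    case (insert j S)
    then show ?case using Yadd[OF Yscale[OF bY, of j "d j"] insert.IH] by simp
  qed (simp add: Y0)
  have expand: "z i = (\<Sum>j\<in>J. z j * b j i)" if z: "z \<in> Y" for z i
  proof -
    have "(\<lambda>i. z i + (- 1) * (\<Sum>j\<in>J. z j * b j i)) \<in> Y"
      by (rule Yadd[OF z Yscale[OF sumY[OF finJ subset_refl]]])
    moreover have "z i + (- 1) * (\<Sum>j\<in>J. z j * b j i) = 0" if i: "i \<in> J" for i
    proof -
      have "(\<Sum>j\<in>J. z j * b j i) = (\<Sum>j\<in>J. if j = i then z i else 0)"
        using i by (intro sum.cong) (auto simp: bJ)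
      then show ?thesis using finJ i by simp
    qed
    ultimately have "(\<lambda>i. z i + (- 1) * (\<Sum>j\<in>J. z j * b j i)) = (\<lambda>i. 0)" by (rule Jdet)
    from fun_cong[OF this, of i] show ?thesis by simp
  qed
  define C where "C = {..<n} - J"
  obtain \<beta> where \<beta>: "bij_betw \<beta> {0..<card J} J" using ex_bij_betw_nat_finite[OF finJ] by blast
  obtain \<gamma> where \<gamma>: "bij_betw \<gamma> {0..<card C} C" using ex_bij_betw_nat_finite[of C] by (auto simp: C_def)
  have \<beta>J: "\<beta> x \<in> J" if "x < card J" for x using bij_betw_apply[OF \<beta>, of x] that by simp
  have \<gamma>C: "\<gamma> x \<in> C" if "x < card C" for x using bij_betw_apply[OF \<gamma>, of x] that by simp
  have \<beta>n: "\<beta> x < n" if "x < card J" for x using \<beta>J[OF that] Jn by blast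
  have \<gamma>n: "\<gamma> x < n" and \<gamma>J: "\<gamma> x \<notin> J" if "x < card C" for x using \<gamma>C[OF that] by (simp_all add: C_def)
  have \<beta>_eq: "\<beta> x = \<beta> y \<longleftrightarrow> x = y" if "x < card J" "y < card J" for x y
    using inj_on_eq_iff[OF bij_betw_imp_inj_on[OF \<beta>], of x y] that by simp
  have \<gamma>_eq: "\<gamma> x = \<gamma> y \<longleftrightarrow> x = y" if "x < card C" "y < card C" for x y
    using inj_on_eq_iff[OF bij_betw_imp_inj_on[OF \<gamma>], of x y] that by simp
  have sum\<beta>: "(\<Sum>x = 0..<card J. h (\<beta> x)) = (\<Sum>i\<in>J. h i)" for h :: "nat \<Rightarrow> complex" by (rule sum.reindex_bij_betw[OF \<beta>])
  have sum\<gamma>: "(\<Sum>x = 0..<card C. h (\<gamma> x)) = (\<Sum>i\<in>C. h i)" for h :: "nat \<Rightarrow> complex" by (rule sum.reindex_bij_betw[OF \<gamma>])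
  define r m where "r = card J" and "m = card C"
  define f where "f = mat n r (\<lambda>(i, x). b (\<beta> x) i)"
  define R where "R = mat r n (\<lambda>(x, i). if i = \<beta> x then 1 else 0 :: complex)"
  \<comment> \<open>Row x subtracts from the coordinate \<open>\<gamma> x\<close> the value
    predicted by the pivot coordinates, so \<open>g\<close> vanishes on \<open>Y\<close>.\<close>
  define g where "g = mat m n (\<lambda>(x, i). (if i = \<gamma> x then 1 else 0) - (if i \<in> J then b i (\<gamma> x) else 0))"
  define S where "S = mat n m (\<lambda>(i, x). if i = \<gamma> x then 1 else 0 :: complex)"
  have c: "f \<in> carrier_mat n r" "g \<in> carrier_mat m n" "R \<in> carrier_mat r n" "S \<in> carrier_mat n m"
    by (simp_all add: f_def g_def R_def S_def)
  have RX: "(R * X) $$ (x, y) = X $$ (\<beta> x, y)" if "X \<in> carrier_mat n l" "x < r" "y < l" for X l x y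
    using that \<beta>n by (simp add: R_def r_def scalar_prod_def if_distrib[of "\<lambda>x. x * _"] cong: if_cong)
  have XS: "(X * S) $$ (x, y) = X $$ (x, \<gamma> y)" if "X \<in> carrier_mat l n" "x < l" "y < m" for X l x y
    using that \<gamma>n by (simp add: S_def m_def scalar_prod_def if_distrib[of "\<lambda>x. _ * x"] cong: if_cong)
  have J_sum: "(\<Sum>i = 0..<n. (if i \<in> J then h i else 0)) = (\<Sum>i\<in>J. h i)" for h :: "nat \<Rightarrow> complex"
    by (rule sum.mono_neutral_cong_right) (use Jn in auto)
  have gz: "(\<Sum>i = 0..<n. g $$ (x, i) * z i) = 0" if z: "z \<in> Y" and x: "x < m" for z x
  proof -
    have "(\<Sum>i = 0..<n. g $$ (x, i) * z i) = (\<Sum>i = 0..<n. (if i = \<gamma> x then z i else 0) - (if i \<in> J then b i (\<gamma> x) * z i else 0))"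
      using x by (intro sum.cong) (auto simp: g_def left_diff_distrib)
    also have "\<dots> = z (\<gamma> x) - (\<Sum>i\<in>J. b i (\<gamma> x) * z i)"
      using x \<gamma>n by (simp add: sum_subtractf J_sum m_def)
    also have "\<dots> = 0" using expand[OF z, of "\<gamma> x"] by (simp add: mult.commute)
    finally show ?thesis .
  qed
  have split: "split_exact r n m f g R S"
    unfolding split_exact_def
  proof (intro conjI c)
    show "R * f = 1\<^sub>m r"
    proof (rule eq_matI)
      fix x y assume "x < dim_row (1\<^sub>m r :: complex mat)" "y < dim_col (1\<^sub>m r :: complex mat)"
      then have xy: "x < r" "y < r" by auto
      then show "(R * f) $$ (x, y) = 1\<^sub>m r $$ (x, y)"
        using RX[OF c(1) xy] \<beta>n[of x] \<beta>J bJ[of "\<beta> y" "\<beta> x"] \<beta>_eq[of x y] by (simp add: f_def r_def)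
    qed (use c in auto)
    show "g * S = 1\<^sub>m m"
    proof (rule eq_matI)
      fix x y assume "x < dim_row (1\<^sub>m m :: complex mat)" "y < dim_col (1\<^sub>m m :: complex mat)"
      then have xy: "x < m" "y < m" by auto
      then show "(g * S) $$ (x, y) = 1\<^sub>m m $$ (x, y)"
        using XS[OF c(2) xy] \<gamma>n[of y] \<gamma>J[of y] \<gamma>_eq[of y x] by (simp add: g_def m_def)
    qed (use c in auto)
    show "g * f = 0\<^sub>m m r"
    proof (rule eq_matI)
      fix x y assume "x < dim_row (0\<^sub>m m r :: complex mat)" "y < dim_col (0\<^sub>m m r :: complex mat)"
      then have xy: "x < m" "y < r" by auto
      have "(g * f) $$ (x, y) = (\<Sum>i = 0..<n. g $$ (x, i) * b (\<beta> y) i)"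
        using xy c by (simp add: scalar_prod_def f_def)
      also have "\<dots> = 0" using xy by (intro gz bY \<beta>J) (simp_all add: r_def)
      finally show "(g * f) $$ (x, y) = 0\<^sub>m m r $$ (x, y)" using xy by simp
    qed (use c in auto)
    show "f * R + S * g = 1\<^sub>m n"
    proof (rule eq_matI)
      fix i l assume "i < dim_row (1\<^sub>m n :: complex mat)" "l < dim_col (1\<^sub>m n :: complex mat)"
      then have il: "i < n" "l < n" by auto
      have "(f * R) $$ (i, l) = (\<Sum>x = 0..<card J. if l = \<beta> x then b (\<beta> x) i else 0)"
        using il by (simp add: scalar_prod_def f_def R_def r_def if_distrib[of "\<lambda>x. _ * x"] cong: if_cong)
      also have "\<dots> = (\<Sum>j\<in>J. if l = j then b j i else 0)" by (rule sum\<beta>)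
      also have "\<dots> = (if l \<in> J then b l i else 0)" using finJ by simp
      finally have 1: "(f * R) $$ (i, l) = (if l \<in> J then b l i else 0)" .
      have "(S * g) $$ (i, l) = (\<Sum>x = 0..<card C. if i = \<gamma> x then (if l = \<gamma> x then 1 else 0) - (if l \<in> J then b l (\<gamma> x) else 0) else 0)"
        using il by (simp add: scalar_prod_def S_def g_def m_def if_distrib[of "\<lambda>x. x * _"] cong: if_cong)
      also have "\<dots> = (\<Sum>j\<in>C. if i = j then (if l = j then 1 else 0) - (if l \<in> J then b l j else 0) else 0)" by (rule sum\<gamma>)
      also have "\<dots> = (if i \<in> C then (if l = i then 1 else 0) - (if l \<in> J then b l i else 0) else 0)" by (simp add: C_def)
      finally have 2: "(S * g) $$ (i, l) = (if i \<in> C then (if l = i then 1 else 0) - (if l \<in> J then b l i else 0) else 0)" .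
      have "(f * R + S * g) $$ (i, l) = (f * R) $$ (i, l) + (S * g) $$ (i, l)"
        using il c by simp
      then show "(f * R + S * g) $$ (i, l) = 1\<^sub>m n $$ (i, l)"
        using il 1 2 bJ[of l i] by (auto simp: C_def)
    qed (use c in auto)
  qed
  have inv: "g * act q V (gen x) * f = 0\<^sub>m m r" for x
  proof (rule eq_matI)
    fix y l assume "y < dim_row (0\<^sub>m m r :: complex mat)" "l < dim_col (0\<^sub>m m r :: complex mat)"
    then have yl: "y < m" "l < r" by auto
    have X: "act q V (gen x) * f \<in> carrier_mat n r" using a c by (simp add: mult_carrier_mat[of _ n n _ r])
    define z where "z = app (op_of n (act q V (gen x))) (b (\<beta> l))"
    have "z \<in> Y" unfolding z_def using yl by (intro Yact bY \<beta>J) (simp add: r_def)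
    have "(act q V (gen x) * f) $$ (i, l) = z i" if "i < n" for i
      using that yl a[of "gen x"] c(1) carrier_matD[OF a[of "gen x"]]
      by (simp add: scalar_prod_def z_def app_op_of f_def)
    moreover have "(g * X) $$ (y, l) = (\<Sum>i = 0..<n. g $$ (y, i) * X $$ (i, l))" if "X \<in> carrier_mat n r" for X
      using that yl c by (simp add: scalar_prod_def)
    ultimately have "(g * (act q V (gen x) * f)) $$ (y, l) = (\<Sum>i = 0..<n. g $$ (y, i) * z i)"
      using X by simp
    also have "\<dots> = 0" by (rule gz[OF \<open>z \<in> Y\<close> yl(1)])
    finally show "(g * act q V (gen x) * f) $$ (y, l) = 0\<^sub>m m r $$ (y, l)"
      using yl a c by (simp add: assoc_mult_mat[of _ m n _ n _ r])
  qed (use a c in auto)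
  have KU: "R * act q V (gen (K N1)) * f = qdiag q r (\<lambda>x. w (\<beta> x))"
  proof (rule eq_matI)
    fix x y assume "x < dim_row (qdiag q r (\<lambda>x. w (\<beta> x)))" "y < dim_col (qdiag q r (\<lambda>x. w (\<beta> x)))"
    then have xy: "x < r" "y < r" by (auto simp: qdiag_def)
    have X: "qdiag q n w * f \<in> carrier_mat n r" using c by (simp add: mult_carrier_mat[of _ n n _ r])
    have "(R * (qdiag q n w * f)) $$ (x, y) = (qdiag q n w * f) $$ (\<beta> x, y)" by (rule RX[OF X xy])
    also have "\<dots> = q powi w (\<beta> x) * b (\<beta> y) (\<beta> x)"
      using xy \<beta>n[of x] by (simp add: qdiag_def f_def scalar_prod_def r_def if_distrib[of "\<lambda>x. x * _"] cong: if_cong)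
    also have "\<dots> = qdiag q r (\<lambda>x. w (\<beta> x)) $$ (x, y)"
      using xy \<beta>J bJ[of "\<beta> y" "\<beta> x"] \<beta>_eq[of x y] by (simp add: qdiag_def r_def)
    finally show "(R * act q V (gen (K N1)) * f) $$ (x, y) = qdiag q r (\<lambda>x. w (\<beta> x)) $$ (x, y)"
      using c by (simp add: K1 n_def[symmetric] assoc_mult_mat[of _ r n _ n _ r])
  qed (use c in \<open>auto simp: qdiag_def\<close>)
  have KW: "g * act q V (gen (K N1)) * S = qdiag q m (\<lambda>x. w (\<gamma> x))"
  proof (rule eq_matI)
    fix x y assume "x < dim_row (qdiag q m (\<lambda>x. w (\<gamma> x)))" "y < dim_col (qdiag q m (\<lambda>x. w (\<gamma> x)))"
    then have xy: "x < m" "y < m" by (auto simp: qdiag_def)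
    have X: "g * qdiag q n w \<in> carrier_mat m n" using c by (simp add: mult_carrier_mat[of _ m n _ n])
    have "(g * qdiag q n w * S) $$ (x, y) = (g * qdiag q n w) $$ (x, \<gamma> y)" by (rule XS[OF X xy])
    also have "\<dots> = g $$ (x, \<gamma> y) * q powi w (\<gamma> y)"
      using xy \<gamma>n[of y] c(2) by (simp add: qdiag_def scalar_prod_def m_def if_distrib[of "\<lambda>x. _ * x"] cong: if_cong)
    also have "\<dots> = qdiag q m (\<lambda>x. w (\<gamma> x)) $$ (x, y)"
      using xy \<gamma>n[of y] \<gamma>J[of y] \<gamma>_eq[of y x] by (simp add: g_def qdiag_def m_def)
    finally show "(g * act q V (gen (K N1)) * S) $$ (x, y) = qdiag q m (\<lambda>x. w (\<gamma> x)) $$ (x, y)"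
      by (simp add: K1 n_def[symmetric])
  qed (use c in \<open>auto simp: qdiag_def\<close>)
  have "J \<noteq> {}"
  proof
    assume "J = {}"
    then have "y = (\<lambda>i. 0)" if "y \<in> Y" for y using Jdet[OF that] by simp
    then have "Y \<subseteq> {\<lambda>i. 0}" by blast
    then show False using Y0 Y(2) by blast
  qed
  have "J \<noteq> {..<n}"
  proof
    assume Jall: "J = {..<n}"
    have "u \<in> Y" if u: "supp n u" for u
    proof -
      have "(\<lambda>i. \<Sum>j\<in>J. u j * b j i) = u"
      proof
        fix i
        show "(\<Sum>j\<in>J. u j * b j i) = u i"
        proof (cases "i < n")
          case True
          then have "(\<Sum>j\<in>J. u j * b j i) = (\<Sum>j\<in>J. if j = i then u i else 0)"
            by (intro sum.cong) (auto simp: bJ Jall)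
          then show ?thesis using True finJ Jall by simp
        next
          case False
          then have "b j i = 0" if "j \<in> J" for j using Ys[OF bY[OF that]] by (simp add: supp_def)
          then show ?thesis using u False by (simp add: supp_def)
        qed
      qed
      then show ?thesis using sumY[OF finJ subset_refl, of u] by simp
    qed
    then show False using Y(3) Ys by blast
  qed
  have "m = n - r" using Jn finJ by (simp add: m_def r_def C_def card_Diff_subset)
  have "r < n" using Jn \<open>J \<noteq> {..<n}\<close> psubset_card_mono[of "{..<n}" J] by (simp add: r_def psubset_eq)
  have "r > 0" using \<open>J \<noteq> {}\<close> finJ by (simp add: r_def card_gt_0_iff)
  with \<open>r < n\<close> \<open>m = n - r\<close> have "m < n" by simp
  have K: "type_one_mat q (R * act q V (gen (K N1)) * f)" "type_one_mat q (g * act q V (gen (K N1)) * S)"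
    unfolding KU KW by (rule type_one_mat_qdiag)+
  obtain U W where "U \<in> uq_reps q" "W \<in> uq_reps q" "fst U = r" "fst W = m" "rep_ses q U V W"
    by (rule rep_ses_from_split[OF q V split[unfolded n_def] inv K])
  then show thesis using that \<open>r < n\<close> \<open>m < n\<close> by (simp add: n_def)
qed

section \<open>Grothendieck rings of monoidal categories\<close>

locale tensor_category =
  fixes Ob :: "'o set" and isom :: "'o \<Rightarrow> 'o \<Rightarrow> bool" and ses :: "'o \<Rightarrow> 'o \<Rightarrow> 'o \<Rightarrow> bool"
    and ten :: "'o \<Rightarrow> 'o \<Rightarrow> 'o" and unit :: 'o
  assumes isom_refl: "U \<in> Ob \<Longrightarrow> isom U U"
    and isom_sym: "isom U V \<Longrightarrow> isom V U"
    and isom_trans: "U \<in> Ob \<Longrightarrow> V \<in> Ob \<Longrightarrow> W \<in> Ob \<Longrightarrow> isom U V \<Longrightarrow> isom V W \<Longrightarrow> isom U W"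
    and ten_closed: "U \<in> Ob \<Longrightarrow> V \<in> Ob \<Longrightarrow> ten U V \<in> Ob"
    and unit_closed: "unit \<in> Ob"
    and ten_isom: "U \<in> Ob \<Longrightarrow> U' \<in> Ob \<Longrightarrow> V \<in> Ob \<Longrightarrow> V' \<in> Ob \<Longrightarrow> isom U U' \<Longrightarrow> isom V V'
      \<Longrightarrow> isom (ten U V) (ten U' V')"
    and ten_assoc: "U \<in> Ob \<Longrightarrow> V \<in> Ob \<Longrightarrow> W \<in> Ob \<Longrightarrow> isom (ten (ten U V) W) (ten U (ten V W))"
    and ten_unit: "U \<in> Ob \<Longrightarrow> isom (ten unit U) U" "U \<in> Ob \<Longrightarrow> isom (ten U unit) U"
    and ses_ten: "U \<in> Ob \<Longrightarrow> W \<in> Ob \<Longrightarrow> V \<in> Ob \<Longrightarrow> X \<in> Ob \<Longrightarrow> ses U W V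
      \<Longrightarrow> ses (ten U X) (ten W X) (ten V X)"
      "U \<in> Ob \<Longrightarrow> W \<in> Ob \<Longrightarrow> V \<in> Ob \<Longrightarrow> X \<in> Ob \<Longrightarrow> ses U W V
      \<Longrightarrow> ses (ten X U) (ten X W) (ten X V)"
begin

abbreviation cl :: "'o \<Rightarrow> 'o set" where
  "cl \<equiv> iso_class Ob isom"

abbreviation R :: "('o set \<Rightarrow>\<^sub>0 int) ring" where
  "R \<equiv> class_group_ring Ob isom ten unit"

abbreviation I :: "('o set \<Rightarrow>\<^sub>0 int) set" where
  "I \<equiv> generate (free_Abelian_group (cl ` Ob)) (ses_relators Ob isom ses)"

lemma cl_eq_iff:
  assumes "U \<in> Ob" "V \<in> Ob"
  shows "cl U = cl V \<longleftrightarrow> isom U V"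
proof
  assume eq: "cl U = cl V"
  have "V \<in> cl U" unfolding eq using assms isom_refl by (simp add: iso_class_def)
  then show "isom U V" by (simp add: iso_class_def)
next
  assume "isom U V"
  then show "cl U = cl V" using assms isom_trans isom_sym unfolding iso_class_def by blast
qed

lemma class_tensor_cl:
  assumes "U \<in> Ob" "V \<in> Ob"
  shows "class_tensor Ob isom ten (cl U) (cl V) = cl (ten U V)"
proof (intro equalityI subsetI)
  fix W assume "W \<in> class_tensor Ob isom ten (cl U) (cl V)"
  then obtain U' V' where W: "W \<in> Ob" "U' \<in> Ob" "V' \<in> Ob" "isom U U'" "isom V V'" "isom (ten U' V') W"
    by (auto simp: class_tensor_def iso_class_def)
  have "isom (ten U V) W"
    using isom_trans[OF ten_closed ten_closed W(1) ten_isom[OF _ _ _ _ W(4,5)] W(6)] assms W(2,3) by blast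
  then show "W \<in> cl (ten U V)" using W(1) by (simp add: iso_class_def)
next
  fix W assume "W \<in> cl (ten U V)"
  then show "W \<in> class_tensor Ob isom ten (cl U) (cl V)"
    using assms isom_refl unfolding class_tensor_def iso_class_def by blast
qed

definition fmul :: "('o set \<Rightarrow>\<^sub>0 int) \<Rightarrow> ('o set \<Rightarrow>\<^sub>0 int) \<Rightarrow> ('o set \<Rightarrow>\<^sub>0 int)" where
  "fmul f g = (\<Sum>A\<in>Poly_Mapping.keys f. \<Sum>B\<in>Poly_Mapping.keys g.
     Poly_Mapping.single (class_tensor Ob isom ten A B) (Poly_Mapping.lookup f A * Poly_Mapping.lookup g B))"

lemma R_simps [simp]:
  "carrier R = {f. Poly_Mapping.keys f \<subseteq> cl ` Ob}" "monoid.mult R = fmul" "\<one>\<^bsub>R\<^esub> = frag_of (cl unit)"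
  "\<zero>\<^bsub>R\<^esub> = 0" "add R = (+)"
  by (auto simp: class_group_ring_def fmul_def fun_eq_iff)

lemma fmul_add_left: "fmul (f + f') g = fmul f g + fmul f' g"
  unfolding fmul_def
  by (rule keys_sum_add[where g = "\<lambda>A a. \<Sum>B\<in>Poly_Mapping.keys g.
        Poly_Mapping.single (class_tensor Ob isom ten A B) (a * Poly_Mapping.lookup g B)"])
    (simp_all add: distrib_right single_add sum.distrib)

lemma fmul_add_right: "fmul f (g + g') = fmul f g + fmul f g'"
proof -
  have "(\<Sum>B\<in>Poly_Mapping.keys (g + g'). Poly_Mapping.single (class_tensor Ob isom ten A B) (a * Poly_Mapping.lookup (g + g') B))
    = (\<Sum>B\<in>Poly_Mapping.keys g. Poly_Mapping.single (class_tensor Ob isom ten A B) (a * Poly_Mapping.lookup g B))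
      + (\<Sum>B\<in>Poly_Mapping.keys g'. Poly_Mapping.single (class_tensor Ob isom ten A B) (a * Poly_Mapping.lookup g' B))" for A a
    by (rule keys_sum_add[where g = "\<lambda>B b. Poly_Mapping.single (class_tensor Ob isom ten A B) (a * b)"])
      (simp_all add: distrib_left single_add)
  then show ?thesis by (simp add: fmul_def sum.distrib)
qed

lemma fmul_zero [simp]: "fmul 0 g = 0" "fmul f 0 = 0"
  by (simp_all add: fmul_def)

lemma fmul_diff: "fmul (f - f') g = fmul f g - fmul f' g" "fmul f (g - g') = fmul f g - fmul f g'"
  using fmul_add_left[of "f - f'" f' g] fmul_add_right[of f "g - g'" g']
  by (simp_all add: eq_diff_eq)

lemma fmul_frag:
  assumes "U \<in> Ob" "V \<in> Ob"
  shows "fmul (frag_of (cl U)) (frag_of (cl V)) = frag_of (cl (ten U V))"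
  by (simp add: fmul_def class_tensor_cl assms)

lemma keys_diff_subset:
  "Poly_Mapping.keys f \<subseteq> S \<Longrightarrow> Poly_Mapping.keys g \<subseteq> S \<Longrightarrow> Poly_Mapping.keys (f - g :: 'o set \<Rightarrow>\<^sub>0 int) \<subseteq> S"
  using keys_diff[of f g] by blast

lemma class_induct [consumes 1, case_names zero cl diff]:
  assumes "Poly_Mapping.keys f \<subseteq> cl ` Ob" and "P 0" and "\<And>U. U \<in> Ob \<Longrightarrow> P (frag_of (cl U))"
    and "\<And>a b. P a \<Longrightarrow> P b \<Longrightarrow> P (a - b)"
  shows "P f"
  using assms(1) by (rule frag_induction) (use assms in auto)

lemma fmul_closed:
  assumes "Poly_Mapping.keys f \<subseteq> cl ` Ob" "Poly_Mapping.keys g \<subseteq> cl ` Ob"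
  shows "Poly_Mapping.keys (fmul f g) \<subseteq> cl ` Ob"
  using assms(1)
proof (induction f rule: class_induct)
  case (cl U)
  show ?case using assms(2)
  proof (induction g rule: class_induct)
    case (cl V)
    then show ?case using \<open>U \<in> Ob\<close> by (simp add: fmul_frag ten_closed)
  qed (simp_all add: fmul_diff keys_diff_subset)
qed (simp_all add: fmul_diff keys_diff_subset)

lemma fmul_assoc:
  assumes "Poly_Mapping.keys f \<subseteq> cl ` Ob" "Poly_Mapping.keys g \<subseteq> cl ` Ob" "Poly_Mapping.keys h \<subseteq> cl ` Ob"
  shows "fmul (fmul f g) h = fmul f (fmul g h)"
  using assms(1)
proof (induction f rule: class_induct)
  case (cl U)
  show ?case using assms(2)
  proof (induction g rule: class_induct)
    case (cl V)
    show ?case using assms(3)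
    proof (induction h rule: class_induct)
      case (cl W)
      then have "cl (ten (ten U V) W) = cl (ten U (ten V W))"
        using \<open>U \<in> Ob\<close> \<open>V \<in> Ob\<close> by (simp add: ten_closed cl_eq_iff ten_assoc)
      then show ?case using cl \<open>U \<in> Ob\<close> \<open>V \<in> Ob\<close> by (simp add: fmul_frag ten_closed)
    qed (simp_all add: fmul_diff)
  qed (simp_all add: fmul_diff)
qed (simp_all add: fmul_diff)

lemma fmul_one:
  assumes "Poly_Mapping.keys f \<subseteq> cl ` Ob"
  shows "fmul (frag_of (cl unit)) f = f" "fmul f (frag_of (cl unit)) = f"
proof -
  have *: "frag_of (cl (ten unit U)) = frag_of (cl U)" "frag_of (cl (ten U unit)) = frag_of (cl U)" if "U \<in> Ob" for U
    using that cl_eq_iff[of "ten unit U" U] cl_eq_iff[of "ten U unit" U] by (simp_all add: ten_closed unit_closed ten_unit)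
  show "fmul (frag_of (cl unit)) f = f"
    using assms by (induction f rule: class_induct) (simp_all add: fmul_frag unit_closed * fmul_diff)
  show "fmul f (frag_of (cl unit)) = f"
    using assms by (induction f rule: class_induct) (simp_all add: fmul_frag unit_closed * fmul_diff)
qed

lemma ring_R: "ring R"
proof (rule ringI)
  have add: "Poly_Mapping.keys (f + g) \<subseteq> S" if "Poly_Mapping.keys f \<subseteq> S" "Poly_Mapping.keys g \<subseteq> S"
    for f g :: "'o set \<Rightarrow>\<^sub>0 int" and S
    using that Poly_Mapping.keys_add[of f g] by blast
  show "abelian_group R"
  proof (rule abelian_groupI)
    fix x assume "x \<in> carrier R"
    then show "\<exists>y\<in>carrier R. y \<oplus>\<^bsub>R\<^esub> x = \<zero>\<^bsub>R\<^esub>" by (intro bexI[of _ "- x"]) simp_all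
  qed (simp_all add: add ac_simps)
  show "monoid R"
    by (rule monoidI) (simp_all add: fmul_closed fmul_assoc fmul_one unit_closed)
qed (simp_all add: fmul_add_left fmul_add_right)

lemma add_monoid_R: "add_monoid R = free_Abelian_group (cl ` Ob)"
  by (simp add: free_Abelian_group_def)

lemma ses_relators_subset: "ses_relators Ob isom ses \<subseteq> carrier (free_Abelian_group (cl ` Ob))"
proof
  fix r assume "r \<in> ses_relators Ob isom ses"
  then obtain U W V where "U \<in> Ob" "W \<in> Ob" "V \<in> Ob" "r = frag_of (cl W) - frag_of (cl U) - frag_of (cl V)"
    unfolding ses_relators_def by blast
  then show "r \<in> carrier (free_Abelian_group (cl ` Ob))" by (simp add: keys_diff_subset)
qed

lemma subgroup_I: "subgroup I (free_Abelian_group (cl ` Ob))"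
  using group.generate_is_subgroup[OF group_free_Abelian_group ses_relators_subset] .

lemma I_keys: "a \<in> I \<Longrightarrow> Poly_Mapping.keys a \<subseteq> cl ` Ob"
  using subgroup.mem_carrier[OF subgroup_I] by simp

lemma I_zero: "0 \<in> I"
  using subgroup.one_closed[OF subgroup_I] by simp

lemma I_add: "a \<in> I \<Longrightarrow> b \<in> I \<Longrightarrow> a + b \<in> I"
  using subgroup.m_closed[OF subgroup_I, of a b] by simp

lemma I_diff: "a \<in> I \<Longrightarrow> b \<in> I \<Longrightarrow> a - b \<in> I"
  using subgroup.m_inv_closed[OF subgroup_I, of b] I_add[of a "- b"] I_keys[of b] by simp

lemma ses_in_I:
  "U \<in> Ob \<Longrightarrow> W \<in> Ob \<Longrightarrow> V \<in> Ob \<Longrightarrow> ses U W V \<Longrightarrow> frag_of (cl W) - frag_of (cl U) - frag_of (cl V) \<in> I"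
  by (rule generate.incl) (auto simp: ses_relators_def)

text \<open>Exactness of the tensor product in each variable makes the subgroup of relators a
  two-sided ideal; on generators of both sides it sends relators to relators.\<close>

lemma fmul_I:
  assumes "a \<in> I" and x: "Poly_Mapping.keys x \<subseteq> cl ` Ob"
  shows "fmul x a \<in> I \<and> fmul a x \<in> I"
proof -
  have rel: "fmul x r \<in> I \<and> fmul r x \<in> I" if rel: "r \<in> ses_relators Ob isom ses" for r
  proof -
    obtain U W V where r: "U \<in> Ob" "W \<in> Ob" "V \<in> Ob" "ses U W V" "r = frag_of (cl W) - frag_of (cl U) - frag_of (cl V)"
      using rel unfolding ses_relators_def by blast
    show ?thesis using x
    proof (induction x rule: class_induct)
      case (cl X)
      then show ?case
        using r ses_in_I[OF _ _ _ ses_ten(1)[OF r(1-3) cl r(4)]] ses_in_I[OF _ _ _ ses_ten(2)[OF r(1-3) cl r(4)]]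
        by (simp add: fmul_diff fmul_frag ten_closed)
    qed (simp_all add: I_zero fmul_diff I_diff)
  qed
  show ?thesis using assms(1)
  proof induction
    case (inv h)
    then have "inv\<^bsub>free_Abelian_group (cl ` Ob)\<^esub> h = 0 - h" using ses_relators_subset by auto
    then show ?case using rel[OF inv] by (simp only: fmul_diff fmul_zero I_diff I_zero simp_thms)
  qed (simp_all add: I_zero rel fmul_add_left fmul_add_right I_add)
qed

lemma ideal_I: "ideal I R"
proof (rule idealI)
  show "ring R" by (rule ring_R)
  show "subgroup I (add_monoid R)" using subgroup_I unfolding add_monoid_R .
qed (use fmul_I in auto)

lemma I_trans: "a - b \<in> I \<Longrightarrow> b - c \<in> I \<Longrightarrow> a - c \<in> I"
  using I_add[of "a - b" "b - c"] by simp

lemma I_sym: "a - b \<in> I \<Longrightarrow> b - a \<in> I"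
  using I_diff[OF I_zero, of "a - b"] by simp

lemma I_mult:
  assumes "a - a' \<in> I" "b - b' \<in> I" and "Poly_Mapping.keys a' \<subseteq> cl ` Ob" "Poly_Mapping.keys b \<subseteq> cl ` Ob"
  shows "fmul a b - fmul a' b' \<in> I"
proof -
  have "fmul (a - a') b + fmul a' (b - b') \<in> I"
    by (intro I_add conjunct1[OF fmul_I] conjunct2[OF fmul_I] assms)
  then show ?thesis by (simp add: fmul_diff)
qed

theorem cring_grothendieck_ring:
  assumes comm: "\<And>U V. U \<in> Ob \<Longrightarrow> V \<in> Ob \<Longrightarrow> frag_of (cl (ten U V)) - frag_of (cl (ten V U)) \<in> I"
  shows "cring (grothendieck_ring Ob isom ses ten unit)"
proof -
  interpret ideal I R by (rule ideal_I)
  have fc: "fmul f g - fmul g f \<in> I" if f: "Poly_Mapping.keys f \<subseteq> cl ` Ob" and g: "Poly_Mapping.keys g \<subseteq> cl ` Ob" for f g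
    using f
  proof (induction f rule: class_induct)
    case (cl U)
    show ?case using g
    proof (induction g rule: class_induct)
      case (cl V)
      then show ?case using comm[OF \<open>U \<in> Ob\<close> cl] \<open>U \<in> Ob\<close> by (simp add: fmul_frag)
    next
      case (diff a b)
      from I_diff[OF this] show ?case by (simp add: fmul_diff algebra_simps)
    qed (simp add: I_zero)
  next
    case (diff a b)
    from I_diff[OF this] show ?case by (simp add: fmul_diff algebra_simps)
  qed (simp add: I_zero)
  have ring: "ring (R Quot I)" by (rule quotient_is_ring)
  moreover have "comm_monoid (R Quot I)"
  proof (rule monoid.monoid_comm_monoidI)
    show "monoid (R Quot I)" using ring by (rule ring.is_monoid)
    fix x y assume "x \<in> carrier (R Quot I)" "y \<in> carrier (R Quot I)"
    then obtain f g where fg: "f \<in> carrier R" "g \<in> carrier R" "x = I +>\<^bsub>R\<^esub> f" "y = I +>\<^bsub>R\<^esub> g"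
      by (auto simp: FactRing_def A_RCOSETS_def')
    have k: "Poly_Mapping.keys f \<subseteq> cl ` Ob" "Poly_Mapping.keys g \<subseteq> cl ` Ob" using fg by auto
    have "fmul f g \<in> I +>\<^bsub>R\<^esub> fmul g f"
      unfolding a_r_coset_def' using fc[OF k] by (auto intro!: bexI[of _ "fmul f g - fmul g f"])
    then have "I +>\<^bsub>R\<^esub> fmul g f = I +>\<^bsub>R\<^esub> fmul f g"
      using k by (intro a_repr_independence') (simp_all add: fmul_closed)
    then show "x \<otimes>\<^bsub>R Quot I\<^esub> y = y \<otimes>\<^bsub>R Quot I\<^esub> x"
      using rcoset_mult_add[OF fg(1,2)] rcoset_mult_add[OF fg(2,1)] by (simp add: FactRing_def fg(3,4))
  qed
  ultimately show ?thesis unfolding grothendieck_ring_def by (rule cring.intro)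
qed

end

section \<open>The Grothendieck ring of type 1 representations\<close>

lemma tensor_category_uq_reps:
  assumes q: "generic_parameter q"
  shows "tensor_category (uq_reps q) (rep_iso q) (rep_ses q) (rep_tensor q) rep_unit"
proof
  fix U V W
  show "U \<in> uq_reps q \<Longrightarrow> rep_iso q U U" by (rule rep_iso_refl)
  show "rep_iso q U V \<Longrightarrow> rep_iso q V U" by (rule rep_iso_sym)
  show "U \<in> uq_reps q \<Longrightarrow> V \<in> uq_reps q \<Longrightarrow> W \<in> uq_reps q \<Longrightarrow> rep_iso q U V \<Longrightarrow> rep_iso q V W \<Longrightarrow> rep_iso q U W"
    by (rule rep_iso_trans)
  show "U \<in> uq_reps q \<Longrightarrow> V \<in> uq_reps q \<Longrightarrow> rep_tensor q U V \<in> uq_reps q" by (rule rep_tensor_in_reps[OF _ _ q])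
  show "rep_unit \<in> uq_reps q" by (rule rep_unit(1)[OF q])
qed (rule rep_iso_tensor[OF q] rep_tensor_assoc[OF q] rep_tensor_unit[OF q] rep_ses_tensor_left[OF q] rep_ses_tensor_right[OF q]; assumption)+

text \<open>Induction on the dimension. A reducible representation sits in a sequence A -> U -> B
  whose dual runs backwards, from the dual of B to the dual of A; as only the sum of the outer
  classes counts, the reversal is invisible in the quotient.\<close>

lemma class_dual:
  assumes q: "generic_parameter q" and "V \<in> uq_reps q"
  shows "frag_of (iso_class (uq_reps q) (rep_iso q) V) - frag_of (iso_class (uq_reps q) (rep_iso q) (dual q V))
    \<in> generate (free_Abelian_group (iso_class (uq_reps q) (rep_iso q) ` uq_reps q))
        (ses_relators (uq_reps q) (rep_iso q) (rep_ses q))"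
  using assms(2)
proof (induction "fst V" arbitrary: V rule: less_induct)
  case less
  interpret tensor_category "uq_reps q" "rep_iso q" "rep_ses q" "rep_tensor q" rep_unit
    by (rule tensor_category_uq_reps[OF q])
  note V = less.prems and d = dual(1)[OF q]
  have iso: "frag_of (cl V) - frag_of (cl (dual q V)) \<in> I" if "rep_iso q V (dual q V)"
    using that cl_eq_iff[OF V d[OF V]] I_zero by simp
  obtain U w where U: "U \<in> uq_reps q" "fst U = fst V" "act q U (gen (K N1)) = qdiag q (fst U) w" "rep_iso q V U"
    using rep_diagonal_form[OF q V] .
  consider "fst V = 0" | "fst V > 0" "irreducible_rep q U" | "\<not> irreducible_rep q U" by blast
  then show "frag_of (cl V) - frag_of (cl (dual q V)) \<in> I"
  proof cases
    case 1
    have "act q V (gen x) = act q (dual q V) (gen x)" for x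
      using act_gen_carrier[OF V, of "gen x"] act_gen_carrier[OF d[OF V], of "gen x"] 1
      by (intro eq_matI) (auto simp: dual(2)[OF q V])
    then show ?thesis by (intro iso rep_iso_same V d) (simp add: dual(2)[OF q V])
  next
    case 2
    have "rep_iso q U (dual q U)" using irreducible_rep_self_dual[OF q U(1) _ U(3)] 2 U(2) by simp
    moreover have "rep_iso q (dual q U) (dual q V)" by (rule rep_iso_dual[OF q U(1) V rep_iso_sym[OF U(4)]])
    ultimately show ?thesis
      using rep_iso_trans[OF V U(1) d[OF U(1)] U(4)] rep_iso_trans[OF V d[OF U(1)] d[OF V]] by (blast intro: iso)
  next
    case 3
    obtain A B where AB: "A \<in> uq_reps q" "B \<in> uq_reps q" "fst A < fst U" "fst B < fst U" "rep_ses q A U B"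
      using reducible_rep_splits[OF q U(1,3) 3] .
    have eq: "cl V = cl U" "cl (dual q V) = cl (dual q U)"
      using U rep_iso_dual[OF q V U(1,4)] by (simp_all add: cl_eq_iff V d)
    have IH: "frag_of (cl A) - frag_of (cl (dual q A)) \<in> I" "frag_of (cl B) - frag_of (cl (dual q B)) \<in> I"
      using AB U(2) by (auto intro!: less.hyps)
    have ses: "frag_of (cl U) - frag_of (cl A) - frag_of (cl B) \<in> I"
      "frag_of (cl (dual q U)) - frag_of (cl (dual q B)) - frag_of (cl (dual q A)) \<in> I"
      by (rule ses_in_I[OF AB(1) U(1) AB(2,5)], rule ses_in_I[OF d d d rep_ses_dual[OF q AB(1) U(1) AB(2,5)]])
        (fact AB U)+
    from I_add[OF I_diff[OF ses] I_add[OF IH]] show ?thesis by (simp add: eq algebra_simps)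
  qed
qed

lemma cring_Rep_ring:
  assumes q: "generic_parameter q"
  shows "cring (Rep_ring q)"
proof -
  interpret tensor_category "uq_reps q" "rep_iso q" "rep_ses q" "rep_tensor q" rep_unit
    by (rule tensor_category_uq_reps[OF q])
  note d = dual(1)[OF q]
  have "frag_of (cl (rep_tensor q V W)) - frag_of (cl (rep_tensor q W V)) \<in> I"
    if V: "V \<in> uq_reps q" and W: "W \<in> uq_reps q" for V W
  proof -
    note dVW = class_dual[OF q ten_closed[OF V W]]
    have "cl (dual q (rep_tensor q V W)) = cl (rep_tensor q (dual q W) (dual q V))"
      using dual_tensor[OF q V W] V W by (simp add: cl_eq_iff ten_closed d)
    then have "frag_of (cl (dual q (rep_tensor q V W))) = fmul (frag_of (cl (dual q W))) (frag_of (cl (dual q V)))"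
      using V W by (simp add: fmul_frag d)
    moreover have "fmul (frag_of (cl (dual q W))) (frag_of (cl (dual q V))) - fmul (frag_of (cl W)) (frag_of (cl V)) \<in> I"
      using V W by (intro I_mult I_sym[OF class_dual[OF q]]) (simp_all add: d)
    ultimately show ?thesis using I_trans[OF dVW] V W by (simp add: fmul_frag)
  qed
  then show ?thesis unfolding Rep_ring_def by (rule cring_grothendieck_ring)
qed

lemma generic_parameterI:
  fixes q :: complex
  assumes "q \<noteq> 0" and "\<not> algebraic q"
  shows "generic_parameter q"
proof
  show "q \<noteq> 0" by fact
  fix m :: nat assume "m > 0"
  show "q ^ m \<noteq> 1"
  proof
    assume "q ^ m = 1"
    let ?p = "monom 1 m - 1 :: complex poly"
    have "coeff ?p m = 1" using \<open>m > 0\<close> by simp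
    then have "?p \<noteq> 0" by (metis coeff_0 zero_neq_one)
    then have "algebraic q"
      by (rule algebraicI[rotated]) (auto simp: poly_monom \<open>q ^ m = 1\<close> coeff_monom coeff_1)
    with assms(2) show False by simp
  qed
qed

theorem corollary2p3p2p14:
  fixes q :: complex
  assumes "q \<noteq> 0" and "\<not> algebraic q"
  shows "cring (Rep_ring q)"
  using assms by (intro cring_Rep_ring generic_parameterI)

end
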